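(* Let $(A,C,\psi)$ be an entwining structure over a field $k$ and let $((R^\bullet,D^\bullet),C,\Psi^\bullet)$, with $k$-algebra homomorphism $\rho:A\to R^0$, be a dg-entwining structure over $(A,C,\psi)$. Then there is an induced morphism $\hat\rho:(\Omega^\bullet A,d^\bullet)\to(R^\bullet,D^\bullet)$ of dg-algebras such that $\hat\rho|_A=\rho:A\to R^0$ and $$(\hat\rho\otimes id_C)\circ\hat\psi=\Psi\circ(id_C\otimes\hat\rho):C\otimes\Omega A\to R\otimes C.$$
   Context: Let $k$ be a field; $\otimes$ is over $k$. An entwining structure $(A,C,\psi)$ over $k$ consists of a unital associative $k$-algebra $A$ with product $\theta$, a counital coassociative $k$-coalgebra $C$ (coproduct $\Delta$, counit $\varepsilon$), and a $k$-linear map $\psi:C\otimes A\to A\otimes C$, written $\psi(c\otimes a)=a_\psi\otimes c^\psi$ with summation suppressed, such that: (i) $\psi\circ(id_C\otimes\theta)=(\theta\otimes id_C)\circ(id_A\otimes\psi)\circ(\psi\otimes id_A)$; (ii) $(id_A\otimes\Delta)\circ\psi=(\psi\otimes id_C)\circ(id_C\otimes\psi)\circ(\Delta\otimes id_A)$; (iii) $a_\psi\,\varepsilon(c^\psi)=\varepsilon(c)a$; (iv) $1_\psi\otimes c^\psi=1\otimes c$. For a non-unital algebra, "entwining structure" means (i)–(iii) only. Iterating, $a_{1\psi}\otimes\cdots\otimes a_{m\psi}\otimes c^{\psi^m}$ denotes the image of $c\otimes a_1\otimes\cdots\otimes a_m$ under the map $C\otimes A^{\otimes m}\to A^{\otimes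 m}\otimes C$ that moves $C$ past $a_1$, then $a_2$, ..., then $a_m$ by $\psi$. A dg-entwining structure $((R^\bullet,D^\bullet),C,\Psi^\bullet)$ consists of a non-negatively graded, not necessarily unital, differential graded $k$-algebra $(R^\bullet,D^\bullet)$ (differential of degree $+1$), a counital coalgebra $C$ and a degree-zero $k$-linear map $\Psi^\bullet:C\otimes R^\bullet\to R^\bullet\otimes C$ with $(D\otimes id_C)\circ\Psi=\Psi\circ(id_C\otimes D)$ and such that $(R,C,\Psi)$ is an entwining structure (in the possibly non-unital sense). A dg-entwining structure over $(A,C,\psi)$ is such a structure together with a (not necessarily unital) $k$-algebra morphism $\rho:A\to R^0$ satisfying $(\rho\otimes id_C)\circ\psi=\Psi^0\circ(id_C\otimes\rho)$. Universal dg-algebra: let $\tilde A=A\oplus k$ with $(a+\mu)(a'+\nu)=(aa'+\mu a'+\nu a)+\mu\nu$. Put $\Omega^0A=A$ and $\Omega^nA=\tilde A\otimes A^{\otimes n}$ for $n>0$; the element $(a_0+\mu)\otimes a_1\otimes\cdots\otimes a_n$ is written $(a_0+\mu)da_1\cdots da_n$ (with $\mu=0$ understood when $n=0$). The product is determined by $a_0da_1\cdots da_n=(a_0)\cdot(da_1)\cdots(da_n)$, $da_1\cdots da_n=(da_1)\cdots(da_n)$ and $(da)\cdot a'=d(aa')-a(da')$; explicitly, for $i\ge1$, $$((p_0+\mu)dp_1\cdots dp_i)\cdot((q_0+\nu)dq_1\cdots dq_j)=(p_0+\mu)\Big(dp_1\cdots dp_{i-1}d(p_iq_0)dq_1\cdots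 dq_j+\sum_{l=1}^{i-1}(-1)^{i-l}dp_1\cdots d(p_lp_{l+1})\cdots dp_i\,dq_0\cdots dq_j\Big)$$ $$+(-1)^i(p_0+\mu)p_1dp_2\cdots dp_i\,dq_0\cdots dq_j+\nu(p_0+\mu)dp_1\cdots dp_idq_1\cdots dq_j,$$ and $p_0\cdot((q_0+\nu)dq_1\cdots dq_j)=(p_0q_0+\nu p_0)dq_1\cdots dq_j$. The differential is $d((a_0+\mu)da_1\cdots da_n)=da_0da_1\cdots da_n$. The map $\hat\psi:C\otimes\Omega A\to\Omega A\otimes C$ is $$\hat\psi(c\otimes(a_0+\mu)da_1\cdots da_n)=(a_{0\psi}da_{1\psi}\cdots da_{n\psi})\otimes c^{\psi^{n+1}}+\mu(da_{1\psi}\cdots da_{n\psi})\otimes c^{\psi^n}.$$ *)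

theory Defs
  imports "HOL-Algebra.Module" "HOL-Algebra.AbelCoset"
begin

section \<open>Modules presented by generators and relations\<close>

text \<open>Vector spaces over a field \<open>K\<close> are \<open>module\<close> records over \<open>K\<close>. The ring fields \<open>mult\<close> and
  \<open>one\<close> of such a record play no role unless an algebra is meant.\<close>

definition free_module :: "('k, 'm) ring_scheme \<Rightarrow> 's set \<Rightarrow> ('k, 's \<Rightarrow> 'k) module" where
  "free_module K S =
    \<lparr>carrier = {f. range f \<subseteq> carrier K \<and> finite {s. f s \<noteq> \<zero>\<^bsub>K\<^esub>} \<and> (\<forall>s. s \<notin> S \<longrightarrow> f s = \<zero>\<^bsub>K\<^esub>)},
     mult = (\<lambda>_ _. undefined), one = undefined,
     zero = (\<lambda>_. \<zero>\<^bsub>K\<^esub>), add = (\<lambda>f g s. f s \<oplus>\<^bsub>K\<^esub> g s), smult = (\<lambda>k f s. k \<otimes>\<^bsub>K\<^esub> f s)\<rparr>"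

definition basis_vec :: "('k, 'm) ring_scheme \<Rightarrow> 's \<Rightarrow> 's \<Rightarrow> 'k" where
  "basis_vec K s = (\<lambda>t. if t = s then \<one>\<^bsub>K\<^esub> else \<zero>\<^bsub>K\<^esub>)"

definition mspan :: "('k, 'm) ring_scheme \<Rightarrow> ('k, 'v, 'n) module_scheme \<Rightarrow> 'v set \<Rightarrow> 'v set" where
  "mspan K M G = \<Inter>{H. submodule H K M \<and> G \<subseteq> H}"

definition quotient_module ::
    "('k, 'v, 'n) module_scheme \<Rightarrow> 'v set \<Rightarrow> ('k, 'v set) module" where
  "quotient_module M N =
    \<lparr>carrier = a_rcosets\<^bsub>M\<^esub> N,
     mult = (\<lambda>_ _. undefined), one = undefined,
     zero = N, add = set_add M, smult = (\<lambda>k X. \<Union>x\<in>X. N +>\<^bsub>M\<^esub> (k \<odot>\<^bsub>M\<^esub> x))\<rparr>"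

definition presented ::
    "('k, 'm) ring_scheme \<Rightarrow> 's set \<Rightarrow> ('s \<Rightarrow> 'k) set \<Rightarrow> ('k, ('s \<Rightarrow> 'k) set) module" where
  "presented K S Rel = quotient_module (free_module K S) (mspan K (free_module K S) Rel)"

definition gen ::
    "('k, 'm) ring_scheme \<Rightarrow> 's set \<Rightarrow> ('s \<Rightarrow> 'k) set \<Rightarrow> 's \<Rightarrow> ('s \<Rightarrow> 'k) set" where
  "gen K S Rel s = mspan K (free_module K S) Rel +>\<^bsub>free_module K S\<^esub> basis_vec K s"

text \<open>The linear map into \<open>P\<close> out of a presented module that sends each generator \<open>s\<close> to \<open>f s\<close>.
  The choice of a representative is immaterial as soon as \<open>f\<close> respects the relations, which is
  the case in all uses below.\<close>

definition lift ::
    "('k, 'm) ring_scheme \<Rightarrow> ('k, 'p, 'n) module_scheme \<Rightarrow> ('s \<Rightarrow> 'p) \<Rightarrow> ('s \<Rightarrow> 'k) set \<Rightarrow> 'p" where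
  "lift K P f X = (let x = (SOME x. x \<in> X) in
     (\<Oplus>\<^bsub>P\<^esub>s\<in>{s. x s \<noteq> \<zero>\<^bsub>K\<^esub>}. x s \<odot>\<^bsub>P\<^esub> f s))"

text \<open>The relations saying that \<open>x \<mapsto> w x\<close>, from \<open>M\<close> to generators in \<open>S\<close>, is linear. With \<open>w\<close>
  the insertion into one slot of a tensor these are the defining relations of tensor products.\<close>

definition linear_rels ::
    "('k, 'm) ring_scheme \<Rightarrow> 's set \<Rightarrow> ('k, 'v, 'n) module_scheme \<Rightarrow> ('v \<Rightarrow> 's) \<Rightarrow> ('s \<Rightarrow> 'k) set" where
  "linear_rels K S M w =
     {basis_vec K (w (x \<oplus>\<^bsub>M\<^esub> y)) \<ominus>\<^bsub>free_module K S\<^esub>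
        (basis_vec K (w x) \<oplus>\<^bsub>free_module K S\<^esub> basis_vec K (w y)) | x y.
        x \<in> carrier M \<and> y \<in> carrier M}
   \<union> {basis_vec K (w (k \<odot>\<^bsub>M\<^esub> x)) \<ominus>\<^bsub>free_module K S\<^esub>
        (k \<odot>\<^bsub>free_module K S\<^esub> basis_vec K (w x)) | k x.
        k \<in> carrier K \<and> x \<in> carrier M}"

definition linear_maps ::
    "('k, 'm) ring_scheme \<Rightarrow> ('k, 'v, 'n) module_scheme \<Rightarrow> ('k, 'w, 'o) module_scheme \<Rightarrow> ('v \<Rightarrow> 'w) set"
  where
  "linear_maps K M N = {f \<in> carrier M \<rightarrow> carrier N.
     (\<forall>x\<in>carrier M. \<forall>y\<in>carrier M. f (x \<oplus>\<^bsub>M\<^esub> y) = f x \<oplus>\<^bsub>N\<^esub> f y) \<and>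
     (\<forall>k\<in>carrier K. \<forall>x\<in>carrier M. f (k \<odot>\<^bsub>M\<^esub> x) = k \<odot>\<^bsub>N\<^esub> f x)}"


section \<open>Tensor products\<close>

definition tensor_rels ::
    "('k, 'm) ring_scheme \<Rightarrow> ('k, 'v, 'n) module_scheme \<Rightarrow> ('k, 'w, 'o) module_scheme
      \<Rightarrow> ('v \<times> 'w \<Rightarrow> 'k) set" where
  "tensor_rels K M N =
     (\<Union>y\<in>carrier N. linear_rels K (carrier M \<times> carrier N) M (\<lambda>x. (x, y)))
   \<union> (\<Union>x\<in>carrier M. linear_rels K (carrier M \<times> carrier N) N (\<lambda>y. (x, y)))"

definition tensor ::
    "('k, 'm) ring_scheme \<Rightarrow> ('k, 'v, 'n) module_scheme \<Rightarrow> ('k, 'w, 'o) module_scheme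
      \<Rightarrow> ('k, ('v \<times> 'w \<Rightarrow> 'k) set) module" where
  "tensor K M N = presented K (carrier M \<times> carrier N) (tensor_rels K M N)"

text \<open>\<open>tens K M N x y\<close> is the pure tensor of \<open>x\<close> in \<open>M\<close> and \<open>y\<close> in \<open>N\<close>.\<close>

definition tens ::
    "('k, 'm) ring_scheme \<Rightarrow> ('k, 'v, 'n) module_scheme \<Rightarrow> ('k, 'w, 'o) module_scheme
      \<Rightarrow> 'v \<Rightarrow> 'w \<Rightarrow> ('v \<times> 'w \<Rightarrow> 'k) set" where
  "tens K M N x y = gen K (carrier M \<times> carrier N) (tensor_rels K M N) (x, y)"

text \<open>The map induced by \<open>f\<close> and \<open>g\<close> on tensor products; \<open>M\<close> and \<open>N\<close> are the codomains.\<close>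

definition tensor_map ::
    "('k, 'm) ring_scheme \<Rightarrow> ('k, 'v, 'n) module_scheme \<Rightarrow> ('k, 'w, 'o) module_scheme
      \<Rightarrow> ('x \<Rightarrow> 'v) \<Rightarrow> ('y \<Rightarrow> 'w) \<Rightarrow> ('x \<times> 'y \<Rightarrow> 'k) set \<Rightarrow> ('v \<times> 'w \<Rightarrow> 'k) set" where
  "tensor_map K M N f g = lift K (tensor K M N) (\<lambda>(x, y). tens K M N (f x) (g y))"

text \<open>\<open>(L \<otimes> M) \<otimes> N \<rightarrow> L \<otimes> (M \<otimes> N)\<close> and its inverse.\<close>

definition assoc_r ::
    "('k, 'm) ring_scheme \<Rightarrow> ('k, 'u, 'l) module_scheme \<Rightarrow> ('k, 'v, 'n) module_scheme
      \<Rightarrow> ('k, 'w, 'o) module_scheme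
      \<Rightarrow> (('u \<times> 'v \<Rightarrow> 'k) set \<times> 'w \<Rightarrow> 'k) set \<Rightarrow> ('u \<times> ('v \<times> 'w \<Rightarrow> 'k) set \<Rightarrow> 'k) set" where
  "assoc_r K L M N = (let T = tensor K L (tensor K M N) in
     lift K T (\<lambda>(X, n). lift K T (\<lambda>(l, m). tens K L (tensor K M N) l (tens K M N m n)) X))"

definition assoc_l ::
    "('k, 'm) ring_scheme \<Rightarrow> ('k, 'u, 'l) module_scheme \<Rightarrow> ('k, 'v, 'n) module_scheme
      \<Rightarrow> ('k, 'w, 'o) module_scheme
      \<Rightarrow> ('u \<times> ('v \<times> 'w \<Rightarrow> 'k) set \<Rightarrow> 'k) set \<Rightarrow> (('u \<times> 'v \<Rightarrow> 'k) set \<times> 'w \<Rightarrow> 'k) set" where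
  "assoc_l K L M N = (let T = tensor K (tensor K L M) N in
     lift K T (\<lambda>(l, X). lift K T (\<lambda>(m, n). tens K (tensor K L M) N (tens K L M l m) n) X))"

text \<open>The tensor power of \<open>n\<close> copies of \<open>A\<close>; the generator \<open>[a\<^sub>1, \<dots>, a\<^sub>n]\<close> is the pure tensor
  of \<open>a\<^sub>1, \<dots>, a\<^sub>n\<close>.\<close>

definition tpow_words :: "('k, 'a, 'n) module_scheme \<Rightarrow> nat \<Rightarrow> 'a list set" where
  "tpow_words A n = {as \<in> lists (carrier A). length as = n}"

definition tpow_rels ::
    "('k, 'm) ring_scheme \<Rightarrow> ('k, 'a, 'n) module_scheme \<Rightarrow> nat \<Rightarrow> ('a list \<Rightarrow> 'k) set" where
  "tpow_rels K A n =
     (\<Union>(xs, ys)\<in>{(xs, ys). xs \<in> lists (carrier A) \<and> ys \<in> lists (carrier A) \<and>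
                          Suc (length xs + length ys) = n}.
        linear_rels K (tpow_words A n) A (\<lambda>x. xs @ x # ys))"

definition tpow ::
    "('k, 'm) ring_scheme \<Rightarrow> ('k, 'a, 'n) module_scheme \<Rightarrow> nat \<Rightarrow> ('k, ('a list \<Rightarrow> 'k) set) module" where
  "tpow K A n = presented K (tpow_words A n) (tpow_rels K A n)"

definition tpow_tens ::
    "('k, 'm) ring_scheme \<Rightarrow> ('k, 'a, 'n) module_scheme \<Rightarrow> 'a list \<Rightarrow> ('a list \<Rightarrow> 'k) set" where
  "tpow_tens K A as = gen K (tpow_words A (length as)) (tpow_rels K A (length as)) as"


section \<open>Algebras and coalgebras\<close>

locale nonunital_algebra = module K A for K (structure) and A (structure) +
  assumes mult_closed: "\<lbrakk>x \<in> carrier A; y \<in> carrier A\<rbrakk> \<Longrightarrow> x \<otimes>\<^bsub>A\<^esub> y \<in> carrier A"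
    and mult_assoc: "\<lbrakk>x \<in> carrier A; y \<in> carrier A; z \<in> carrier A\<rbrakk>
      \<Longrightarrow> (x \<otimes>\<^bsub>A\<^esub> y) \<otimes>\<^bsub>A\<^esub> z = x \<otimes>\<^bsub>A\<^esub> (y \<otimes>\<^bsub>A\<^esub> z)"
    and mult_distr_l: "\<lbrakk>x \<in> carrier A; y \<in> carrier A; z \<in> carrier A\<rbrakk>
      \<Longrightarrow> (x \<oplus>\<^bsub>A\<^esub> y) \<otimes>\<^bsub>A\<^esub> z = x \<otimes>\<^bsub>A\<^esub> z \<oplus>\<^bsub>A\<^esub> y \<otimes>\<^bsub>A\<^esub> z"
    and mult_distr_r: "\<lbrakk>x \<in> carrier A; y \<in> carrier A; z \<in> carrier A\<rbrakk>
      \<Longrightarrow> z \<otimes>\<^bsub>A\<^esub> (x \<oplus>\<^bsub>A\<^esub> y) = z \<otimes>\<^bsub>A\<^esub> x \<oplus>\<^bsub>A\<^esub> z \<otimes>\<^bsub>A\<^esub> y"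
    and smult_mult_l: "\<lbrakk>k \<in> carrier K; x \<in> carrier A; y \<in> carrier A\<rbrakk>
      \<Longrightarrow> (k \<odot>\<^bsub>A\<^esub> x) \<otimes>\<^bsub>A\<^esub> y = k \<odot>\<^bsub>A\<^esub> (x \<otimes>\<^bsub>A\<^esub> y)"
    and smult_mult_r: "\<lbrakk>k \<in> carrier K; x \<in> carrier A; y \<in> carrier A\<rbrakk>
      \<Longrightarrow> x \<otimes>\<^bsub>A\<^esub> (k \<odot>\<^bsub>A\<^esub> y) = k \<odot>\<^bsub>A\<^esub> (x \<otimes>\<^bsub>A\<^esub> y)"

text \<open>The locale \<open>algebra\<close> of HOL-Algebra is about commutative algebras.\<close>

locale unital_algebra = nonunital_algebra +
  assumes unit_closed: "\<one>\<^bsub>A\<^esub> \<in> carrier A"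
    and unit_l: "x \<in> carrier A \<Longrightarrow> \<one>\<^bsub>A\<^esub> \<otimes>\<^bsub>A\<^esub> x = x"
    and unit_r: "x \<in> carrier A \<Longrightarrow> x \<otimes>\<^bsub>A\<^esub> \<one>\<^bsub>A\<^esub> = x"

definition mult_map ::
    "('k, 'm) ring_scheme \<Rightarrow> ('k, 'a, 'n) module_scheme \<Rightarrow> ('a \<times> 'a \<Rightarrow> 'k) set \<Rightarrow> 'a" where
  "mult_map K A = lift K A (\<lambda>(a, b). a \<otimes>\<^bsub>A\<^esub> b)"

record ('k, 'c) coalg = "('k, 'c) module" +
  coprod :: "'c \<Rightarrow> ('c \<times> 'c \<Rightarrow> 'k) set"
  counit :: "'c \<Rightarrow> 'k"

locale coalgebra = module K C for K (structure) and C :: "('k, 'c, 'o) coalg_scheme" (structure) +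
  assumes coprod_linear: "coprod C \<in> linear_maps K C (tensor K C C)"
    and counit_closed: "c \<in> carrier C \<Longrightarrow> counit C c \<in> carrier K"
    and counit_add: "\<lbrakk>c \<in> carrier C; e \<in> carrier C\<rbrakk>
      \<Longrightarrow> counit C (c \<oplus>\<^bsub>C\<^esub> e) = counit C c \<oplus>\<^bsub>K\<^esub> counit C e"
    and counit_smult: "\<lbrakk>k \<in> carrier K; c \<in> carrier C\<rbrakk>
      \<Longrightarrow> counit C (k \<odot>\<^bsub>C\<^esub> c) = k \<otimes>\<^bsub>K\<^esub> counit C c"
    and coassoc: "c \<in> carrier C
      \<Longrightarrow> assoc_r K C C C (tensor_map K (tensor K C C) C (coprod C) id (coprod C c))
        = tensor_map K C (tensor K C C) id (coprod C) (coprod C c)"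
    and counit_l: "c \<in> carrier C \<Longrightarrow> lift K C (\<lambda>(c1, c2). counit C c1 \<odot>\<^bsub>C\<^esub> c2) (coprod C c) = c"
    and counit_r: "c \<in> carrier C \<Longrightarrow> lift K C (\<lambda>(c1, c2). counit C c2 \<odot>\<^bsub>C\<^esub> c1) (coprod C c) = c"


section \<open>Entwining structures\<close>

locale nonunital_entwining =
  nonunital_algebra K A + coalgebra K C
  for K :: "('k, 'm) ring_scheme" (structure)
    and A :: "('k, 'a, 'n) module_scheme" (structure)
    and C :: "('k, 'c, 'o) coalg_scheme" (structure)
    and \<psi> :: "('c \<times> 'a \<Rightarrow> 'k) set \<Rightarrow> ('a \<times> 'c \<Rightarrow> 'k) set" +
  assumes psi_linear: "\<psi> \<in> linear_maps K (tensor K C A) (tensor K A C)"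
    and psi_mult: "X \<in> carrier (tensor K C (tensor K A A))
      \<Longrightarrow> \<psi> (tensor_map K C A id (mult_map K A) X)
        = tensor_map K A C (mult_map K A) id
            (assoc_l K A A C
              (tensor_map K A (tensor K A C) id \<psi>
                (assoc_r K A C A
                  (tensor_map K (tensor K A C) A \<psi> id
                    (assoc_l K C A A X)))))"
    and psi_coprod: "Y \<in> carrier (tensor K C A)
      \<Longrightarrow> tensor_map K A (tensor K C C) id (coprod C) (\<psi> Y)
        = assoc_r K A C C
            (tensor_map K (tensor K A C) C \<psi> id
              (assoc_l K C A C
                (tensor_map K C (tensor K A C) id \<psi>
                  (assoc_r K C C A
                    (tensor_map K (tensor K C C) A (coprod C) id Y)))))"
    and psi_counit: "\<lbrakk>c \<in> carrier C; a \<in> carrier A\<rbrakk>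
      \<Longrightarrow> lift K A (\<lambda>(b, e). counit C e \<odot>\<^bsub>A\<^esub> b) (\<psi> (tens K C A c a)) = counit C c \<odot>\<^bsub>A\<^esub> a"

locale entwining = nonunital_entwining K A C \<psi> + unital_algebra K A
  for K (structure) and A (structure) and C (structure) and \<psi> +
  assumes psi_unit: "c \<in> carrier C \<Longrightarrow> \<psi> (tens K C A c \<one>\<^bsub>A\<^esub>) = tens K A C \<one>\<^bsub>A\<^esub> c"


section \<open>Differential graded algebras\<close>

record ('k, 'r) dg_alg = "('k, 'r) module" +
  grade :: "nat \<Rightarrow> 'r set"
  diff :: "'r \<Rightarrow> 'r"

locale dg_algebra = nonunital_algebra K R
  for K (structure) and R :: "('k, 'r, 'n) dg_alg_scheme" (structure) +
  assumes grade_submodule: "submodule (grade R n) K R"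
    and grade_direct_sum: "x \<in> carrier R
      \<Longrightarrow> \<exists>!f. (\<forall>n. f n \<in> grade R n) \<and> finite {n. f n \<noteq> \<zero>\<^bsub>R\<^esub>} \<and>
             x = (\<Oplus>\<^bsub>R\<^esub>n\<in>{n. f n \<noteq> \<zero>\<^bsub>R\<^esub>}. f n)"
    and grade_mult: "\<lbrakk>x \<in> grade R i; y \<in> grade R j\<rbrakk> \<Longrightarrow> x \<otimes>\<^bsub>R\<^esub> y \<in> grade R (i + j)"
    and diff_linear: "diff R \<in> linear_maps K R R"
    and diff_grade: "x \<in> grade R n \<Longrightarrow> diff R x \<in> grade R (Suc n)"
    and diff_diff: "x \<in> carrier R \<Longrightarrow> diff R (diff R x) = \<zero>\<^bsub>R\<^esub>"
    and diff_mult: "\<lbrakk>x \<in> grade R n; y \<in> carrier R\<rbrakk>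
      \<Longrightarrow> diff R (x \<otimes>\<^bsub>R\<^esub> y)
        = diff R x \<otimes>\<^bsub>R\<^esub> y \<oplus>\<^bsub>R\<^esub> ((\<ominus>\<^bsub>K\<^esub> \<one>\<^bsub>K\<^esub>) [^]\<^bsub>K\<^esub> n) \<odot>\<^bsub>R\<^esub> (x \<otimes>\<^bsub>R\<^esub> diff R y)"

definition dg_algebra_hom ::
    "('k, 'm) ring_scheme \<Rightarrow> ('k, 'r, 'n) dg_alg_scheme \<Rightarrow> ('k, 's, 'o) dg_alg_scheme \<Rightarrow> ('r \<Rightarrow> 's) set"
  where
  "dg_algebra_hom K R S = {f \<in> linear_maps K R S.
     (\<forall>x\<in>carrier R. \<forall>y\<in>carrier R. f (x \<otimes>\<^bsub>R\<^esub> y) = f x \<otimes>\<^bsub>S\<^esub> f y) \<and>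
     (\<forall>n. f ` grade R n \<subseteq> grade S n) \<and>
     (\<forall>x\<in>carrier R. f (diff R x) = diff S (f x))}"

locale dg_entwining = dg_algebra K R + nonunital_entwining K R C \<Psi>
  for K :: "('k, 'm) ring_scheme" (structure)
    and R :: "('k, 'r, 'n) dg_alg_scheme" (structure)
    and C :: "('k, 'c, 'o) coalg_scheme" (structure)
    and \<Psi> :: "('c \<times> 'r \<Rightarrow> 'k) set \<Rightarrow> ('r \<times> 'c \<Rightarrow> 'k) set" +
  assumes Psi_degree: "\<Psi> ` mspan K (tensor K C R) {tens K C R c r | c r. c \<in> carrier C \<and> r \<in> grade R n}
      \<subseteq> mspan K (tensor K R C) {tens K R C r c | r c. r \<in> grade R n \<and> c \<in> carrier C}"
    and Psi_diff: "X \<in> carrier (tensor K C R)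
      \<Longrightarrow> tensor_map K R C (diff R) id (\<Psi> X) = \<Psi> (tensor_map K C R id (diff R) X)"

text \<open>Here \<open>\<rho>\<close> need not send \<open>\<one>\<^bsub>A\<^esub>\<close> to a unit, even if \<open>R\<close> happens to have one.\<close>

locale dg_entwining_over =
  entwining K A C \<psi> + dg_entwining K R C \<Psi>
  for K :: "('k, 'm) ring_scheme" (structure)
    and A :: "('k, 'a, 'l) module_scheme" (structure)
    and C :: "('k, 'c, 'o) coalg_scheme" (structure)
    and \<psi>
    and R :: "('k, 'r, 'n) dg_alg_scheme" (structure)
    and \<Psi>
    and \<rho> :: "'a \<Rightarrow> 'r" +
  assumes rho_linear: "\<rho> \<in> linear_maps K A R"
    and rho_grade: "a \<in> carrier A \<Longrightarrow> \<rho> a \<in> grade R 0"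
    and rho_mult: "\<lbrakk>a \<in> carrier A; b \<in> carrier A\<rbrakk> \<Longrightarrow> \<rho> (a \<otimes>\<^bsub>A\<^esub> b) = \<rho> a \<otimes>\<^bsub>R\<^esub> \<rho> b"
    and rho_psi: "X \<in> carrier (tensor K C A)
      \<Longrightarrow> tensor_map K R C \<rho> id (\<psi> X) = \<Psi> (tensor_map K C R id \<rho> X)"


section \<open>The universal differential graded algebra\<close>

definition unitization ::
    "('k, 'm) ring_scheme \<Rightarrow> ('k, 'a, 'n) module_scheme \<Rightarrow> ('k, 'a \<times> 'k) module" where
  "unitization K A =
    \<lparr>carrier = carrier A \<times> carrier K,
     mult = (\<lambda>(a, \<mu>) (b, \<nu>). (a \<otimes>\<^bsub>A\<^esub> b \<oplus>\<^bsub>A\<^esub> \<mu> \<odot>\<^bsub>A\<^esub> b \<oplus>\<^bsub>A\<^esub> \<nu> \<odot>\<^bsub>A\<^esub> a, \<mu> \<otimes>\<^bsub>K\<^esub> \<nu>)),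
     one = (\<zero>\<^bsub>A\<^esub>, \<one>\<^bsub>K\<^esub>),
     zero = (\<zero>\<^bsub>A\<^esub>, \<zero>\<^bsub>K\<^esub>),
     add = (\<lambda>(a, \<mu>) (b, \<nu>). (a \<oplus>\<^bsub>A\<^esub> b, \<mu> \<oplus>\<^bsub>K\<^esub> \<nu>)),
     smult = (\<lambda>k (a, \<mu>). (k \<odot>\<^bsub>A\<^esub> a, k \<otimes>\<^bsub>K\<^esub> \<mu>))\<rparr>"

text \<open>The generator \<open>((a, \<mu>), [a\<^sub>1, \<dots>, a\<^sub>n])\<close> stands for \<open>(a + \<mu>) da\<^sub>1 \<dots> da\<^sub>n\<close>. The relations are those
  of the tensor product of \<open>unitization K A\<close> with \<open>n\<close> copies of \<open>A\<close> when \<open>n > 0\<close>, and those of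
  \<open>A\<close> when \<open>n = 0\<close>. No relation mixes different \<open>n\<close>, so the presented module is the direct sum
  of these spaces over all \<open>n\<close>.\<close>

definition omega_gens ::
    "('k, 'm) ring_scheme \<Rightarrow> ('k, 'a, 'n) module_scheme \<Rightarrow> (('a \<times> 'k) \<times> 'a list) set" where
  "omega_gens K A = {((a, \<mu>), as). a \<in> carrier A \<and> \<mu> \<in> carrier K \<and> as \<in> lists (carrier A) \<and>
                                  (as = [] \<longrightarrow> \<mu> = \<zero>\<^bsub>K\<^esub>)}"

definition omega_rels ::
    "('k, 'm) ring_scheme \<Rightarrow> ('k, 'a, 'n) module_scheme \<Rightarrow> (('a \<times> 'k) \<times> 'a list \<Rightarrow> 'k) set" where
  "omega_rels K A =
     linear_rels K (omega_gens K A) A (\<lambda>a. ((a, \<zero>\<^bsub>K\<^esub>), []))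
   \<union> (\<Union>as\<in>lists (carrier A) - {[]}. linear_rels K (omega_gens K A) (unitization K A) (\<lambda>p. (p, as)))
   \<union> (\<Union>(p, xs, ys)\<in>carrier (unitization K A) \<times> lists (carrier A) \<times> lists (carrier A).
        linear_rels K (omega_gens K A) A (\<lambda>x. (p, xs @ x # ys)))"

definition omega_module ::
    "('k, 'm) ring_scheme \<Rightarrow> ('k, 'a, 'n) module_scheme
      \<Rightarrow> ('k, (('a \<times> 'k) \<times> 'a list \<Rightarrow> 'k) set) module" where
  "omega_module K A = presented K (omega_gens K A) (omega_rels K A)"

definition omega_gen ::
    "('k, 'm) ring_scheme \<Rightarrow> ('k, 'a, 'n) module_scheme
      \<Rightarrow> 'a \<times> 'k \<Rightarrow> 'a list \<Rightarrow> (('a \<times> 'k) \<times> 'a list \<Rightarrow> 'k) set" where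
  "omega_gen K A p as = gen K (omega_gens K A) (omega_rels K A) (p, as)"

text \<open>The product of \<open>(p\<^sub>0 + \<mu>) dp\<^sub>1 \<dots> dp\<^sub>i\<close> and \<open>(q\<^sub>0 + \<nu>) dq\<^sub>1 \<dots> dq\<^sub>j\<close>. Lists are indexed from
  \<open>0\<close>, so \<open>p\<^sub>l\<close> is \<open>ps ! (l - 1)\<close>. If \<open>i = 0\<close> then \<open>\<mu> = 0\<close>, and the first coefficient below is
  \<open>p\<^sub>0q\<^sub>0 + \<nu>p\<^sub>0\<close>.\<close>

fun omega_gen_mult ::
    "('k, 'm) ring_scheme \<Rightarrow> ('k, 'a, 'n) module_scheme
      \<Rightarrow> ('a \<times> 'k) \<times> 'a list \<Rightarrow> ('a \<times> 'k) \<times> 'a list \<Rightarrow> (('a \<times> 'k) \<times> 'a list \<Rightarrow> 'k) set" where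
  "omega_gen_mult K A (p, ps) ((q0, \<nu>), qs) =
    (let W = omega_module K A; i = length ps; sgn = (\<lambda>n::nat. (\<ominus>\<^bsub>K\<^esub> \<one>\<^bsub>K\<^esub>) [^]\<^bsub>K\<^esub> n) in
     if ps = [] then omega_gen K A (p \<otimes>\<^bsub>unitization K A\<^esub> (q0, \<nu>)) qs
     else omega_gen K A p (butlast ps @ (last ps \<otimes>\<^bsub>A\<^esub> q0) # qs)
       \<oplus>\<^bsub>W\<^esub> (\<Oplus>\<^bsub>W\<^esub>l\<in>{1..<i}. sgn (i - l) \<odot>\<^bsub>W\<^esub>
              omega_gen K A p (take (l - 1) ps @ (ps ! (l - 1) \<otimes>\<^bsub>A\<^esub> ps ! l) # drop (l + 1) ps @ q0 # qs))
       \<oplus>\<^bsub>W\<^esub> sgn i \<odot>\<^bsub>W\<^esub> omega_gen K A (p \<otimes>\<^bsub>unitization K A\<^esub> (hd ps, \<zero>\<^bsub>K\<^esub>)) (tl ps @ q0 # qs)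
       \<oplus>\<^bsub>W\<^esub> \<nu> \<odot>\<^bsub>W\<^esub> omega_gen K A p (ps @ qs))"

text \<open>The universal dg-algebra is not unital in general; the field \<open>one\<close> is not used.\<close>

definition Omega ::
    "('k, 'm) ring_scheme \<Rightarrow> ('k, 'a, 'n) module_scheme
      \<Rightarrow> ('k, (('a \<times> 'k) \<times> 'a list \<Rightarrow> 'k) set) dg_alg" where
  "Omega K A = (let W = omega_module K A in
    \<lparr>carrier = carrier W,
     mult = (\<lambda>X Y. lift K W (\<lambda>p. lift K W (\<lambda>q. omega_gen_mult K A p q) Y) X),
     one = undefined,
     zero = zero W, add = add W, smult = smult W,
     grade = (\<lambda>n. mspan K W {omega_gen K A p as | p as. (p, as) \<in> omega_gens K A \<and> length as = n}),
     diff = lift K W (\<lambda>((a, \<mu>), as). omega_gen K A (\<zero>\<^bsub>A\<^esub>, \<one>\<^bsub>K\<^esub>) (a # as))\<rparr>)"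

definition Omega_incl ::
    "('k, 'm) ring_scheme \<Rightarrow> ('k, 'a, 'n) module_scheme \<Rightarrow> 'a \<Rightarrow> (('a \<times> 'k) \<times> 'a list \<Rightarrow> 'k) set" where
  "Omega_incl K A a = omega_gen K A (a, \<zero>\<^bsub>K\<^esub>) []"

text \<open>\<open>psi_iter K A C \<psi> c [a\<^sub>1, \<dots>, a\<^sub>m]\<close> moves \<open>c\<close> past \<open>a\<^sub>1\<close>, then past \<open>a\<^sub>2\<close>, and so on. The result
  is in \<open>tensor K (tpow K A m) C\<close>.\<close>

fun psi_iter ::
    "('k, 'm) ring_scheme \<Rightarrow> ('k, 'a, 'n) module_scheme \<Rightarrow> ('k, 'c, 'o) module_scheme
      \<Rightarrow> (('c \<times> 'a \<Rightarrow> 'k) set \<Rightarrow> ('a \<times> 'c \<Rightarrow> 'k) set)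
      \<Rightarrow> 'c \<Rightarrow> 'a list \<Rightarrow> (('a list \<Rightarrow> 'k) set \<times> 'c \<Rightarrow> 'k) set" where
  "psi_iter K A C \<psi> c [] = tens K (tpow K A 0) C (tpow_tens K A []) c"
| "psi_iter K A C \<psi> c (a # as) =
    (let T = tpow K A (Suc (length as)) in
     lift K (tensor K T C)
       (\<lambda>(b, e). tensor_map K T C (lift K T (\<lambda>bs. tpow_tens K A (b # bs))) id (psi_iter K A C \<psi> e as))
       (\<psi> (tens K C A c a)))"

text \<open>The two linear maps \<open>omega_word\<close> and \<open>omega_dword\<close> send \<open>a\<^sub>0 \<otimes> a\<^sub>1 \<otimes> \<dots> \<otimes> a\<^sub>n\<close> to
  \<open>a\<^sub>0 da\<^sub>1 \<dots> da\<^sub>n\<close>, and \<open>a\<^sub>1 \<otimes> \<dots> \<otimes> a\<^sub>n\<close> (with \<open>n > 0\<close>) to \<open>da\<^sub>1 \<dots> da\<^sub>n\<close>.\<close>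

definition omega_word ::
    "('k, 'm) ring_scheme \<Rightarrow> ('k, 'a, 'n) module_scheme
      \<Rightarrow> ('a list \<Rightarrow> 'k) set \<Rightarrow> (('a \<times> 'k) \<times> 'a list \<Rightarrow> 'k) set" where
  "omega_word K A = lift K (Omega K A) (\<lambda>as. omega_gen K A (hd as, \<zero>\<^bsub>K\<^esub>) (tl as))"

definition omega_dword ::
    "('k, 'm) ring_scheme \<Rightarrow> ('k, 'a, 'n) module_scheme
      \<Rightarrow> ('a list \<Rightarrow> 'k) set \<Rightarrow> (('a \<times> 'k) \<times> 'a list \<Rightarrow> 'k) set" where
  "omega_dword K A = lift K (Omega K A) (\<lambda>as. omega_gen K A (\<zero>\<^bsub>A\<^esub>, \<one>\<^bsub>K\<^esub>) as)"

text \<open>In degree \<open>0\<close> only \<open>\<mu> = 0\<close> occurs, so the second summand is absent.\<close>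

definition psi_hat ::
    "('k, 'm) ring_scheme \<Rightarrow> ('k, 'a, 'n) module_scheme \<Rightarrow> ('k, 'c, 'o) module_scheme
      \<Rightarrow> (('c \<times> 'a \<Rightarrow> 'k) set \<Rightarrow> ('a \<times> 'c \<Rightarrow> 'k) set)
      \<Rightarrow> ('c \<times> (('a \<times> 'k) \<times> 'a list \<Rightarrow> 'k) set \<Rightarrow> 'k) set
      \<Rightarrow> ((('a \<times> 'k) \<times> 'a list \<Rightarrow> 'k) set \<times> 'c \<Rightarrow> 'k) set" where
  "psi_hat K A C \<psi> = (let W = Omega K A; WC = tensor K W C in
     lift K WC (\<lambda>(c, X). lift K WC (\<lambda>((a, \<mu>), as).
       tensor_map K W C (omega_word K A) id (psi_iter K A C \<psi> c (a # as))
       \<oplus>\<^bsub>WC\<^esub> (if as = [] then \<zero>\<^bsub>WC\<^esub>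
               else \<mu> \<odot>\<^bsub>WC\<^esub> tensor_map K W C (omega_dword K A) id (psi_iter K A C \<psi> c as))) X))"

end

theory Submission
  imports Defs
begin

text \<open>Write \<open>D\<close> for the differential of \<open>R\<close>. A morphism of dg-algebras that extends \<open>\<rho>\<close> has to send
  \<open>a\<^sub>0 da\<^sub>1 \<dots> da\<^sub>n\<close> to \<open>\<rho>(a\<^sub>0) D\<rho>(a\<^sub>1) \<dots> D\<rho>(a\<^sub>n)\<close> and \<open>da\<^sub>1 \<dots> da\<^sub>n\<close> to \<open>D\<rho>(a\<^sub>1) \<dots> D\<rho>(a\<^sub>n)\<close>, and
  this prescription, multilinear in the \<open>a\<^sub>i\<close>, defines the map \<open>hat\<close>. It commutes with the
  differentials because \<open>D\<close> kills every \<open>D\<rho>(a\<^sub>i)\<close>, so that only the leading factor contributes to the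
  Leibniz rule (\<open>diff_word_mult\<close>, \<open>hat_diff\<close>).

  The product formula of the universal algebra comes from the rule \<open>dx q = d(xq) - x dq\<close>, used to move
  a factor \<open>q\<close> of degree zero leftwards through \<open>dx\<^sub>1 \<dots> dx\<^sub>i\<close>. In \<open>R\<close> the same rule holds for \<open>\<rho>\<close> and
  \<open>D\<rho>\<close>, since \<open>D(\<rho>(x)\<rho>(q)) = D\<rho>(x) \<rho>(q) + \<rho>(x) D\<rho>(q)\<close> (\<open>drho_mult\<close>). Moving \<open>\<rho>(q)\<close> leftwards in
  \<open>R\<close> therefore produces the image of the product formula term by term, by induction on \<open>i\<close>
  (\<open>hat_gen_mult_rho\<close>), and this is the multiplicativity of \<open>hat\<close>.

  For the entwining maps, call a linear map \<open>\<sigma>: A \<rightarrow> R\<close> entwined if \<open>(\<sigma> \<otimes> id)\<psi> = \<Psi>(id \<otimes> \<sigma>)\<close>. Both \<open>\<rho>\<close>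
  and \<open>D\<rho>\<close> are entwined, the latter because \<open>\<Psi>\<close> commutes with \<open>D\<close>. The multiplicativity axiom of \<open>\<Psi>\<close>
  says that \<open>c\<close> is moved past a product by being moved past its factors in turn (\<open>psi_mult_tens\<close>).
  Moving \<open>c\<close> past a product of values of entwined maps therefore amounts to moving it past the
  arguments by \<open>\<psi>\<close> first and applying the maps afterwards (\<open>psi_iter_head_word\<close>). Up to linearity,
  this is the required identity between \<open>psi_hat\<close> and \<open>\<Psi>\<close>.

  All spaces involved are modules given by generators and relations, and all maps out of them are
  formed by \<open>lift\<close>, which evaluates at a chosen representative. The working tool is \<open>lift_compare\<close>: to
  identify \<open>L(lift f X)\<close> with \<open>H X\<close>, where \<open>L\<close> and \<open>H\<close> are linear, it suffices to check \<open>L(f s) = H s\<close> on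
  generators \<open>s\<close>, whichever representative is chosen. It reduces each of the above identities
  to one about generators.\<close>

section \<open>Linear maps\<close>

locale scalars = cring K for K (structure)
begin

lemma linear_mapsI:
  assumes "\<And>x. x \<in> carrier M \<Longrightarrow> f x \<in> carrier N"
    and "\<And>x y. \<lbrakk>x \<in> carrier M; y \<in> carrier M\<rbrakk> \<Longrightarrow> f (x \<oplus>\<^bsub>M\<^esub> y) = f x \<oplus>\<^bsub>N\<^esub> f y"
    and "\<And>k x. \<lbrakk>k \<in> carrier K; x \<in> carrier M\<rbrakk> \<Longrightarrow> f (k \<odot>\<^bsub>M\<^esub> x) = k \<odot>\<^bsub>N\<^esub> f x"
  shows "f \<in> linear_maps K M N"
  using assms unfolding linear_maps_def by auto

lemma linear_closed: "\<lbrakk>f \<in> linear_maps K M N; x \<in> carrier M\<rbrakk> \<Longrightarrow> f x \<in> carrier N"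
  unfolding linear_maps_def by auto

lemma linear_add:
  "\<lbrakk>f \<in> linear_maps K M N; x \<in> carrier M; y \<in> carrier M\<rbrakk> \<Longrightarrow> f (x \<oplus>\<^bsub>M\<^esub> y) = f x \<oplus>\<^bsub>N\<^esub> f y"
  unfolding linear_maps_def by auto

lemma linear_smult:
  "\<lbrakk>f \<in> linear_maps K M N; k \<in> carrier K; x \<in> carrier M\<rbrakk> \<Longrightarrow> f (k \<odot>\<^bsub>M\<^esub> x) = k \<odot>\<^bsub>N\<^esub> f x"
  unfolding linear_maps_def by auto

lemma linear_zero:
  assumes "module K M" "module K N" "f \<in> linear_maps K M N"
  shows "f \<zero>\<^bsub>M\<^esub> = \<zero>\<^bsub>N\<^esub>"
proof -
  interpret M: module K M by fact
  interpret N: module K N by fact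
  have "f \<zero>\<^bsub>M\<^esub> = f (\<zero> \<odot>\<^bsub>M\<^esub> \<zero>\<^bsub>M\<^esub>)" by simp
  also have "\<dots> = \<zero> \<odot>\<^bsub>N\<^esub> f \<zero>\<^bsub>M\<^esub>"
    by (rule linear_smult[OF assms(3)]) simp_all
  also have "\<dots> = \<zero>\<^bsub>N\<^esub>"
    using linear_closed[OF assms(3)] by simp
  finally show ?thesis .
qed

lemma linear_comp:
  "\<lbrakk>f \<in> linear_maps K M N; g \<in> linear_maps K N P\<rbrakk> \<Longrightarrow> (\<lambda>x. g (f x)) \<in> linear_maps K M P"
  unfolding linear_maps_def by (auto simp: Pi_iff)

lemma linear_id: "id \<in> linear_maps K M M"
  unfolding linear_maps_def by auto

lemma linear_sum:
  assumes "module K N" "f \<in> linear_maps K M N" "g \<in> linear_maps K M N"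
  shows "(\<lambda>x. f x \<oplus>\<^bsub>N\<^esub> g x) \<in> linear_maps K M N"
proof -
  interpret N: module K N by fact
  note [simp] = linear_closed[OF assms(2)] linear_closed[OF assms(3)]
    linear_add[OF assms(2)] linear_add[OF assms(3)] linear_smult[OF assms(2)] linear_smult[OF assms(3)]
  show ?thesis by (rule linear_mapsI) (simp_all add: N.a_ac N.smult_r_distr)
qed

lemma linear_scale:
  assumes "module K N" "f \<in> linear_maps K M N" "c \<in> carrier K"
  shows "(\<lambda>x. c \<odot>\<^bsub>N\<^esub> f x) \<in> linear_maps K M N"
proof -
  interpret N: module K N by fact
  note [simp] = linear_closed[OF assms(2)] linear_add[OF assms(2)] linear_smult[OF assms(2)]
  show ?thesis using assms(3)
    by (intro linear_mapsI) (simp_all add: N.smult_r_distr N.smult_assoc1[symmetric] m_comm)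
qed

lemma linear_const_zero: "module K N \<Longrightarrow> (\<lambda>x. \<zero>\<^bsub>N\<^esub>) \<in> linear_maps K M N"
proof -
  assume "module K N"
  then interpret N: module K N .
  show ?thesis by (rule linear_mapsI) simp_all
qed

lemma linear_finsum:
  assumes "module K M" "module K N" "f \<in> linear_maps K M N" "finite T" "g \<in> T \<rightarrow> carrier M"
  shows "f (\<Oplus>\<^bsub>M\<^esub>t\<in>T. g t) = (\<Oplus>\<^bsub>N\<^esub>t\<in>T. f (g t))"
proof -
  interpret M: module K M by fact
  interpret N: module K N by fact
  show ?thesis using assms(4,5)
  proof (induct T)
    case empty
    show ?case by (simp add: linear_zero[OF assms(1-3)])
  next
    case (insert t T)
    then have "g t \<in> carrier M" "g \<in> T \<rightarrow> carrier M" by auto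
    moreover have "(\<lambda>t. f (g t)) \<in> T \<rightarrow> carrier N"
      using insert linear_closed[OF assms(3)] by auto
    ultimately show ?case using insert linear_closed[OF assms(3)]
      by (simp add: linear_add[OF assms(3)])
  qed
qed

lemma submodule_vimage:
  assumes "module K M" "module K N" "f \<in> linear_maps K M N" "submodule H K N"
  shows "submodule {x \<in> carrier M. f x \<in> H} K M"
proof -
  interpret M: module K M by fact
  interpret N: module K N by fact
  note H = N.submoduleE[OF assms(4)]
  have z: "\<zero>\<^bsub>N\<^esub> \<in> H"
    using assms(4) unfolding submodule_def using subgroup.one_closed by fastforce
  have "f (\<ominus>\<^bsub>M\<^esub> x) = \<ominus>\<^bsub>N\<^esub> (f x)" if "x \<in> carrier M" for x
  proof -
    have "f (\<ominus>\<^bsub>M\<^esub> x) = f ((\<ominus> \<one>) \<odot>\<^bsub>M\<^esub> x)" using that by (simp add: M.smult_l_minus)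
    also have "\<dots> = \<ominus>\<^bsub>N\<^esub> (f x)"
      using that linear_closed[OF assms(3)] by (simp add: linear_smult[OF assms(3)] N.smult_l_minus)
    finally show ?thesis .
  qed
  then show ?thesis
    by (intro M.submoduleI)
      (auto simp: z H linear_zero[OF assms(1-3)] linear_add[OF assms(3)] linear_smult[OF assms(3)])
qed


section \<open>Free modules\<close>

lemma free_module_simps:
  "carrier (free_module K S) =
    {f. range f \<subseteq> carrier K \<and> finite {s. f s \<noteq> \<zero>} \<and> (\<forall>s. s \<notin> S \<longrightarrow> f s = \<zero>)}"
  "\<zero>\<^bsub>free_module K S\<^esub> = (\<lambda>_. \<zero>)"
  "f \<oplus>\<^bsub>free_module K S\<^esub> g = (\<lambda>s. f s \<oplus> g s)"
  "k \<odot>\<^bsub>free_module K S\<^esub> f = (\<lambda>s. k \<otimes> f s)"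
  by (simp_all add: free_module_def)

lemma free_module_closed:
  "x \<in> carrier (free_module K S) \<Longrightarrow> x s \<in> carrier K"
  "x \<in> carrier (free_module K S) \<Longrightarrow> finite {s. x s \<noteq> \<zero>}"
  "x \<in> carrier (free_module K S) \<Longrightarrow> s \<notin> S \<Longrightarrow> x s = \<zero>"
  by (auto simp: free_module_simps)

lemma free_module_module: "module K (free_module K S)"
proof (rule moduleI)
  let ?F = "free_module K S"
  show "cring K" ..
  have add: "(\<lambda>s. x s \<oplus> y s) \<in> carrier ?F" if "x \<in> carrier ?F" "y \<in> carrier ?F" for x y
  proof -
    have "finite {s. x s \<oplus> y s \<noteq> \<zero>}"
      by (rule finite_subset[of _ "{s. x s \<noteq> \<zero>} \<union> {s. y s \<noteq> \<zero>}"])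
        (use that in \<open>auto simp: free_module_simps\<close>)
    then show ?thesis using that by (auto simp: free_module_simps)
  qed
  show smult: "k \<odot>\<^bsub>?F\<^esub> x \<in> carrier ?F" if "k \<in> carrier K" "x \<in> carrier ?F" for k x
  proof -
    have "finite {s. k \<otimes> x s \<noteq> \<zero>}"
      by (rule finite_subset[of _ "{s. x s \<noteq> \<zero>}"])
        (use that in \<open>auto simp: free_module_simps\<close>)
    then show ?thesis using that by (auto simp: free_module_simps)
  qed
  show "abelian_group ?F"
  proof (rule abelian_groupI)
    show "\<exists>y\<in>carrier ?F. y \<oplus>\<^bsub>?F\<^esub> x = \<zero>\<^bsub>?F\<^esub>" if "x \<in> carrier ?F" for x
      using smult[OF _ that, of "\<ominus> \<one>"] free_module_closed(1)[OF that]
      by (intro bexI[of _ "(\<ominus> \<one>) \<odot>\<^bsub>?F\<^esub> x"]) (auto simp: free_module_simps l_minus l_neg)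
  qed (auto simp: free_module_simps(2-4) add free_module_closed(1) a_ac,
      auto simp: free_module_simps)
qed (auto simp: free_module_simps(2-4) free_module_closed(1) l_distr r_distr m_assoc)

lemma basis_vec_closed: "s \<in> S \<Longrightarrow> basis_vec K s \<in> carrier (free_module K S)"
  by (auto simp: free_module_simps basis_vec_def)

text \<open>The value of \<open>lift\<close> at a coset is the value of this linear extension at a representative.\<close>

definition lin_ext :: "('a, 'p, 'n) module_scheme \<Rightarrow> ('s \<Rightarrow> 'p) \<Rightarrow> ('s \<Rightarrow> 'a) \<Rightarrow> 'p" where
  "lin_ext P f x = (\<Oplus>\<^bsub>P\<^esub>s\<in>{s. x s \<noteq> \<zero>}. x s \<odot>\<^bsub>P\<^esub> f s)"


lemma lift_eq_lin_ext: "lift K P f X = lin_ext P f (SOME x. x \<in> X)"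
  by (simp add: lift_def lin_ext_def Let_def)

text \<open>The supports of two vectors and of their sum differ. To compare the defining sums, they are taken
  over a common finite set.\<close>

lemma lin_ext_superset:
  assumes "module K P" "f \<in> S \<rightarrow> carrier P" "x \<in> carrier (free_module K S)"
    and "finite T" "{s. x s \<noteq> \<zero>} \<subseteq> T" "T \<subseteq> S"
  shows "lin_ext P f x = (\<Oplus>\<^bsub>P\<^esub>s\<in>T. x s \<odot>\<^bsub>P\<^esub> f s)"
proof -
  interpret P: module K P by fact
  show ?thesis unfolding lin_ext_def
    by (rule P.add.finprod_mono_neutral_cong_left)
      (use assms in \<open>auto simp: free_module_closed(1)[OF assms(3)] Pi_iff\<close>)
qed

lemma lin_ext_cong:
  assumes "module K P" "f \<in> S \<rightarrow> carrier P" "x \<in> carrier (free_module K S)"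
    and "\<And>s. s \<in> S \<Longrightarrow> f s = g s"
  shows "lin_ext P f x = lin_ext P g x"
proof -
  interpret P: module K P by fact
  show ?thesis unfolding lin_ext_def
  proof (rule P.finsum_cong')
    have inS: "s \<in> S" if "x s \<noteq> \<zero>" for s using that free_module_closed(3)[OF assms(3)] by blast
    show "(\<lambda>s. x s \<odot>\<^bsub>P\<^esub> g s) \<in> {s. x s \<noteq> \<zero>} \<rightarrow> carrier P"
      using assms(2,4) inS free_module_closed(1)[OF assms(3)] by (fastforce simp: Pi_iff)
    show "x s \<odot>\<^bsub>P\<^esub> f s = x s \<odot>\<^bsub>P\<^esub> g s" if "s \<in> {s. x s \<noteq> \<zero>}" for s
      using that assms(4) inS by simp
  qed simp
qed

lemma lin_ext_linear:
  assumes "module K P" "f \<in> S \<rightarrow> carrier P"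
  shows "lin_ext P f \<in> linear_maps K (free_module K S) P"
proof -
  interpret P: module K P by fact
  let ?F = "free_module K S"
  interpret F: module K ?F by (rule free_module_module)
  have supp: "finite {s. x s \<noteq> \<zero>}" "{s. x s \<noteq> \<zero>} \<subseteq> S" if "x \<in> carrier ?F" for x
    using free_module_closed[OF that] by auto
  have f: "f s \<in> carrier P" if "s \<in> S" for s using assms(2) that by auto
  show ?thesis
  proof (rule linear_mapsI)
    show closed: "lin_ext P f x \<in> carrier P" if "x \<in> carrier ?F" for x
      unfolding lin_ext_def
      by (rule P.finsum_closed) (use supp[OF that] free_module_closed(1)[OF that] f in blast)
    show "lin_ext P f (x \<oplus>\<^bsub>?F\<^esub> y) = lin_ext P f x \<oplus>\<^bsub>P\<^esub> lin_ext P f y"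
      if x: "x \<in> carrier ?F" and y: "y \<in> carrier ?F" for x y
    proof -
      let ?T = "{s. x s \<noteq> \<zero>} \<union> {s. y s \<noteq> \<zero>}"
      have T: "finite ?T" "?T \<subseteq> S" using supp[OF x] supp[OF y] by auto
      have fT: "f s \<in> carrier P" if "s \<in> ?T" for s using that T(2) f by blast
      have "{s. (x \<oplus>\<^bsub>?F\<^esub> y) s \<noteq> \<zero>} \<subseteq> ?T" by (auto simp: free_module_simps(3))
      then have "lin_ext P f (x \<oplus>\<^bsub>?F\<^esub> y) = (\<Oplus>\<^bsub>P\<^esub>s\<in>?T. (x \<oplus>\<^bsub>?F\<^esub> y) s \<odot>\<^bsub>P\<^esub> f s)"
        using T F.a_closed[OF x y] by (intro lin_ext_superset[OF assms])
      also have "\<dots> = (\<Oplus>\<^bsub>P\<^esub>s\<in>?T. x s \<odot>\<^bsub>P\<^esub> f s \<oplus>\<^bsub>P\<^esub> y s \<odot>\<^bsub>P\<^esub> f s)"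
        using fT free_module_closed(1)[OF x] free_module_closed(1)[OF y]
        by (intro P.finsum_cong') (auto simp: free_module_simps(3) P.smult_l_distr)
      also have "\<dots> = (\<Oplus>\<^bsub>P\<^esub>s\<in>?T. x s \<odot>\<^bsub>P\<^esub> f s) \<oplus>\<^bsub>P\<^esub> (\<Oplus>\<^bsub>P\<^esub>s\<in>?T. y s \<odot>\<^bsub>P\<^esub> f s)"
        using fT free_module_closed(1)[OF x] free_module_closed(1)[OF y]
        by (intro P.finsum_addf) (auto simp: Pi_iff)
      also have "\<dots> = lin_ext P f x \<oplus>\<^bsub>P\<^esub> lin_ext P f y"
        using T by (simp add: lin_ext_superset[OF assms x, of ?T] lin_ext_superset[OF assms y, of ?T])
      finally show ?thesis .
    qed
    show "lin_ext P f (k \<odot>\<^bsub>?F\<^esub> x) = k \<odot>\<^bsub>P\<^esub> lin_ext P f x"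
      if k: "k \<in> carrier K" and x: "x \<in> carrier ?F" for k x
    proof -
      let ?T = "{s. x s \<noteq> \<zero>}"
      have fT: "f s \<in> carrier P" if "s \<in> ?T" for s using that supp[OF x] f by blast
      have "{s. (k \<odot>\<^bsub>?F\<^esub> x) s \<noteq> \<zero>} \<subseteq> ?T" using k by (auto simp: free_module_simps(4))
      then have "lin_ext P f (k \<odot>\<^bsub>?F\<^esub> x) = (\<Oplus>\<^bsub>P\<^esub>s\<in>?T. (k \<odot>\<^bsub>?F\<^esub> x) s \<odot>\<^bsub>P\<^esub> f s)"
        using supp[OF x] F.smult_closed[OF k x] by (intro lin_ext_superset[OF assms])
      also have "\<dots> = (\<Oplus>\<^bsub>P\<^esub>s\<in>?T. k \<odot>\<^bsub>P\<^esub> (x s \<odot>\<^bsub>P\<^esub> f s))"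
        using fT free_module_closed(1)[OF x] k
        by (intro P.finsum_cong') (auto simp: free_module_simps(4) P.smult_assoc1)
      also have "\<dots> = k \<odot>\<^bsub>P\<^esub> lin_ext P f x" unfolding lin_ext_def
        using fT free_module_closed(1)[OF x] k supp[OF x]
        by (intro P.finsum_smult_ldistr[symmetric]) (auto simp: Pi_iff)
      finally show ?thesis .
    qed
  qed
qed

lemma lin_ext_basis_vec:
  assumes "module K P" "f \<in> S \<rightarrow> carrier P" "s \<in> S"
  shows "lin_ext P f (basis_vec K s) = f s"
proof -
  interpret P: module K P by fact
  have fs: "f s \<in> carrier P" using assms by auto
  have "lin_ext P f (basis_vec K s) = (\<Oplus>\<^bsub>P\<^esub>t\<in>{s}. basis_vec K s t \<odot>\<^bsub>P\<^esub> f t)"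
    by (rule lin_ext_superset[OF assms(1,2) basis_vec_closed[OF assms(3)]])
      (use assms(3) in \<open>auto simp: basis_vec_def split: if_splits\<close>)
  also have "\<dots> = basis_vec K s s \<odot>\<^bsub>P\<^esub> f s"
    using fs by (simp add: basis_vec_def)
  finally show ?thesis using fs by (simp add: basis_vec_def)
qed

text \<open>A linear map is determined by its values on basis vectors: by induction on a finite set that
  contains the support, with one basis vector split off in each step.\<close>

lemma linear_eq_lin_ext:
  assumes "module K P" "g \<in> linear_maps K (free_module K S) P" "x \<in> carrier (free_module K S)"
  shows "g x = lin_ext P (\<lambda>s. g (basis_vec K s)) x"
proof -
  interpret P: module K P by fact
  let ?F = "free_module K S"
  interpret F: module K ?F by (rule free_module_module)
  let ?h = "lin_ext P (\<lambda>s. g (basis_vec K s))"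
  have gb: "(\<lambda>s. g (basis_vec K s)) \<in> S \<rightarrow> carrier P"
    by (intro funcsetI linear_closed[OF assms(2)] basis_vec_closed)
  note h = lin_ext_linear[OF assms(1) gb]
  have main: "finite T \<Longrightarrow> x \<in> carrier ?F \<Longrightarrow> {s. x s \<noteq> \<zero>} \<subseteq> T \<Longrightarrow> T \<subseteq> S \<Longrightarrow> g x = ?h x" for T x
  proof (induct T arbitrary: x rule: finite_induct)
    case empty
    then have "x = \<zero>\<^bsub>?F\<^esub>" by (auto simp: free_module_simps(2))
    then show ?case
      using linear_zero[OF F.module_axioms assms(1) assms(2)] linear_zero[OF F.module_axioms assms(1) h]
      by simp
  next
    case (insert t T)
    define y where "y = (\<lambda>s. if s = t then \<zero> else x s)"
    define b where "b = x t \<odot>\<^bsub>?F\<^esub> basis_vec K t"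
    have t: "t \<in> S" using insert by auto
    have xt: "x t \<in> carrier K" using insert free_module_closed(1) by auto
    have y: "y \<in> carrier ?F"
    proof -
      have "finite {s. y s \<noteq> \<zero>}"
        by (rule finite_subset[of _ "{s. x s \<noteq> \<zero>}"])
          (use insert in \<open>auto simp: y_def free_module_closed\<close>)
      then show ?thesis using insert by (auto simp: y_def free_module_simps(1))
    qed
    have b: "b \<in> carrier ?F"
      unfolding b_def by (intro F.smult_closed xt basis_vec_closed t)
    have "x = y \<oplus>\<^bsub>?F\<^esub> b"
      using free_module_closed(1)[OF insert.prems(1)]
      by (auto simp: free_module_simps(3,4) y_def b_def basis_vec_def fun_eq_iff)
    moreover have "g y = ?h y"
      by (rule insert.hyps(3)) (use y insert in \<open>auto simp: y_def\<close>)
    moreover have "g b = ?h b"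
      unfolding b_def
      using xt basis_vec_closed[OF t] lin_ext_basis_vec[OF assms(1) gb t]
      by (simp add: linear_smult[OF assms(2)] linear_smult[OF h])
    ultimately show ?case using y b by (simp add: linear_add[OF assms(2)] linear_add[OF h])
  qed
  show ?thesis
    by (rule main[OF free_module_closed(2)[OF assms(3)] assms(3) subset_refl])
      (rule subsetI, simp, rule ccontr, simp add: free_module_closed(3)[OF assms(3)])
qed

lemma linear_lin_ext:
  assumes "module K P" "module K Q" "L \<in> linear_maps K P Q" "f \<in> S \<rightarrow> carrier P"
    "x \<in> carrier (free_module K S)"
  shows "L (lin_ext P f x) = lin_ext Q (\<lambda>s. L (f s)) x"
proof -
  note h = linear_comp[OF lin_ext_linear[OF assms(1,4)] assms(3)]
  have "L (lin_ext P f x) = lin_ext Q (\<lambda>s. L (lin_ext P f (basis_vec K s))) x"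
    by (rule linear_eq_lin_ext[OF assms(2) h assms(5)])
  also have "\<dots> = lin_ext Q (\<lambda>s. L (f s)) x"
  proof (rule lin_ext_cong[OF assms(2) _ assms(5)])
    show "(\<lambda>s. L (lin_ext P f (basis_vec K s))) \<in> S \<rightarrow> carrier Q"
      by (intro funcsetI linear_closed[OF h] basis_vec_closed)
    show "L (lin_ext P f (basis_vec K s)) = L (f s)" if "s \<in> S" for s
      by (simp only: lin_ext_basis_vec[OF assms(1,4) that])
  qed
  finally show ?thesis .
qed


section \<open>Modules given by generators and relations\<close>

text \<open>The module axioms are equations, so they descend along any surjection that respects the
  operations.\<close>

lemma module_surj_image:
  assumes M: "module K M" and carr: "carrier Q = p ` carrier M"
    and add: "\<And>x y. \<lbrakk>x \<in> carrier M; y \<in> carrier M\<rbrakk> \<Longrightarrow> p (x \<oplus>\<^bsub>M\<^esub> y) = p x \<oplus>\<^bsub>Q\<^esub> p y"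
    and smult: "\<And>k x. \<lbrakk>k \<in> carrier K; x \<in> carrier M\<rbrakk> \<Longrightarrow> p (k \<odot>\<^bsub>M\<^esub> x) = k \<odot>\<^bsub>Q\<^esub> p x"
    and zero: "\<zero>\<^bsub>Q\<^esub> = p \<zero>\<^bsub>M\<^esub>"
  shows "module K Q"
proof -
  interpret M: module K M by (rule M)
  have group: "abelian_group Q"
  proof (rule abelian_groupI)
    fix X assume "X \<in> carrier Q"
    then obtain x where x: "x \<in> carrier M" "X = p x" using carr by auto
    have "p (\<ominus>\<^bsub>M\<^esub> x) \<oplus>\<^bsub>Q\<^esub> X = \<zero>\<^bsub>Q\<^esub>"
      using add[of "\<ominus>\<^bsub>M\<^esub> x" x] x by (simp add: zero M.l_neg)
    then show "\<exists>Y\<in>carrier Q. Y \<oplus>\<^bsub>Q\<^esub> X = \<zero>\<^bsub>Q\<^esub>" using x carr by blast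
  next
    fix X Y assume "X \<in> carrier Q" "Y \<in> carrier Q"
    then obtain x y where x: "x \<in> carrier M" "X = p x" and y: "y \<in> carrier M" "Y = p y"
      using carr by auto
    show "X \<oplus>\<^bsub>Q\<^esub> Y \<in> carrier Q" using x y carr by (simp add: add[symmetric])
    show "X \<oplus>\<^bsub>Q\<^esub> Y = Y \<oplus>\<^bsub>Q\<^esub> X" using x y by (simp add: add[symmetric] M.a_comm)
    fix Z assume "Z \<in> carrier Q"
    then obtain z where z: "z \<in> carrier M" "Z = p z" using carr by auto
    show "X \<oplus>\<^bsub>Q\<^esub> Y \<oplus>\<^bsub>Q\<^esub> Z = X \<oplus>\<^bsub>Q\<^esub> (Y \<oplus>\<^bsub>Q\<^esub> Z)"
      using x y z by (simp add: add[symmetric] M.a_assoc)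
  next
    fix X assume "X \<in> carrier Q"
    then obtain x where x: "x \<in> carrier M" "X = p x" using carr by auto
    show "\<zero>\<^bsub>Q\<^esub> \<oplus>\<^bsub>Q\<^esub> X = X" using x by (simp add: zero add[symmetric])
  next
    show "\<zero>\<^bsub>Q\<^esub> \<in> carrier Q" using carr by (simp add: zero)
  qed
  show ?thesis
  proof (rule moduleI[OF is_cring group])
    fix a X assume a: "a \<in> carrier K" and "X \<in> carrier Q"
    then obtain x where x: "x \<in> carrier M" "X = p x" using carr by auto
    show "a \<odot>\<^bsub>Q\<^esub> X \<in> carrier Q" using a x carr by (simp add: smult[symmetric])
    fix b assume b: "b \<in> carrier K"
    show "(a \<oplus> b) \<odot>\<^bsub>Q\<^esub> X = a \<odot>\<^bsub>Q\<^esub> X \<oplus>\<^bsub>Q\<^esub> b \<odot>\<^bsub>Q\<^esub> X"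
      using a b x by (simp add: smult[symmetric] add[symmetric] M.smult_l_distr)
    show "(a \<otimes> b) \<odot>\<^bsub>Q\<^esub> X = a \<odot>\<^bsub>Q\<^esub> (b \<odot>\<^bsub>Q\<^esub> X)"
      using a b x by (simp add: smult[symmetric] M.smult_assoc1)
  next
    fix a X Y assume a: "a \<in> carrier K" and "X \<in> carrier Q" "Y \<in> carrier Q"
    then obtain x y where "x \<in> carrier M" "X = p x" "y \<in> carrier M" "Y = p y"
      using carr by auto
    then show "a \<odot>\<^bsub>Q\<^esub> (X \<oplus>\<^bsub>Q\<^esub> Y) = a \<odot>\<^bsub>Q\<^esub> X \<oplus>\<^bsub>Q\<^esub> a \<odot>\<^bsub>Q\<^esub> Y"
      using a by (simp add: smult[symmetric] add[symmetric] M.smult_r_distr)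
  next
    fix X assume "X \<in> carrier Q"
    then show "\<one> \<odot>\<^bsub>Q\<^esub> X = X" using carr by (auto simp: smult[symmetric])
  qed
qed

lemma mspan_submodule:
  assumes "module K M" "G \<subseteq> carrier M"
  shows "submodule (mspan K M G) K M"
proof -
  interpret M: module K M by fact
  have c: "carrier M \<in> {H. submodule H K M \<and> G \<subseteq> H}"
    by (intro CollectI conjI M.carrier_is_submodule assms(2))
  have z: "\<zero>\<^bsub>M\<^esub> \<in> H" if "submodule H K M" for H
    using that unfolding submodule_def using subgroup.one_closed by fastforce
  show ?thesis
    unfolding mspan_def
  proof (rule M.submoduleI)
    show "\<Inter>{H. submodule H K M \<and> G \<subseteq> H} \<subseteq> carrier M" using c by blast
  qed (simp_all add: z M.submoduleE(3-5))
qed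

lemma mspan_superset: "G \<subseteq> mspan K M G"
  unfolding mspan_def by auto

lemma mspan_least: "submodule H K M \<Longrightarrow> G \<subseteq> H \<Longrightarrow> mspan K M G \<subseteq> H"
  unfolding mspan_def by auto

text \<open>The multiple of a coset is a union of cosets, one for each of its elements. They all coincide
  because \<open>N\<close> is closed under scalars.\<close>

lemma quotient_module:
  assumes "module K M" "submodule N K M"
  shows "module K (quotient_module M N)"
    and "(\<lambda>x. N +>\<^bsub>M\<^esub> x) \<in> linear_maps K M (quotient_module M N)"
    and "carrier (quotient_module M N) = (\<lambda>x. N +>\<^bsub>M\<^esub> x) ` carrier M"
    and "x \<in> carrier M \<Longrightarrow> y \<in> N +>\<^bsub>M\<^esub> x \<Longrightarrow> y \<in> carrier M \<and> N +>\<^bsub>M\<^esub> y = N +>\<^bsub>M\<^esub> x"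
    and "x \<in> carrier M \<Longrightarrow> x \<in> N +>\<^bsub>M\<^esub> x"
    and "x \<in> N \<Longrightarrow> N +>\<^bsub>M\<^esub> x = \<zero>\<^bsub>quotient_module M N\<^esub>"
proof -
  interpret M: module K M by fact
  have sg: "subgroup N (add_monoid M)" using assms(2) by (simp add: submodule_def)
  interpret N: abelian_subgroup N M
    by (rule abelian_subgroupI3[OF additive_subgroup.intro[OF sg] M.abelian_group_axioms])
  let ?Q = "quotient_module M N"
  let ?p = "\<lambda>x. N +>\<^bsub>M\<^esub> x"
  show self: "x \<in> ?p x" if "x \<in> carrier M" for x
    by (rule N.a_rcos_self[OF that])
  show repr: "y \<in> carrier M \<and> ?p y = ?p x" if "x \<in> carrier M" "y \<in> ?p x" for x y
    using N.a_repr_independence'[OF that(2,1)] N.a_elemrcos_carrier[OF that(1,2)] by simp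
  show null: "?p x = \<zero>\<^bsub>?Q\<^esub>" if "x \<in> N" for x
    using that M.a_coset_join2[OF _ sg that] N.a_Hcarr by (simp add: quotient_module_def)
  show carr: "carrier ?Q = ?p ` carrier M"
    by (auto simp: quotient_module_def A_RCOSETS_def')
  have add: "?p (x \<oplus>\<^bsub>M\<^esub> y) = ?p x \<oplus>\<^bsub>?Q\<^esub> ?p y" if "x \<in> carrier M" "y \<in> carrier M" for x y
    using N.a_rcos_sum[OF that] by (simp add: quotient_module_def)
  have smult: "?p (k \<odot>\<^bsub>M\<^esub> x) = k \<odot>\<^bsub>?Q\<^esub> ?p x" if k: "k \<in> carrier K" and x: "x \<in> carrier M" for k x
  proof -
    have "?p (k \<odot>\<^bsub>M\<^esub> y) = ?p (k \<odot>\<^bsub>M\<^esub> x)" if y: "y \<in> ?p x" for y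
    proof -
      obtain n where n: "n \<in> N" "y = n \<oplus>\<^bsub>M\<^esub> x" using y by (auto simp: a_r_coset_def')
      then have "k \<odot>\<^bsub>M\<^esub> y = k \<odot>\<^bsub>M\<^esub> n \<oplus>\<^bsub>M\<^esub> k \<odot>\<^bsub>M\<^esub> x"
        using k x N.a_Hcarr by (simp add: M.smult_r_distr)
      moreover have "k \<odot>\<^bsub>M\<^esub> n \<in> N" by (rule M.submoduleE(4)[OF assms(2) k n(1)])
      ultimately have "k \<odot>\<^bsub>M\<^esub> y \<in> ?p (k \<odot>\<^bsub>M\<^esub> x)" by (auto simp: a_r_coset_def')
      then show ?thesis using repr[OF M.smult_closed[OF k x]] by simp
    qed
    then have "(\<Union>y\<in>?p x. ?p (k \<odot>\<^bsub>M\<^esub> y)) = (\<Union>y\<in>?p x. ?p (k \<odot>\<^bsub>M\<^esub> x))"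
      by (intro SUP_cong refl)
    also have "\<dots> = ?p (k \<odot>\<^bsub>M\<^esub> x)" using self[OF x] by blast
    finally show ?thesis by (simp add: quotient_module_def)
  qed
  have zero: "\<zero>\<^bsub>?Q\<^esub> = ?p \<zero>\<^bsub>M\<^esub>"
    using null[of "\<zero>\<^bsub>M\<^esub>"] N.zero_closed by simp
  show lin: "?p \<in> linear_maps K M ?Q"
    by (rule linear_mapsI) (auto simp: add smult carr)
  show "module K ?Q"
    by (rule module_surj_image[OF assms(1) carr add smult zero])
qed

text \<open>The condition for the linear extension of \<open>f\<close> to factor through the quotient by \<open>Rel\<close>.\<close>

definition kills :: "('a, 'p, 'n) module_scheme \<Rightarrow> ('s \<Rightarrow> 'p) \<Rightarrow> ('s \<Rightarrow> 'a) set \<Rightarrow> bool" where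
  "kills P f Rel \<longleftrightarrow> (\<forall>r\<in>Rel. lin_ext P f r = \<zero>\<^bsub>P\<^esub>)"

lemma
  assumes "Rel \<subseteq> carrier (free_module K S)"
  defines "N \<equiv> mspan K (free_module K S) Rel"
  shows presented_module: "module K (presented K S Rel)"
    and presented_proj:
      "(\<lambda>x. N +>\<^bsub>free_module K S\<^esub> x) \<in> linear_maps K (free_module K S) (presented K S Rel)"
    and presented_carrier:
      "carrier (presented K S Rel) = (\<lambda>x. N +>\<^bsub>free_module K S\<^esub> x) ` carrier (free_module K S)"
  unfolding presented_def N_def
  by (rule quotient_module[OF free_module_module mspan_submodule[OF free_module_module assms(1)]])+

lemma presented_cases:
  assumes Rel: "Rel \<subseteq> carrier (free_module K S)" and X: "X \<in> carrier (presented K S Rel)"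
  obtains x where "x = (SOME x. x \<in> X)" "x \<in> carrier (free_module K S)"
    "X = mspan K (free_module K S) Rel +>\<^bsub>free_module K S\<^esub> x"
proof -
  let ?F = "free_module K S"
  note q = quotient_module[OF free_module_module mspan_submodule[OF free_module_module Rel]]
  obtain y where y: "y \<in> carrier ?F" "X = mspan K ?F Rel +>\<^bsub>?F\<^esub> y"
    using X by (auto simp: presented_carrier[OF Rel])
  have "y \<in> X" unfolding y(2) by (rule q(5)[OF y(1)])
  then have "(SOME x. x \<in> X) \<in> X" by (rule someI[of "\<lambda>x. x \<in> X"])
  from q(4)[OF y(1) this[unfolded y(2)]] show ?thesis
    unfolding y(2)[symmetric] by (intro that[of "SOME x. x \<in> X"] refl) simp_all
qed

lemma gen_closed:
  assumes "Rel \<subseteq> carrier (free_module K S)" "s \<in> S"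
  shows "gen K S Rel s \<in> carrier (presented K S Rel)"
  unfolding presented_carrier[OF assms(1)] gen_def
  by (rule imageI[OF basis_vec_closed[OF assms(2)]])

text \<open>The set \<open>linear_rels\<close> is made for this: modulo these relations, insertion into the slot \<open>w\<close> is
  linear. The lemma \<open>kills_linear_rels\<close> is the dual statement for maps out of the presented module.\<close>

lemma gen_linear:
  assumes Rel: "Rel \<subseteq> carrier (free_module K S)" and M: "module K M"
    and w: "\<And>x. x \<in> carrier M \<Longrightarrow> w x \<in> S" and sub: "linear_rels K S M w \<subseteq> Rel"
  shows "(\<lambda>x. gen K S Rel (w x)) \<in> linear_maps K M (presented K S Rel)"
proof -
  interpret M: module K M by fact
  let ?F = "free_module K S" and ?P = "presented K S Rel"
  interpret F: module K ?F by (rule free_module_module)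
  interpret P: module K ?P by (rule presented_module[OF Rel])
  define N where "N = mspan K ?F Rel"
  let ?p = "\<lambda>x. N +>\<^bsub>?F\<^esub> x"
  note p = presented_proj[OF Rel, folded N_def]
  have g: "gen K S Rel s = ?p (basis_vec K s)" for s by (simp add: gen_def N_def)
  have bw: "basis_vec K (w x) \<in> carrier ?F" if "x \<in> carrier M" for x
    using w[OF that] by (rule basis_vec_closed)
  have eq: "?p a = ?p b" if "a \<in> carrier ?F" "b \<in> carrier ?F" "a \<ominus>\<^bsub>?F\<^esub> b \<in> Rel" for a b
  proof -
    have "a \<ominus>\<^bsub>?F\<^esub> b \<in> N" unfolding N_def by (rule subsetD[OF mspan_superset that(3)])
    then have "?p (a \<ominus>\<^bsub>?F\<^esub> b) = \<zero>\<^bsub>?P\<^esub>"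
      unfolding N_def presented_def
      by (rule quotient_module(6)[OF free_module_module mspan_submodule[OF free_module_module Rel]])
    moreover have "a = (a \<ominus>\<^bsub>?F\<^esub> b) \<oplus>\<^bsub>?F\<^esub> b"
      using that by (simp add: F.minus_eq F.a_assoc F.l_neg)
    ultimately have "?p a = \<zero>\<^bsub>?P\<^esub> \<oplus>\<^bsub>?P\<^esub> ?p b"
      using that linear_add[OF p, of "a \<ominus>\<^bsub>?F\<^esub> b" b] by simp
    then show ?thesis using linear_closed[OF p that(2)] by simp
  qed
  show ?thesis
  proof (rule linear_mapsI)
    fix x assume x: "x \<in> carrier M"
    show "gen K S Rel (w x) \<in> carrier ?P" by (rule gen_closed[OF Rel w[OF x]])
  next
    fix x y assume x: "x \<in> carrier M" and y: "y \<in> carrier M"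
    have "?p (basis_vec K (w (x \<oplus>\<^bsub>M\<^esub> y))) = ?p (basis_vec K (w x) \<oplus>\<^bsub>?F\<^esub> basis_vec K (w y))"
    proof (rule eq)
      show "basis_vec K (w (x \<oplus>\<^bsub>M\<^esub> y)) \<ominus>\<^bsub>?F\<^esub> (basis_vec K (w x) \<oplus>\<^bsub>?F\<^esub> basis_vec K (w y)) \<in> Rel"
        by (rule subsetD[OF sub], unfold linear_rels_def) (use x y in blast)
    qed (simp_all add: x y bw)
    then show "gen K S Rel (w (x \<oplus>\<^bsub>M\<^esub> y)) = gen K S Rel (w x) \<oplus>\<^bsub>?P\<^esub> gen K S Rel (w y)"
      using x y bw by (simp add: g linear_add[OF p])
  next
    fix k x assume k: "k \<in> carrier K" and x: "x \<in> carrier M"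
    have "?p (basis_vec K (w (k \<odot>\<^bsub>M\<^esub> x))) = ?p (k \<odot>\<^bsub>?F\<^esub> basis_vec K (w x))"
    proof (rule eq)
      show "basis_vec K (w (k \<odot>\<^bsub>M\<^esub> x)) \<ominus>\<^bsub>?F\<^esub> (k \<odot>\<^bsub>?F\<^esub> basis_vec K (w x)) \<in> Rel"
        by (rule subsetD[OF sub], unfold linear_rels_def) (use x k in blast)
    qed (simp_all add: x k bw)
    then show "gen K S Rel (w (k \<odot>\<^bsub>M\<^esub> x)) = k \<odot>\<^bsub>?P\<^esub> gen K S Rel (w x)"
      using x k bw by (simp add: g linear_smult[OF p])
  qed
qed

lemma linear_rels_subset:
  assumes M: "module K M" and w: "\<And>x. x \<in> carrier M \<Longrightarrow> w x \<in> S"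
  shows "linear_rels K S M w \<subseteq> carrier (free_module K S)"
proof -
  interpret M: module K M by fact
  interpret F: module K "free_module K S" by (rule free_module_module)
  show ?thesis unfolding linear_rels_def by (auto intro!: F.minus_closed F.a_closed F.smult_closed basis_vec_closed w)
qed

lemma kills_linear_rels:
  assumes P: "module K P" and M: "module K M" and f: "f \<in> S \<rightarrow> carrier P"
    and w: "\<And>x. x \<in> carrier M \<Longrightarrow> w x \<in> S"
    and fw: "(\<lambda>x. f (w x)) \<in> linear_maps K M P"
  shows "kills P f (linear_rels K S M w)"
proof -
  interpret M: module K M by fact
  interpret P: module K P by fact
  let ?F = "free_module K S"
  interpret F: module K ?F by (rule free_module_module)
  note h = lin_ext_linear[OF P f]
  have z: "lin_ext P f (a \<ominus>\<^bsub>?F\<^esub> b) = \<zero>\<^bsub>P\<^esub>"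
    if "a \<in> carrier ?F" "b \<in> carrier ?F" "lin_ext P f a = lin_ext P f b" for a b
  proof -
    have "a \<ominus>\<^bsub>?F\<^esub> b = a \<oplus>\<^bsub>?F\<^esub> (\<ominus> \<one>) \<odot>\<^bsub>?F\<^esub> b" using that by (simp add: F.minus_eq F.smult_l_minus)
    then show ?thesis using that linear_closed[OF h]
      by (simp add: linear_add[OF h] linear_smult[OF h] P.smult_l_minus P.r_neg)
  qed
  have bw: "basis_vec K (w x) \<in> carrier ?F" "lin_ext P f (basis_vec K (w x)) = f (w x)"
    if "x \<in> carrier M" for x
    using w[OF that] by (auto intro: basis_vec_closed simp: lin_ext_basis_vec[OF P f])
  show ?thesis
    unfolding kills_def linear_rels_def
    by (auto intro!: z simp: bw linear_add[OF h] linear_smult[OF h] linear_add[OF fw] linear_smult[OF fw])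
qed

lemma lift_closed:
  assumes "module K P" "Rel \<subseteq> carrier (free_module K S)" "f \<in> S \<rightarrow> carrier P"
    "X \<in> carrier (presented K S Rel)"
  shows "lift K P f X \<in> carrier P"
  by (rule presented_cases[OF assms(2,4)])
    (simp only: lift_eq_lin_ext linear_closed[OF lin_ext_linear[OF assms(1,3)]])

text \<open>Choose the representative \<open>x\<close> that \<open>lift\<close> uses. Then \<open>L(lift f X)\<close> is the sum of the
  \<open>x s \<odot> L(f s)\<close>, and \<open>H X\<close> is the sum of the \<open>x s \<odot> H(gen s)\<close> for the same \<open>x\<close>, since \<open>X\<close> itself is
  the sum of the \<open>x s \<odot> gen s\<close>.\<close>

lemma lift_compare:
  assumes P: "module K P" and Q: "module K Q" and Rel: "Rel \<subseteq> carrier (free_module K S)"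
    and f: "\<And>s. s \<in> S \<Longrightarrow> f s \<in> carrier P" and L: "L \<in> linear_maps K P Q"
    and H: "H \<in> linear_maps K (presented K S Rel) Q"
    and eq: "\<And>s. s \<in> S \<Longrightarrow> L (f s) = H (gen K S Rel s)"
    and X: "X \<in> carrier (presented K S Rel)"
  shows "L (lift K P f X) = H X"
proof -
  let ?F = "free_module K S"
  obtain x where x: "x = (SOME x. x \<in> X)" "x \<in> carrier ?F" "X = mspan K ?F Rel +>\<^bsub>?F\<^esub> x"
    by (rule presented_cases[OF Rel X])
  have f': "f \<in> S \<rightarrow> carrier P" using f by auto
  have "L (lift K P f X) = lin_ext Q (\<lambda>s. L (f s)) x"
    unfolding lift_eq_lin_ext x(1)[symmetric] by (rule linear_lin_ext[OF P Q L f' x(2)])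
  also have "\<dots> = lin_ext Q (\<lambda>s. H (gen K S Rel s)) x"
    by (rule lin_ext_cong[OF Q _ x(2)]) (auto intro: linear_closed[OF L] f eq)
  also have "\<dots> = H X"
    using linear_eq_lin_ext[OF Q linear_comp[OF presented_proj[OF Rel] H] x(2)]
    by (simp add: gen_def x(3)[symmetric])
  finally show ?thesis .
qed

lemma presented_ext:
  assumes "module K Q" "Rel \<subseteq> carrier (free_module K S)"
    "G \<in> linear_maps K (presented K S Rel) Q" "H \<in> linear_maps K (presented K S Rel) Q"
    "\<And>s. s \<in> S \<Longrightarrow> G (gen K S Rel s) = H (gen K S Rel s)" "X \<in> carrier (presented K S Rel)"
  shows "G X = H X"
proof -
  note cmp = lift_compare[OF presented_module[OF assms(2)] assms(1,2) gen_closed[OF assms(2)]]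
  have "G X = G (lift K (presented K S Rel) (gen K S Rel) X)"
    by (rule cmp[OF _ assms(3,3) _ assms(6), symmetric]) auto
  also have "\<dots> = H X"
    by (rule cmp[OF _ assms(3,4,5,6)])
  finally show ?thesis .
qed

text \<open>The kernel of the linear extension of \<open>f\<close> is a submodule that contains the relations, hence also
  their span. So the extension is constant on cosets and every representative gives the same value.\<close>

lemma lift_universal:
  assumes P: "module K P" and Rel: "Rel \<subseteq> carrier (free_module K S)"
    and f: "\<And>s. s \<in> S \<Longrightarrow> f s \<in> carrier P" and kills: "kills P f Rel"
  shows lift_linear: "lift K P f \<in> linear_maps K (presented K S Rel) P"
    and lift_gen: "s \<in> S \<Longrightarrow> lift K P f (gen K S Rel s) = f s"
proof -
  interpret P: module K P by fact
  let ?F = "free_module K S" and ?P = "presented K S Rel"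
  interpret F: module K ?F by (rule free_module_module)
  define N where "N = mspan K ?F Rel"
  note p = presented_proj[OF Rel, folded N_def]
  have f': "f \<in> S \<rightarrow> carrier P" using f by auto
  note h = lin_ext_linear[OF P f']
  have "submodule {\<zero>\<^bsub>P\<^esub>} K P" by (rule P.submoduleI) auto
  note ker = submodule_vimage[OF F.module_axioms P h this]
  have N0: "lin_ext P f n = \<zero>\<^bsub>P\<^esub>" "n \<in> carrier ?F" if "n \<in> N" for n
    using that mspan_least[OF ker, of Rel] kills Rel unfolding N_def kills_def by auto
  have val: "lift K P f (N +>\<^bsub>?F\<^esub> x) = lin_ext P f x" if x: "x \<in> carrier ?F" for x
  proof -
    let ?y = "SOME y. y \<in> N +>\<^bsub>?F\<^esub> x"
    have "?y \<in> N +>\<^bsub>?F\<^esub> x"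
      unfolding N_def
      by (rule someI[of "\<lambda>y. y \<in> _"], rule quotient_module(5)[OF free_module_module mspan_submodule[OF free_module_module Rel] x])
    then obtain n where "n \<in> N" "?y = n \<oplus>\<^bsub>?F\<^esub> x" by (auto simp: a_r_coset_def')
    then show ?thesis
      using N0[of n] x linear_closed[OF h x] by (simp add: lift_eq_lin_ext linear_add[OF h])
  qed
  show "s \<in> S \<Longrightarrow> lift K P f (gen K S Rel s) = f s"
    unfolding gen_def N_def[symmetric]
    by (simp add: val basis_vec_closed lin_ext_basis_vec[OF P f'])
  have carr: "carrier ?P = (\<lambda>x. N +>\<^bsub>?F\<^esub> x) ` carrier ?F"
    by (simp add: presented_carrier[OF Rel] N_def)
  show "lift K P f \<in> linear_maps K ?P P"
  proof (rule linear_mapsI)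
    fix X assume "X \<in> carrier ?P"
    then show "lift K P f X \<in> carrier P" using linear_closed[OF h] by (auto simp: carr val)
  next
    fix X Y assume "X \<in> carrier ?P" "Y \<in> carrier ?P"
    then show "lift K P f (X \<oplus>\<^bsub>?P\<^esub> Y) = lift K P f X \<oplus>\<^bsub>P\<^esub> lift K P f Y"
      by (auto simp: carr val linear_add[OF p, symmetric] linear_add[OF h])
  next
    fix k X assume "k \<in> carrier K" "X \<in> carrier ?P"
    then show "lift K P f (k \<odot>\<^bsub>?P\<^esub> X) = k \<odot>\<^bsub>P\<^esub> lift K P f X"
      by (auto simp: carr val linear_smult[OF p, symmetric] linear_smult[OF h])
  qed
qed

section \<open>Bilinear maps and tensor products\<close>

definition bilinear_maps ::
    "('a, 'v, 'n) module_scheme \<Rightarrow> ('a, 'w, 'o) module_scheme \<Rightarrow> ('a, 'p, 'q) module_scheme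
      \<Rightarrow> ('v \<Rightarrow> 'w \<Rightarrow> 'p) set" where
  "bilinear_maps M N P =
    {f. (\<forall>y\<in>carrier N. (\<lambda>x. f x y) \<in> linear_maps K M P) \<and> (\<forall>x\<in>carrier M. f x \<in> linear_maps K N P)}"

lemma bilinearI:
  assumes "\<And>y. y \<in> carrier N \<Longrightarrow> (\<lambda>x. f x y) \<in> linear_maps K M P"
    and "\<And>x. x \<in> carrier M \<Longrightarrow> (\<lambda>y. f x y) \<in> linear_maps K N P"
  shows "f \<in> bilinear_maps M N P"
  unfolding bilinear_maps_def using assms by simp

lemma bilinear_left: "f \<in> bilinear_maps M N P \<Longrightarrow> y \<in> carrier N \<Longrightarrow> (\<lambda>x. f x y) \<in> linear_maps K M P"
  unfolding bilinear_maps_def by simp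

lemma bilinear_right: "f \<in> bilinear_maps M N P \<Longrightarrow> x \<in> carrier M \<Longrightarrow> (\<lambda>y. f x y) \<in> linear_maps K N P"
  unfolding bilinear_maps_def by simp

lemma bilinear_closed:
  "f \<in> bilinear_maps M N P \<Longrightarrow> x \<in> carrier M \<Longrightarrow> y \<in> carrier N \<Longrightarrow> f x y \<in> carrier P"
  by (drule (1) bilinear_right) (erule (1) linear_closed)

lemma bilinear_comp:
  assumes f: "f \<in> bilinear_maps M' N' P" and g: "g \<in> linear_maps K M M'"
    and h: "h \<in> linear_maps K N N'" and L: "L \<in> linear_maps K P Q"
  shows "(\<lambda>x y. L (f (g x) (h y))) \<in> bilinear_maps M N Q"
proof (rule bilinearI)
  fix y assume "y \<in> carrier N"
  from linear_comp[OF linear_comp[OF g bilinear_left[OF f linear_closed[OF h this]]] L]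
  show "(\<lambda>x. L (f (g x) (h y))) \<in> linear_maps K M Q" .
next
  fix x assume "x \<in> carrier M"
  from linear_comp[OF linear_comp[OF h bilinear_right[OF f linear_closed[OF g this]]] L]
  show "(\<lambda>y. L (f (g x) (h y))) \<in> linear_maps K N Q" .
qed

lemma tensor_rels_subset:
  assumes M: "module K M" and N: "module K N"
  shows "tensor_rels K M N \<subseteq> carrier (free_module K (carrier M \<times> carrier N))"
  unfolding tensor_rels_def
  by (intro Un_least UN_least linear_rels_subset[OF M] linear_rels_subset[OF N]) simp_all

lemma tensor_module:
  assumes "module K M" "module K N"
  shows "module K (tensor K M N)"
  unfolding tensor_def by (rule presented_module[OF tensor_rels_subset[OF assms]])

lemma tens_bilinear:
  assumes M: "module K M" and N: "module K N"
  shows "tens K M N \<in> bilinear_maps M N (tensor K M N)"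
proof (rule bilinearI)
  fix y assume y: "y \<in> carrier N"
  have "linear_rels K (carrier M \<times> carrier N) M (\<lambda>x. (x, y)) \<subseteq> tensor_rels K M N"
    unfolding tensor_rels_def using y by blast
  from gen_linear[OF tensor_rels_subset[OF M N] M _ this]
  show "(\<lambda>x. tens K M N x y) \<in> linear_maps K M (tensor K M N)"
    unfolding tensor_def tens_def using y by simp
next
  fix x assume x: "x \<in> carrier M"
  have "linear_rels K (carrier M \<times> carrier N) N (\<lambda>y. (x, y)) \<subseteq> tensor_rels K M N"
    unfolding tensor_rels_def using x by blast
  from gen_linear[OF tensor_rels_subset[OF M N] N _ this]
  show "(\<lambda>y. tens K M N x y) \<in> linear_maps K N (tensor K M N)"
    unfolding tensor_def tens_def using x by simp
qed

lemma tens_closed: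
  assumes "module K M" "module K N" "x \<in> carrier M" "y \<in> carrier N"
  shows "tens K M N x y \<in> carrier (tensor K M N)"
  by (rule bilinear_closed[OF tens_bilinear[OF assms(1,2)] assms(3,4)])

lemma tens_map_bilinear:
  assumes "module K M" "module K N" "f \<in> linear_maps K M' M" "g \<in> linear_maps K N' N"
  shows "(\<lambda>x y. tens K M N (f x) (g y)) \<in> bilinear_maps M' N' (tensor K M N)"
  using bilinear_comp[OF tens_bilinear[OF assms(1,2)] assms(3,4) linear_id] by simp

lemma lift_tensor_closed:
  assumes "module K M" "module K N" "module K P"
    and "\<And>x y. \<lbrakk>x \<in> carrier M; y \<in> carrier N\<rbrakk> \<Longrightarrow> f x y \<in> carrier P" "X \<in> carrier (tensor K M N)"
  shows "lift K P (\<lambda>(x, y). f x y) X \<in> carrier P"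
  by (rule lift_closed[OF assms(3) tensor_rels_subset[OF assms(1,2)] _ assms(5)[unfolded tensor_def]])
    (use assms(4) in auto)

lemma lift_tensor_compare:
  assumes "module K M" "module K N" "module K P" "module K Q"
    and "\<And>x y. \<lbrakk>x \<in> carrier M; y \<in> carrier N\<rbrakk> \<Longrightarrow> f x y \<in> carrier P"
    and "L \<in> linear_maps K P Q" "H \<in> linear_maps K (tensor K M N) Q"
    and "\<And>x y. \<lbrakk>x \<in> carrier M; y \<in> carrier N\<rbrakk> \<Longrightarrow> L (f x y) = H (tens K M N x y)"
    and "X \<in> carrier (tensor K M N)"
  shows "L (lift K P (\<lambda>(x, y). f x y) X) = H X"
  by (rule lift_compare[OF assms(3,4) tensor_rels_subset[OF assms(1,2)] _ assms(6)
        assms(7)[unfolded tensor_def] _ assms(9)[unfolded tensor_def]])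
    (use assms(5,8) in \<open>auto simp: tens_def\<close>)

lemma tensor_ext:
  assumes "module K M" "module K N" "module K Q"
    and "G \<in> linear_maps K (tensor K M N) Q" "H \<in> linear_maps K (tensor K M N) Q"
    and "\<And>x y. \<lbrakk>x \<in> carrier M; y \<in> carrier N\<rbrakk> \<Longrightarrow> G (tens K M N x y) = H (tens K M N x y)"
    and "X \<in> carrier (tensor K M N)"
  shows "G X = H X"
  by (rule presented_ext[OF assms(3) tensor_rels_subset[OF assms(1,2)]
        assms(4,5)[unfolded tensor_def] _ assms(7)[unfolded tensor_def]])
    (use assms(6) in \<open>auto simp: tens_def\<close>)

lemma lift_bilinear:
  assumes M: "module K M" and N: "module K N" and P: "module K P" and f: "f \<in> bilinear_maps M N P"
  shows lift_tensor_linear: "lift K P (\<lambda>(x, y). f x y) \<in> linear_maps K (tensor K M N) P"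
    and lift_tens: "\<lbrakk>x \<in> carrier M; y \<in> carrier N\<rbrakk> \<Longrightarrow> lift K P (\<lambda>(x, y). f x y) (tens K M N x y) = f x y"
proof -
  let ?S = "carrier M \<times> carrier N" and ?f = "\<lambda>(x, y). f x y"
  have cl: "?f s \<in> carrier P" if "s \<in> ?S" for s
    using that bilinear_closed[OF f] by auto
  then have cl': "?f \<in> ?S \<rightarrow> carrier P" by auto
  have "kills P ?f (linear_rels K ?S M (\<lambda>x. (x, y)))" if "y \<in> carrier N" for y
    by (rule kills_linear_rels[OF P M cl']) (use that bilinear_left[OF f that] in simp_all)
  moreover have "kills P ?f (linear_rels K ?S N (\<lambda>y. (x, y)))" if "x \<in> carrier M" for x
    by (rule kills_linear_rels[OF P N cl']) (use that bilinear_right[OF f that] in simp_all)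
  ultimately have "kills P ?f (tensor_rels K M N)"
    unfolding tensor_rels_def kills_def by blast
  note u = lift_universal[OF P tensor_rels_subset[OF M N] cl this]
  show "lift K P ?f \<in> linear_maps K (tensor K M N) P"
    unfolding tensor_def by (rule u(1))
  show "lift K P ?f (tens K M N x y) = f x y" if "x \<in> carrier M" "y \<in> carrier N"
    using u(2)[of "(x, y)"] that by (simp add: tens_def)
qed

text \<open>The linearity identities in the parameter \<open>l\<close> are identities between linear maps in \<open>X\<close>, so they
  need to be checked on pure tensors only. This supplies the second half of bilinearity whenever one
  \<open>lift\<close> is nested in another, as in the associators.\<close>

lemma lift_tensor_param:
  assumes mods: "module K M" "module K N" "module K P"
    and f: "\<And>l. l \<in> carrier L \<Longrightarrow> f l \<in> bilinear_maps M N P"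
    and fl: "\<And>m n. \<lbrakk>m \<in> carrier M; n \<in> carrier N\<rbrakk> \<Longrightarrow> (\<lambda>l. f l m n) \<in> linear_maps K L P"
    and L: "module K L" and X: "X \<in> carrier (tensor K M N)"
  shows "(\<lambda>l. lift K P (\<lambda>(m, n). f l m n) X) \<in> linear_maps K L P"
proof -
  interpret L: module K L by (rule L)
  note lin = lift_tensor_linear[OF mods f] and val = lift_tens[OF mods f]
  show ?thesis
  proof (rule linear_mapsI)
    fix l assume l: "l \<in> carrier L"
    show "lift K P (\<lambda>(m, n). f l m n) X \<in> carrier P"
      by (rule linear_closed[OF lin[OF l] X])
    fix l' assume l': "l' \<in> carrier L"
    show "lift K P (\<lambda>(m, n). f (l \<oplus>\<^bsub>L\<^esub> l') m n) X
      = lift K P (\<lambda>(m, n). f l m n) X \<oplus>\<^bsub>P\<^esub> lift K P (\<lambda>(m, n). f l' m n) X"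
      by (rule tensor_ext[OF mods lin[OF L.a_closed[OF l l']] linear_sum[OF mods(3) lin[OF l] lin[OF l']] _ X])
        (simp add: val l l' linear_add[OF fl])
  next
    fix k l assume k: "k \<in> carrier K" and l: "l \<in> carrier L"
    show "lift K P (\<lambda>(m, n). f (k \<odot>\<^bsub>L\<^esub> l) m n) X = k \<odot>\<^bsub>P\<^esub> lift K P (\<lambda>(m, n). f l m n) X"
      by (rule tensor_ext[OF mods lin[OF L.smult_closed[OF k l]] linear_scale[OF mods(3) lin[OF l] k] _ X])
        (simp add: val k l linear_smult[OF fl])
  qed
qed

lemma tensor_map_closed:
  assumes "module K M'" "module K N'" "module K M" "module K N"
    and "\<And>x. x \<in> carrier M' \<Longrightarrow> f x \<in> carrier M" "\<And>y. y \<in> carrier N' \<Longrightarrow> g y \<in> carrier N"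
    and "X \<in> carrier (tensor K M' N')"
  shows "tensor_map K M N f g X \<in> carrier (tensor K M N)"
  unfolding tensor_map_def
  by (rule lift_tensor_closed[OF assms(1,2) tensor_module[OF assms(3,4)] _ assms(7)])
    (intro tens_closed assms(3-6))

lemma tensor_map_compare:
  assumes "module K M'" "module K N'" "module K M" "module K N" "module K Q"
    and "\<And>x. x \<in> carrier M' \<Longrightarrow> f x \<in> carrier M" "\<And>y. y \<in> carrier N' \<Longrightarrow> g y \<in> carrier N"
    and "L \<in> linear_maps K (tensor K M N) Q" "H \<in> linear_maps K (tensor K M' N') Q"
    and "\<And>x y. \<lbrakk>x \<in> carrier M'; y \<in> carrier N'\<rbrakk> \<Longrightarrow> L (tens K M N (f x) (g y)) = H (tens K M' N' x y)"
    and "X \<in> carrier (tensor K M' N')"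
  shows "L (tensor_map K M N f g X) = H X"
  unfolding tensor_map_def
  by (rule lift_tensor_compare[OF assms(1,2) tensor_module[OF assms(3,4)] assms(5) _ assms(8,9,10,11)])
    (intro tens_closed assms(3-7))

lemma
  assumes "module K M'" "module K N'" "module K M" "module K N"
    and "f \<in> linear_maps K M' M" "g \<in> linear_maps K N' N"
  shows tensor_map_linear: "tensor_map K M N f g \<in> linear_maps K (tensor K M' N') (tensor K M N)"
    and tensor_map_tens: "\<lbrakk>x \<in> carrier M'; y \<in> carrier N'\<rbrakk>
      \<Longrightarrow> tensor_map K M N f g (tens K M' N' x y) = tens K M N (f x) (g y)"
  using lift_bilinear[OF assms(1,2) tensor_module[OF assms(3,4)] tens_map_bilinear[OF assms(3-6)]]
  by (simp_all add: tensor_map_def)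

lemma
  assumes L: "module K L" and M: "module K M" and N: "module K N"
  shows assoc_l_linear: "assoc_l K L M N
      \<in> linear_maps K (tensor K L (tensor K M N)) (tensor K (tensor K L M) N)" (is ?lin)
    and assoc_l_tens: "\<lbrakk>l \<in> carrier L; m \<in> carrier M; n \<in> carrier N\<rbrakk>
      \<Longrightarrow> assoc_l K L M N (tens K L (tensor K M N) l (tens K M N m n))
        = tens K (tensor K L M) N (tens K L M l m) n"
proof -
  let ?T = "tensor K (tensor K L M) N"
  let ?f = "\<lambda>l m n. tens K (tensor K L M) N (tens K L M l m) n"
  note mods = M N tensor_module[OF tensor_module[OF L M] N]
  have f: "?f l \<in> bilinear_maps M N ?T" if "l \<in> carrier L" for l
    using tens_map_bilinear[OF tensor_module[OF L M] N bilinear_right[OF tens_bilinear[OF L M] that] linear_id]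
    by simp
  have fl: "(\<lambda>l. ?f l m n) \<in> linear_maps K L ?T" if "m \<in> carrier M" "n \<in> carrier N" for m n
    by (rule linear_comp[OF bilinear_left[OF tens_bilinear[OF L M] that(1)]
          bilinear_left[OF tens_bilinear[OF tensor_module[OF L M] N] that(2)]])
  have "(\<lambda>l X. lift K ?T (\<lambda>(m, n). ?f l m n) X) \<in> bilinear_maps L (tensor K M N) ?T"
    by (rule bilinearI[OF lift_tensor_param[OF mods f fl L] lift_tensor_linear[OF mods f]])
  note u = lift_bilinear[OF L tensor_module[OF M N] mods(3) this]
  show ?lin unfolding assoc_l_def Let_def by (rule u(1))
  show "assoc_l K L M N (tens K L (tensor K M N) l (tens K M N m n)) = ?f l m n"
    if "l \<in> carrier L" "m \<in> carrier M" "n \<in> carrier N"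
    unfolding assoc_l_def Let_def u(2)[OF that(1) tens_closed[OF M N that(2,3)]]
    by (rule lift_tens[OF mods f[OF that(1)] that(2,3)])
qed

lemma
  assumes L: "module K L" and M: "module K M" and N: "module K N"
  shows assoc_r_linear: "assoc_r K L M N
      \<in> linear_maps K (tensor K (tensor K L M) N) (tensor K L (tensor K M N))" (is ?lin)
    and assoc_r_tens: "\<lbrakk>l \<in> carrier L; m \<in> carrier M; n \<in> carrier N\<rbrakk>
      \<Longrightarrow> assoc_r K L M N (tens K (tensor K L M) N (tens K L M l m) n)
        = tens K L (tensor K M N) l (tens K M N m n)"
proof -
  let ?T = "tensor K L (tensor K M N)"
  let ?f = "\<lambda>n l m. tens K L (tensor K M N) l (tens K M N m n)"
  note mods = L M tensor_module[OF L tensor_module[OF M N]]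
  have f: "?f n \<in> bilinear_maps L M ?T" if "n \<in> carrier N" for n
    using tens_map_bilinear[OF L tensor_module[OF M N] linear_id bilinear_left[OF tens_bilinear[OF M N] that]]
    by simp
  have fn: "(\<lambda>n. ?f n l m) \<in> linear_maps K N ?T" if "l \<in> carrier L" "m \<in> carrier M" for l m
    by (rule linear_comp[OF bilinear_right[OF tens_bilinear[OF M N] that(2)]
          bilinear_right[OF tens_bilinear[OF L tensor_module[OF M N]] that(1)]])
  have "(\<lambda>X n. lift K ?T (\<lambda>(l, m). ?f n l m) X) \<in> bilinear_maps (tensor K L M) N ?T"
    by (rule bilinearI[OF lift_tensor_linear[OF mods f] lift_tensor_param[OF mods f fn N]])
  note u = lift_bilinear[OF tensor_module[OF L M] N mods(3) this]
  show ?lin unfolding assoc_r_def Let_def by (rule u(1))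
  show "assoc_r K L M N (tens K (tensor K L M) N (tens K L M l m) n) = ?f n l m"
    if "l \<in> carrier L" "m \<in> carrier M" "n \<in> carrier N"
    unfolding assoc_r_def Let_def u(2)[OF tens_closed[OF L M that(1,2)] that(3)]
    by (rule lift_tens[OF mods f[OF that(3)] that(1,2)])
qed

section \<open>Tensor powers\<close>

lemma tpow_rels_subset:
  assumes "module K A"
  shows "tpow_rels K A n \<subseteq> carrier (free_module K (tpow_words A n))"
  unfolding tpow_rels_def
  by (intro UN_least, clarify, rule subsetD[OF linear_rels_subset[OF assms]])
    (auto simp: tpow_words_def)

lemma tpow_module: "module K A \<Longrightarrow> module K (tpow K A n)"
  unfolding tpow_def by (rule presented_module[OF tpow_rels_subset])

lemma tpow_tens_closed:
  "\<lbrakk>module K A; as \<in> tpow_words A n\<rbrakk> \<Longrightarrow> tpow_tens K A as \<in> carrier (tpow K A n)"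
  using gen_closed[OF tpow_rels_subset, of A as n] by (simp add: tpow_tens_def tpow_def tpow_words_def)

lemma lift_tpow_closed:
  assumes "module K A" "module K P" "\<And>as. as \<in> tpow_words A n \<Longrightarrow> f as \<in> carrier P"
    and "X \<in> carrier (tpow K A n)"
  shows "lift K P f X \<in> carrier P"
  by (rule lift_closed[OF assms(2) tpow_rels_subset[OF assms(1)] _ assms(4)[unfolded tpow_def]])
    (use assms(3) in auto)

lemma lift_tpow_compare:
  assumes "module K A" "module K P" "module K Q"
    and "\<And>as. as \<in> tpow_words A n \<Longrightarrow> f as \<in> carrier P"
    and "L \<in> linear_maps K P Q" "H \<in> linear_maps K (tpow K A n) Q"
    and "\<And>as. as \<in> tpow_words A n \<Longrightarrow> L (f as) = H (tpow_tens K A as)"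
    and "X \<in> carrier (tpow K A n)"
  shows "L (lift K P f X) = H X"
proof (rule lift_compare[OF assms(2,3) tpow_rels_subset[OF assms(1)] assms(4,5)
        assms(6)[unfolded tpow_def] _ assms(8)[unfolded tpow_def]])
  fix as assume as: "as \<in> tpow_words A n"
  then show "L (f as) = H (gen K (tpow_words A n) (tpow_rels K A n) as)"
    using assms(7)[OF as] by (simp add: tpow_tens_def tpow_words_def)
qed

lemma lift_tpow:
  assumes A: "module K A" and P: "module K P"
    and cl: "\<And>as. as \<in> tpow_words A n \<Longrightarrow> f as \<in> carrier P"
    and lin: "\<And>xs ys. \<lbrakk>xs \<in> lists (carrier A); ys \<in> lists (carrier A); Suc (length xs + length ys) = n\<rbrakk>
      \<Longrightarrow> (\<lambda>x. f (xs @ x # ys)) \<in> linear_maps K A P"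
  shows lift_tpow_linear: "lift K P f \<in> linear_maps K (tpow K A n) P"
    and lift_tpow_tens: "as \<in> tpow_words A n \<Longrightarrow> lift K P f (tpow_tens K A as) = f as"
proof -
  have cl': "f \<in> tpow_words A n \<rightarrow> carrier P" using cl by auto
  have "kills P f (linear_rels K (tpow_words A n) A (\<lambda>x. xs @ x # ys))"
    if "xs \<in> lists (carrier A)" "ys \<in> lists (carrier A)" "Suc (length xs + length ys) = n" for xs ys
    by (rule kills_linear_rels[OF P A cl' _ lin[OF that]]) (use that in \<open>simp_all add: tpow_words_def\<close>)
  then have "kills P f (tpow_rels K A n)"
    unfolding tpow_rels_def kills_def by blast
  note u = lift_universal[OF P tpow_rels_subset[OF A] cl this]
  show "lift K P f \<in> linear_maps K (tpow K A n) P"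
    unfolding tpow_def by (rule u(1))
  show "lift K P f (tpow_tens K A as) = f as" if "as \<in> tpow_words A n"
    using u(2)[OF _ that] that by (simp add: tpow_tens_def tpow_words_def)
qed

end


section \<open>Products in an entwined algebra\<close>

lemma (in nonunital_algebra) mult_bilinear: "(\<lambda>x y. x \<otimes>\<^bsub>A\<^esub> y) \<in> scalars.bilinear_maps K A A A"
proof -
  interpret scalars K by unfold_locales
  show ?thesis
    by (intro bilinearI linear_mapsI mult_closed mult_distr_l mult_distr_r smult_mult_l smult_mult_r)
qed

lemma (in nonunital_entwining) modules: "module K A" "module K C"
  by unfold_locales

text \<open>The map \<open>(r, e) \<mapsto> r b\<^sub>\<psi> \<otimes> e\<^sup>\<psi>\<close> moves \<open>e\<close> past \<open>b\<close> and multiplies the result by \<open>r\<close> from the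
  left. Being bilinear, it can be applied to \<open>\<psi>(c \<otimes> a)\<close>.\<close>

lemma (in nonunital_entwining) left_mult_psi_bilinear:
  assumes b: "b \<in> carrier A"
  shows "(\<lambda>r e. tensor_map K A C (\<lambda>t. r \<otimes>\<^bsub>A\<^esub> t) id (\<psi> (tens K C A e b)))
    \<in> scalars.bilinear_maps K A C (tensor K A C)"
proof -
  interpret scalars K by unfold_locales
  note AC = tensor_module[OF modules]
  show ?thesis
  proof (rule bilinearI)
    fix e assume e: "e \<in> carrier C"
    have W: "\<psi> (tens K C A e b) \<in> carrier (tensor K A C)"
      by (rule linear_closed[OF psi_linear tens_closed[OF modules(2,1) e b]])
    have f: "(\<lambda>x y. tens K A C (r \<otimes>\<^bsub>A\<^esub> x) (id y)) \<in> bilinear_maps A C (tensor K A C)"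
      if "r \<in> carrier A" for r
      by (rule tens_map_bilinear[OF modules bilinear_right[OF mult_bilinear that] linear_id])
    show "(\<lambda>r. tensor_map K A C (\<lambda>t. r \<otimes>\<^bsub>A\<^esub> t) id (\<psi> (tens K C A e b)))
        \<in> linear_maps K A (tensor K A C)"
      unfolding tensor_map_def
      by (rule lift_tensor_param[OF modules AC f _ modules(1) W],
          assumption,
          rule linear_comp[OF bilinear_left[OF mult_bilinear] bilinear_left[OF tens_bilinear[OF modules]]])
        simp_all
  next
    fix r assume r: "r \<in> carrier A"
    show "(\<lambda>e. tensor_map K A C (\<lambda>t. r \<otimes>\<^bsub>A\<^esub> t) id (\<psi> (tens K C A e b)))
        \<in> linear_maps K C (tensor K A C)"
      by (rule linear_comp[OF linear_comp[OF bilinear_left[OF tens_bilinear[OF modules(2,1)] b] psi_linear]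
            tensor_map_linear[OF modules modules bilinear_right[OF mult_bilinear r] linear_id]])
  qed
qed

text \<open>The multiplicativity axiom at \<open>c \<otimes> a \<otimes> b\<close>, freed of associators: \<open>c\<close> moves past \<open>a\<close> first, and
  what comes out of it moves past \<open>b\<close>. With \<open>\<psi>(c \<otimes> a)\<close> replaced by a variable \<open>Z\<close>, both sides are
  linear in \<open>Z\<close>, so that \<open>Z\<close> may be taken to be a pure tensor \<open>r \<otimes> e\<close>. There the right-hand side of the
  axiom is linear in \<open>W = \<psi>(e \<otimes> b)\<close>, and \<open>W\<close> may be taken to be pure as well.\<close>

lemma (in nonunital_entwining) psi_mult_tens:
  assumes c: "c \<in> carrier C" and a: "a \<in> carrier A" and b: "b \<in> carrier A"
  shows "\<psi> (tens K C A c (a \<otimes>\<^bsub>A\<^esub> b))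
    = lift K (tensor K A C) (\<lambda>(r, e). tensor_map K A C (\<lambda>t. r \<otimes>\<^bsub>A\<^esub> t) id (\<psi> (tens K C A e b)))
        (\<psi> (tens K C A c a))"
proof -
  interpret scalars K by unfold_locales
  note A = modules(1) and C = modules(2)
  note AA = tensor_module[OF A A] and AC = tensor_module[OF A C] and CA = tensor_module[OF C A]
  note m = lift_bilinear[OF A A A mult_bilinear, folded mult_map_def]
  let ?X = "tens K C (tensor K A A) c (tens K A A a b)"
  let ?Z = "\<psi> (tens K C A c a)"
  let ?M = "tensor_map K A C (mult_map K A) id"
  let ?h = "\<lambda>r e. tensor_map K A C (\<lambda>t. r \<otimes>\<^bsub>A\<^esub> t) id (\<psi> (tens K C A e b))"
  have ab: "tens K A A a b \<in> carrier (tensor K A A)" by (rule tens_closed[OF A A a b])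
  have psi_cl: "\<psi> (tens K C A e b) \<in> carrier (tensor K A C)" if "e \<in> carrier C" for e
    by (rule linear_closed[OF psi_linear tens_closed[OF C A that b]])
  have Z: "?Z \<in> carrier (tensor K A C)"
    by (rule linear_closed[OF psi_linear tens_closed[OF C A c a]])
  note M_lin = tensor_map_linear[OF AA C A C m(1) linear_id]
  have inner: "?M (assoc_l K A A C (tens K A (tensor K A C) r W)) = tensor_map K A C (\<lambda>t. r \<otimes>\<^bsub>A\<^esub> t) id W"
    if r: "r \<in> carrier A" and W: "W \<in> carrier (tensor K A C)" for r W
  proof (rule tensor_ext[OF A C AC _ _ _ W])
    show "(\<lambda>W. ?M (assoc_l K A A C (tens K A (tensor K A C) r W))) \<in> linear_maps K (tensor K A C) (tensor K A C)"
      by (rule linear_comp[OF linear_comp[OF bilinear_right[OF tens_bilinear[OF A AC] r]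
            assoc_l_linear[OF A A C]] M_lin])
    show "tensor_map K A C (\<lambda>t. r \<otimes>\<^bsub>A\<^esub> t) id \<in> linear_maps K (tensor K A C) (tensor K A C)"
      by (rule tensor_map_linear[OF A C A C bilinear_right[OF mult_bilinear r] linear_id])
    fix t e assume t: "t \<in> carrier A" and e: "e \<in> carrier C"
    show "?M (assoc_l K A A C (tens K A (tensor K A C) r (tens K A C t e)))
        = tensor_map K A C (\<lambda>t. r \<otimes>\<^bsub>A\<^esub> t) id (tens K A C t e)"
      unfolding assoc_l_tens[OF A A C r t e]
        tensor_map_tens[OF AA C A C m(1) linear_id tens_closed[OF A A r t] e]
        tensor_map_tens[OF A C A C bilinear_right[OF mult_bilinear r] linear_id t e]
        m(2)[OF r t] by simp
  qed
  have outer: "?M (assoc_l K A A C (tensor_map K A (tensor K A C) id \<psi>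
      (assoc_r K A C A (tens K (tensor K A C) A Z b)))) = lift K (tensor K A C) (\<lambda>(r, e). ?h r e) Z"
    if Z: "Z \<in> carrier (tensor K A C)" for Z
  proof (rule tensor_ext[OF A C AC _ _ _ Z])
    show "(\<lambda>Z. ?M (assoc_l K A A C (tensor_map K A (tensor K A C) id \<psi>
        (assoc_r K A C A (tens K (tensor K A C) A Z b))))) \<in> linear_maps K (tensor K A C) (tensor K A C)"
      by (rule linear_comp[OF linear_comp[OF linear_comp[OF linear_comp[OF
            bilinear_left[OF tens_bilinear[OF AC A] b] assoc_r_linear[OF A C A]]
            tensor_map_linear[OF A CA A AC linear_id psi_linear]] assoc_l_linear[OF A A C]] M_lin])
    show "lift K (tensor K A C) (\<lambda>(r, e). ?h r e) \<in> linear_maps K (tensor K A C) (tensor K A C)"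
      by (rule lift_tensor_linear[OF A C AC left_mult_psi_bilinear[OF b]])
    fix r e assume r: "r \<in> carrier A" and e: "e \<in> carrier C"
    show "?M (assoc_l K A A C (tensor_map K A (tensor K A C) id \<psi>
        (assoc_r K A C A (tens K (tensor K A C) A (tens K A C r e) b))))
        = lift K (tensor K A C) (\<lambda>(r, e). ?h r e) (tens K A C r e)"
      unfolding assoc_r_tens[OF A C A r e b]
        tensor_map_tens[OF A CA A AC linear_id psi_linear r tens_closed[OF C A e b]]
        lift_tens[OF A C AC left_mult_psi_bilinear[OF b] r e]
      using inner[OF r psi_cl[OF e]] by simp
  qed
  have "\<psi> (tens K C A c (a \<otimes>\<^bsub>A\<^esub> b)) = \<psi> (tensor_map K C A id (mult_map K A) ?X)"
    unfolding tensor_map_tens[OF C AA C A linear_id m(1) c ab] m(2)[OF a b] by simp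
  also have "\<dots> = ?M (assoc_l K A A C (tensor_map K A (tensor K A C) id \<psi>
      (assoc_r K A C A (tensor_map K (tensor K A C) A \<psi> id (assoc_l K C A A ?X)))))"
    by (rule psi_mult[OF tens_closed[OF C AA c ab]])
  also have "\<dots> = ?M (assoc_l K A A C (tensor_map K A (tensor K A C) id \<psi>
      (assoc_r K A C A (tens K (tensor K A C) A ?Z b))))"
    unfolding assoc_l_tens[OF C A A c a b]
      tensor_map_tens[OF CA A AC A psi_linear linear_id tens_closed[OF C A c a] b] by simp
  also have "\<dots> = lift K (tensor K A C) (\<lambda>(r, e). ?h r e) ?Z"
    by (rule outer[OF Z])
  finally show ?thesis .
qed

section \<open>Products of the values of an entwined map\<close>

text \<open>The notion covers both \<open>\<rho>\<close> and \<open>D \<circ> \<rho>\<close>, the two kinds of factors in the image of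
  \<open>a\<^sub>0 da\<^sub>1 \<dots> da\<^sub>n\<close>.\<close>

definition entwined_maps where
  "entwined_maps K A R C \<psi> \<Psi> = {f \<in> linear_maps K A R.
     \<forall>X\<in>carrier (tensor K C A). tensor_map K R C f id (\<psi> X) = \<Psi> (tensor_map K C R id f X)}"

lemma entwined_linear: "\<sigma> \<in> entwined_maps K A R C \<psi> \<Psi> \<Longrightarrow> \<sigma> \<in> linear_maps K A R"
  by (simp add: entwined_maps_def)

text \<open>In the application \<open>\<tau>\<close> is \<open>D \<circ> \<rho>\<close>. Products \<open>r \<tau>(a\<^sub>1) \<dots> \<tau>(a\<^sub>n)\<close> are formed with a leading factor \<open>r\<close>,
  because a non-unital algebra has no empty product.\<close>

locale entwined_word =
  A: nonunital_entwining K A C \<psi> + R: nonunital_entwining K R C \<Psi>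
  for K :: "('k, 'm) ring_scheme" (structure)
    and A :: "('k, 'a, 'l) module_scheme"
    and C :: "('k, 'c, 'o) coalg_scheme"
    and \<psi>
    and R :: "('k, 'r, 'n) module_scheme"
    and \<Psi>
    and \<tau> :: "'a \<Rightarrow> 'r" +
  assumes tau: "\<tau> \<in> entwined_maps K A R C \<psi> \<Psi>"
begin

sublocale scalars K by unfold_locales

definition word_mult :: "'r \<Rightarrow> 'a list \<Rightarrow> 'r" where
  "word_mult r as = foldl (\<lambda>t a. t \<otimes>\<^bsub>R\<^esub> \<tau> a) r as"

lemma word_mult_simps [simp]:
  "word_mult r [] = r"
  "word_mult r (a # as) = word_mult (r \<otimes>\<^bsub>R\<^esub> \<tau> a) as"
  "word_mult r (as @ bs) = word_mult (word_mult r as) bs"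
  by (simp_all add: word_mult_def)

lemma tau_linear: "\<tau> \<in> linear_maps K A R"
  by (rule entwined_linear[OF tau])

lemma tau_closed: "a \<in> carrier A \<Longrightarrow> \<tau> a \<in> carrier R"
  by (rule linear_closed[OF tau_linear])

lemma word_mult_closed: "\<lbrakk>r \<in> carrier R; as \<in> lists (carrier A)\<rbrakk> \<Longrightarrow> word_mult r as \<in> carrier R"
  by (induct as arbitrary: r) (auto simp: R.mult_closed tau_closed)

lemma mult_word_mult:
  "\<lbrakk>r \<in> carrier R; s \<in> carrier R; as \<in> lists (carrier A)\<rbrakk>
    \<Longrightarrow> word_mult (r \<otimes>\<^bsub>R\<^esub> s) as = r \<otimes>\<^bsub>R\<^esub> word_mult s as"
  by (induct as arbitrary: s) (auto simp: R.mult_closed R.mult_assoc tau_closed)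

lemma word_mult_linear:
  "as \<in> lists (carrier A) \<Longrightarrow> (\<lambda>r. word_mult r as) \<in> linear_maps K R R"
proof (induct as)
  case Nil
  show ?case using linear_id[of R] by (simp add: id_def)
next
  case (Cons a as)
  then have "a \<in> carrier A" "as \<in> lists (carrier A)" by auto
  then show ?case
    using linear_comp[OF bilinear_left[OF R.mult_bilinear tau_closed] Cons.hyps] by simp
qed

lemma word_mult_slot_linear:
  assumes "f \<in> linear_maps K A R" "xs \<in> lists (carrier A)" "ys \<in> lists (carrier A)"
  shows "(\<lambda>a. word_mult (f a) xs) \<in> linear_maps K A R"
    and "r \<in> carrier R \<Longrightarrow> (\<lambda>x. word_mult r (xs @ x # ys)) \<in> linear_maps K A R"
proof -
  show "(\<lambda>a. word_mult (f a) xs) \<in> linear_maps K A R"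
    by (rule linear_comp[OF assms(1) word_mult_linear[OF assms(2)]])
  assume r: "r \<in> carrier R"
  show "(\<lambda>x. word_mult r (xs @ x # ys)) \<in> linear_maps K A R"
    using linear_comp[OF linear_comp[OF tau_linear bilinear_right[OF R.mult_bilinear
          word_mult_closed[OF r assms(2)]]] word_mult_linear[OF assms(3)]]
    by simp
qed

lemma psi_iter_closed:
  "\<lbrakk>c \<in> carrier C; as \<in> lists (carrier A)\<rbrakk>
    \<Longrightarrow> psi_iter K A C \<psi> c as \<in> carrier (tensor K (tpow K A (length as)) C)"
proof (induct as arbitrary: c)
  case Nil
  show ?case
    using tens_closed[OF tpow_module[OF A.modules(1)] A.modules(2)
        tpow_tens_closed[OF A.modules(1), of "[]" 0] Nil(1)]
    by (simp add: tpow_words_def)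
next
  case (Cons a as)
  then have a: "a \<in> carrier A" and as: "as \<in> lists (carrier A)" by auto
  let ?T = "tpow K A (Suc (length as))"
  note T = tpow_module[OF A.modules(1)]
  have cons: "lift K ?T (\<lambda>bs. tpow_tens K A (b # bs)) X \<in> carrier ?T"
    if "b \<in> carrier A" "X \<in> carrier (tpow K A (length as))" for b X
    by (rule lift_tpow_closed[OF A.modules(1) T tpow_tens_closed[OF A.modules(1)] that(2)])
      (use that(1) in \<open>auto simp: tpow_words_def\<close>)
  show ?case
    unfolding psi_iter.simps Let_def list.size add_0_right add_Suc_right
    by (rule lift_tensor_closed[OF A.modules tensor_module[OF T A.modules(2)]
          tensor_map_closed[OF T A.modules(2) T A.modules(2) cons _ Cons.hyps[OF _ as]]
          linear_closed[OF A.psi_linear tens_closed[OF A.modules(2,1) Cons.prems(1) a]]])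
      simp_all
qed

lemma lift_word_mult:
  assumes r: "r \<in> carrier R"
  shows "lift K R (word_mult r) \<in> linear_maps K (tpow K A n) R"
    and "as \<in> tpow_words A n \<Longrightarrow> lift K R (word_mult r) (tpow_tens K A as) = word_mult r as"
proof -
  have cl: "word_mult r as \<in> carrier R" if "as \<in> tpow_words A n" for as
    using that by (intro word_mult_closed[OF r]) (simp add: tpow_words_def)
  note u = lift_tpow[OF A.modules(1) R.modules(1) cl word_mult_slot_linear(2)[OF tau_linear _ _ r]]
  show "lift K R (word_mult r) \<in> linear_maps K (tpow K A n) R" by (rule u(1))
  show "lift K R (word_mult r) (tpow_tens K A as) = word_mult r as" if "as \<in> tpow_words A n"
    by (rule u(2)[OF _ _ _ that])
qed

text \<open>The product \<open>\<sigma>(a\<^sub>0) \<tau>(a\<^sub>1) \<dots> \<tau>(a\<^sub>n)\<close>, meaningful for nonempty words. Under the map to be constructed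
  it is the image of \<open>a\<^sub>0 da\<^sub>1 \<dots> da\<^sub>n\<close> if \<open>\<sigma> = \<rho>\<close>, and that of \<open>da\<^sub>0 \<dots> da\<^sub>n\<close> if \<open>\<sigma> = \<tau>\<close>.\<close>

definition head_word :: "('a \<Rightarrow> 'r) \<Rightarrow> 'a list \<Rightarrow> 'r" where
  "head_word \<sigma> as = word_mult (\<sigma> (hd as)) (tl as)"

lemma head_word_closed:
  "\<lbrakk>\<sigma> \<in> linear_maps K A R; as \<in> lists (carrier A); as \<noteq> []\<rbrakk> \<Longrightarrow> head_word \<sigma> as \<in> carrier R"
  unfolding head_word_def by (cases as) (auto intro!: word_mult_closed linear_closed[of \<sigma>])

lemma head_word_slot_linear:
  assumes s: "\<sigma> \<in> linear_maps K A R" and xs: "xs \<in> lists (carrier A)" and ys: "ys \<in> lists (carrier A)"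
  shows "(\<lambda>x. head_word \<sigma> (xs @ x # ys)) \<in> linear_maps K A R"
proof (cases xs)
  case Nil
  then show ?thesis using word_mult_slot_linear(1)[OF s ys ys] by (simp add: head_word_def)
next
  case (Cons b bs)
  then have "b \<in> carrier A" "bs \<in> lists (carrier A)" using xs by auto
  then show ?thesis
    using word_mult_slot_linear(2)[OF s _ ys linear_closed[OF s], of bs b] Cons
    by (simp add: head_word_def)
qed

lemma lift_head_word:
  assumes s: "\<sigma> \<in> linear_maps K A R"
  shows "lift K R (head_word \<sigma>) \<in> linear_maps K (tpow K A (Suc n)) R"
    and "as \<in> tpow_words A (Suc n) \<Longrightarrow> lift K R (head_word \<sigma>) (tpow_tens K A as) = head_word \<sigma> as"
proof -
  have cl: "head_word \<sigma> as \<in> carrier R" if "as \<in> tpow_words A (Suc n)" for as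
    by (rule head_word_closed[OF s]) (use that in \<open>auto simp: tpow_words_def\<close>)
  note u = lift_tpow[OF A.modules(1) R.modules(1) cl head_word_slot_linear[OF s]]
  show "lift K R (head_word \<sigma>) \<in> linear_maps K (tpow K A (Suc n)) R" by (rule u(1))
  show "lift K R (head_word \<sigma>) (tpow_tens K A as) = head_word \<sigma> as" if "as \<in> tpow_words A (Suc n)"
    by (rule u(2)[OF _ _ _ that])
qed

lemma entwined_tens:
  assumes "\<sigma> \<in> entwined_maps K A R C \<psi> \<Psi>" "c \<in> carrier C" "a \<in> carrier A"
  shows "tensor_map K R C \<sigma> id (\<psi> (tens K C A c a)) = \<Psi> (tens K C R c (\<sigma> a))"
proof -
  note s = entwined_linear[OF assms(1)]
  have "tensor_map K R C \<sigma> id (\<psi> (tens K C A c a)) = \<Psi> (tensor_map K C R id \<sigma> (tens K C A c a))"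
    using assms(1) tens_closed[OF A.modules(2,1) assms(2,3)] by (simp add: entwined_maps_def)
  then show ?thesis
    by (simp add: tensor_map_tens[OF A.modules(2,1) R.modules(2,1) linear_id s assms(2,3)])
qed

text \<open>One step of the recursion that defines \<open>psi_iter\<close>. The operator \<open>G\<close> stands for moving the
  coalgebra element past the remaining word \<open>as\<close> and multiplying the outcome to the given left
  factor. The first letter contributes \<open>\<psi>(c \<otimes> a)\<close>, which \<open>\<sigma>\<close> turns into \<open>\<Psi>(c \<otimes> \<sigma>(a))\<close>.\<close>

lemma psi_iter_step:
  assumes c: "c \<in> carrier C" and a: "a \<in> carrier A" and as: "as \<in> lists (carrier A)"
    and s: "\<sigma> \<in> entwined_maps K A R C \<psi> \<Psi>"
    and G: "G \<in> linear_maps K (tensor K R C) (tensor K R C)"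
    and G_tens: "\<And>r e. \<lbrakk>r \<in> carrier R; e \<in> carrier C\<rbrakk>
      \<Longrightarrow> tensor_map K R C (lift K R (word_mult r)) id (psi_iter K A C \<psi> e as) = G (tens K R C r e)"
  shows "tensor_map K R C (lift K R (head_word \<sigma>)) id (psi_iter K A C \<psi> c (a # as))
    = G (\<Psi> (tens K C R c (\<sigma> a)))"
proof -
  let ?n = "length as"
  let ?T = "tpow K A (Suc ?n)"
  note A = A.modules(1) and C = A.modules(2) and R = R.modules(1)
  note T = tpow_module[OF A] and RC = tensor_module[OF R C]
  let ?cons = "\<lambda>b. lift K ?T (\<lambda>bs. tpow_tens K A (b # bs))"
  note s_lin = entwined_linear[OF s]
  have cons_word: "b # bs \<in> tpow_words A (Suc ?n)" if "b \<in> carrier A" "bs \<in> tpow_words A ?n" for b bs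
    using that by (auto simp: tpow_words_def)
  have cons_cl: "?cons b X \<in> carrier ?T" if "b \<in> carrier A" "X \<in> carrier (tpow K A ?n)" for b X
    by (rule lift_tpow_closed[OF A T tpow_tens_closed[OF A cons_word[OF that(1)]] that(2)])
  \<comment> \<open>prefixing the letter \<open>b\<close> to a word puts \<open>\<sigma>(b)\<close> in front of its product\<close>
  have head_cons: "lift K R (head_word \<sigma>) (?cons b X) = lift K R (word_mult (\<sigma> b)) X"
    if b: "b \<in> carrier A" and X: "X \<in> carrier (tpow K A ?n)" for b X
  proof (rule lift_tpow_compare[OF A T R tpow_tens_closed[OF A cons_word[OF b]]
        lift_head_word(1)[OF s_lin] lift_word_mult(1)[OF linear_closed[OF s_lin b]] _ X])
    fix bs assume bs: "bs \<in> tpow_words A ?n"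
    show "lift K R (head_word \<sigma>) (tpow_tens K A (b # bs)) = lift K R (word_mult (\<sigma> b)) (tpow_tens K A bs)"
      unfolding lift_head_word(2)[OF s_lin cons_word[OF b bs]]
        lift_word_mult(2)[OF linear_closed[OF s_lin b] bs]
      by (simp add: head_word_def)
  qed
  note head_lin = tensor_map_linear[OF T C R C lift_head_word(1)[OF s_lin] linear_id]
  have "tensor_map K R C (lift K R (head_word \<sigma>)) id (psi_iter K A C \<psi> c (a # as))
      = G (tensor_map K R C \<sigma> id (\<psi> (tens K C A c a)))"
    unfolding psi_iter.simps Let_def
  proof (rule lift_tensor_compare[OF A C tensor_module[OF T C] RC _ head_lin])
    show "(\<lambda>X. G (tensor_map K R C \<sigma> id X)) \<in> linear_maps K (tensor K A C) (tensor K R C)"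
      by (rule linear_comp[OF tensor_map_linear[OF A C R C s_lin linear_id] G])
    show "\<psi> (tens K C A c a) \<in> carrier (tensor K A C)"
      by (rule linear_closed[OF A.psi_linear tens_closed[OF C A c a]])
    fix b e assume b: "b \<in> carrier A" and e: "e \<in> carrier C"
    note iter = psi_iter_closed[OF e as]
    show "tensor_map K ?T C (?cons b) id (psi_iter K A C \<psi> e as) \<in> carrier (tensor K ?T C)"
      by (rule tensor_map_closed[OF T C T C cons_cl[OF b] _ iter]) simp_all
    have "tensor_map K R C (lift K R (head_word \<sigma>)) id (tensor_map K ?T C (?cons b) id (psi_iter K A C \<psi> e as))
        = tensor_map K R C (lift K R (word_mult (\<sigma> b))) id (psi_iter K A C \<psi> e as)"
    proof (rule tensor_map_compare[OF T C T C RC cons_cl[OF b] _ head_lin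
          tensor_map_linear[OF T C R C lift_word_mult(1)[OF linear_closed[OF s_lin b]] linear_id] _ iter])
      fix X f assume X: "X \<in> carrier (tpow K A ?n)" and f: "f \<in> carrier C"
      show "tensor_map K R C (lift K R (head_word \<sigma>)) id (tens K ?T C (?cons b X) (id f))
          = tensor_map K R C (lift K R (word_mult (\<sigma> b))) id (tens K (tpow K A ?n) C X f)"
        using tensor_map_tens[OF T C R C lift_head_word(1)[OF s_lin] linear_id cons_cl[OF b X] f]
          tensor_map_tens[OF T C R C lift_word_mult(1)[OF linear_closed[OF s_lin b]] linear_id X f]
        by (simp add: head_cons[OF b X])
    qed simp_all
    also have "\<dots> = G (tensor_map K R C \<sigma> id (tens K A C b e))"
      unfolding tensor_map_tens[OF A C R C s_lin linear_id b e]
      using G_tens[OF linear_closed[OF s_lin b] e] by simp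
    finally show "tensor_map K R C (lift K R (head_word \<sigma>)) id
        (tensor_map K ?T C (?cons b) id (psi_iter K A C \<psi> e as)) = G (tensor_map K R C \<sigma> id (tens K A C b e))" .
  qed
  then show ?thesis unfolding entwined_tens[OF s c a] .
qed

text \<open>Induction on the word. The head map \<open>\<sigma>\<close> is generalized, because the tail of the word is headed by
  \<open>\<tau>\<close> instead. In the induction step \<open>G\<close> is the operator \<open>r \<otimes> e \<mapsto> r \<Psi>(e \<otimes> s)\<close> of \<open>psi_mult_tens\<close>, with \<open>s\<close>
  the product belonging to the tail.\<close>

lemma psi_iter_head_word:
  assumes "c \<in> carrier C" "a \<in> carrier A" "as \<in> lists (carrier A)" "\<sigma> \<in> entwined_maps K A R C \<psi> \<Psi>"
  shows "tensor_map K R C (lift K R (head_word \<sigma>)) id (psi_iter K A C \<psi> c (a # as))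
    = \<Psi> (tens K C R c (word_mult (\<sigma> a) as))"
  using assms
proof (induct as arbitrary: c a \<sigma>)
  case Nil
  note A = A.modules(1) and C = A.modules(2) and R = R.modules(1)
  have nil: "[] \<in> tpow_words A 0" by (simp add: tpow_words_def)
  have "tensor_map K R C (lift K R (head_word \<sigma>)) id (psi_iter K A C \<psi> c [a]) = id (\<Psi> (tens K C R c (\<sigma> a)))"
  proof (rule psi_iter_step[OF Nil(1-4) linear_id])
    fix r e assume r: "r \<in> carrier R" and e: "e \<in> carrier C"
    show "tensor_map K R C (lift K R (word_mult r)) id (psi_iter K A C \<psi> e []) = id (tens K R C r e)"
      using tensor_map_tens[OF tpow_module[OF A] C R C lift_word_mult(1)[OF r] linear_id
          tpow_tens_closed[OF A nil] e]
      by (simp add: lift_word_mult(2)[OF r nil])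
  qed
  also have "id (\<Psi> (tens K C R c (\<sigma> a))) = \<Psi> (tens K C R c (\<sigma> a))" by (rule id_apply)
  finally show ?case by (simp only: word_mult_simps)
next
  case (Cons a' as)
  note A = A.modules(1) and C = A.modules(2) and R = R.modules(1)
  note T = tpow_module[OF A] and RC = tensor_module[OF R C]
  let ?n = "length as"
  from Cons.prems have a': "a' \<in> carrier A" and as: "as \<in> lists (carrier A)" by auto
  have sa: "\<sigma> a \<in> carrier R"
    by (rule linear_closed[OF entwined_linear[OF Cons.prems(4)] Cons.prems(2)])
  let ?s = "word_mult (\<tau> a') as"
  have s: "?s \<in> carrier R" by (rule word_mult_closed[OF tau_closed[OF a'] as])
  let ?h = "\<lambda>r e. tensor_map K R C (\<lambda>t. r \<otimes>\<^bsub>R\<^esub> t) id (\<Psi> (tens K C R e ?s))"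
  let ?G = "lift K (tensor K R C) (\<lambda>(r, e). ?h r e)"
  note h = R.left_mult_psi_bilinear[OF s]
  have "tensor_map K R C (lift K R (head_word \<sigma>)) id (psi_iter K A C \<psi> c (a # a' # as))
      = ?G (\<Psi> (tens K C R c (\<sigma> a)))"
  proof (rule psi_iter_step[OF Cons.prems(1,2,3,4) lift_tensor_linear[OF R C RC h]])
    fix r e assume r: "r \<in> carrier R" and e: "e \<in> carrier C"
    note mr = bilinear_right[OF R.mult_bilinear r]
    note iter = psi_iter_closed[OF e Cons.prems(3), unfolded list.size add_0_right add_Suc_right]
    have cl: "head_word \<tau> as' \<in> carrier R" if "as' \<in> tpow_words A (Suc ?n)" for as'
      by (rule head_word_closed[OF tau_linear]) (use that in \<open>auto simp: tpow_words_def\<close>)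
    have word: "r \<otimes>\<^bsub>R\<^esub> lift K R (head_word \<tau>) X = lift K R (word_mult r) X"
      if X: "X \<in> carrier (tpow K A (Suc ?n))" for X
    proof (rule lift_tpow_compare[OF A R R cl mr lift_word_mult(1)[OF r] _ X])
      fix as' assume as': "as' \<in> tpow_words A (Suc ?n)"
      then obtain b bs where b: "as' = b # bs" "b \<in> carrier A" "bs \<in> lists (carrier A)"
        by (cases as') (auto simp: tpow_words_def)
      show "r \<otimes>\<^bsub>R\<^esub> head_word \<tau> as' = lift K R (word_mult r) (tpow_tens K A as')"
        unfolding lift_word_mult(2)[OF r as']
        using mult_word_mult[OF r tau_closed[OF b(2)] b(3)] by (simp add: b head_word_def)
    qed
    note tl = lift_head_word(1)[OF tau_linear, of ?n]
    have "tensor_map K R C (lift K R (word_mult r)) id (psi_iter K A C \<psi> e (a' # as))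
        = tensor_map K R C (\<lambda>t. r \<otimes>\<^bsub>R\<^esub> t) id
            (tensor_map K R C (lift K R (head_word \<tau>)) id (psi_iter K A C \<psi> e (a' # as)))"
    proof (rule tensor_ext[OF T C RC _ _ _ iter])
      show "tensor_map K R C (lift K R (word_mult r)) id
          \<in> linear_maps K (tensor K (tpow K A (Suc ?n)) C) (tensor K R C)"
        by (rule tensor_map_linear[OF T C R C lift_word_mult(1)[OF r] linear_id])
      show "(\<lambda>X. tensor_map K R C (\<lambda>t. r \<otimes>\<^bsub>R\<^esub> t) id (tensor_map K R C (lift K R (head_word \<tau>)) id X))
          \<in> linear_maps K (tensor K (tpow K A (Suc ?n)) C) (tensor K R C)"
        by (rule linear_comp[OF tensor_map_linear[OF T C R C tl linear_id]
              tensor_map_linear[OF R C R C mr linear_id]])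
      fix X f assume X: "X \<in> carrier (tpow K A (Suc ?n))" and f: "f \<in> carrier C"
      show "tensor_map K R C (lift K R (word_mult r)) id (tens K (tpow K A (Suc ?n)) C X f)
          = tensor_map K R C (\<lambda>t. r \<otimes>\<^bsub>R\<^esub> t) id
              (tensor_map K R C (lift K R (head_word \<tau>)) id (tens K (tpow K A (Suc ?n)) C X f))"
        unfolding tensor_map_tens[OF T C R C tl linear_id X f]
          tensor_map_tens[OF T C R C lift_word_mult(1)[OF r] linear_id X f]
        using tensor_map_tens[OF R C R C mr linear_id linear_closed[OF tl X] f]
        by (simp add: word[OF X])
    qed
    also have "\<dots> = ?h r e"
      unfolding Cons.hyps[OF e a' as tau] by (rule refl)
    also have "\<dots> = ?G (tens K R C r e)"
      by (rule lift_tens[OF R C RC h r e, symmetric])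
    finally show "tensor_map K R C (lift K R (word_mult r)) id (psi_iter K A C \<psi> e (a' # as))
        = ?G (tens K R C r e)" .
  qed
  also have "\<dots> = \<Psi> (tens K C R c (\<sigma> a \<otimes>\<^bsub>R\<^esub> ?s))"
    by (rule R.psi_mult_tens[OF Cons.prems(1) sa s, symmetric])
  also have "\<sigma> a \<otimes>\<^bsub>R\<^esub> ?s = word_mult (\<sigma> a) (a' # as)"
    using mult_word_mult[OF sa tau_closed[OF a'] as] by simp
  finally show ?case .
qed

end

section \<open>The universal differential graded algebra as a module\<close>

context scalars
begin

lemma unitization_simps:
  "carrier (unitization K A) = carrier A \<times> carrier K"
  "\<zero>\<^bsub>unitization K A\<^esub> = (\<zero>\<^bsub>A\<^esub>, \<zero>)"
  "(a, \<mu>) \<oplus>\<^bsub>unitization K A\<^esub> (b, \<nu>) = (a \<oplus>\<^bsub>A\<^esub> b, \<mu> \<oplus> \<nu>)"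
  "k \<odot>\<^bsub>unitization K A\<^esub> (a, \<mu>) = (k \<odot>\<^bsub>A\<^esub> a, k \<otimes> \<mu>)"
  "(a, \<mu>) \<otimes>\<^bsub>unitization K A\<^esub> (b, \<nu>)
    = (a \<otimes>\<^bsub>A\<^esub> b \<oplus>\<^bsub>A\<^esub> \<mu> \<odot>\<^bsub>A\<^esub> b \<oplus>\<^bsub>A\<^esub> \<nu> \<odot>\<^bsub>A\<^esub> a, \<mu> \<otimes> \<nu>)"
  by (simp_all add: unitization_def)

lemma unitization_module:
  assumes "module K A"
  shows "module K (unitization K A)"
proof -
  interpret A: module K A by fact
  show ?thesis
  proof (rule moduleI[OF is_cring])
    show "abelian_group (unitization K A)"
    proof (rule abelian_groupI)
      fix x assume "x \<in> carrier (unitization K A)"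
      then obtain a \<mu> where "x = (a, \<mu>)" "a \<in> carrier A" "\<mu> \<in> carrier K"
        by (auto simp: unitization_simps)
      then show "\<exists>y\<in>carrier (unitization K A). y \<oplus>\<^bsub>unitization K A\<^esub> x = \<zero>\<^bsub>unitization K A\<^esub>"
        by (intro bexI[of _ "(\<ominus>\<^bsub>A\<^esub> a, \<ominus> \<mu>)"]) (auto simp: unitization_simps l_neg A.l_neg)
    qed (auto simp: unitization_simps a_ac A.a_ac)
  qed (auto simp: unitization_simps l_distr r_distr m_assoc A.smult_l_distr A.smult_r_distr A.smult_assoc1)
qed

lemma omega_gensI:
  "\<lbrakk>p \<in> carrier (unitization K A); as \<in> lists (carrier A); as = [] \<Longrightarrow> snd p = \<zero>\<rbrakk>
    \<Longrightarrow> (p, as) \<in> omega_gens K A"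
  by (cases p) (auto simp: omega_gens_def unitization_simps)

lemma omega_gensD:
  assumes "(p, as) \<in> omega_gens K A"
  shows "p \<in> carrier (unitization K A)" "as \<in> lists (carrier A)" "as = [] \<Longrightarrow> snd p = \<zero>"
  using assms by (auto simp: omega_gens_def unitization_simps)

lemma omega_rels_subset:
  assumes A: "module K A"
  shows "omega_rels K A \<subseteq> carrier (free_module K (omega_gens K A))"
proof -
  have "linear_rels K (omega_gens K A) A (\<lambda>x. (p, xs @ x # ys)) \<subseteq> carrier (free_module K (omega_gens K A))"
    if "p \<in> carrier (unitization K A)" "xs \<in> lists (carrier A)" "ys \<in> lists (carrier A)" for p xs ys
    by (rule linear_rels_subset[OF A omega_gensI]) (use that in auto)
  moreover have "linear_rels K (omega_gens K A) (unitization K A) (\<lambda>p. (p, as))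
      \<subseteq> carrier (free_module K (omega_gens K A))" if "as \<in> lists (carrier A) - {[]}" for as
    by (rule linear_rels_subset[OF unitization_module[OF A] omega_gensI]) (use that in auto)
  moreover have "linear_rels K (omega_gens K A) A (\<lambda>a. ((a, \<zero>), []))
      \<subseteq> carrier (free_module K (omega_gens K A))"
    by (rule linear_rels_subset[OF A omega_gensI]) (auto simp: unitization_simps)
  ultimately show ?thesis unfolding omega_rels_def by blast
qed

lemma omega_module_module: "module K A \<Longrightarrow> module K (omega_module K A)"
  unfolding omega_module_def by (rule presented_module[OF omega_rels_subset])

lemma Omega_simps:
  "carrier (Omega K A) = carrier (omega_module K A)"
  "zero (Omega K A) = zero (omega_module K A)"
  "add (Omega K A) = add (omega_module K A)"
  "smult (Omega K A) = smult (omega_module K A)"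
  by (simp_all add: Omega_def Let_def)

lemma Omega_module:
  assumes "module K A"
  shows "module K (Omega K A)"
proof -
  interpret W: module K "omega_module K A" by (rule omega_module_module[OF assms])
  show ?thesis
    by (rule module_surj_image[OF W.module_axioms, of _ "\<lambda>x. x"]) (simp_all add: Omega_simps)
qed

lemma linear_maps_Omega: "linear_maps K (Omega K A) P = linear_maps K (omega_module K A) P"
  by (simp add: linear_maps_def Omega_simps)

lemma omega_gen_closed:
  "\<lbrakk>module K A; (p, as) \<in> omega_gens K A\<rbrakk> \<Longrightarrow> omega_gen K A p as \<in> carrier (omega_module K A)"
  unfolding omega_module_def omega_gen_def by (rule gen_closed[OF omega_rels_subset])

lemma lift_omega_closed:
  assumes "module K A" "module K P"
    and "\<And>p as. (p, as) \<in> omega_gens K A \<Longrightarrow> f (p, as) \<in> carrier P" "X \<in> carrier (omega_module K A)"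
  shows "lift K P f X \<in> carrier P"
  by (rule lift_closed[OF assms(2) omega_rels_subset[OF assms(1)] _ assms(4)[unfolded omega_module_def]])
    (use assms(3) in auto)

lemma lift_omega_compare:
  assumes "module K A" "module K P" "module K Q"
    and "\<And>p as. (p, as) \<in> omega_gens K A \<Longrightarrow> f (p, as) \<in> carrier P"
    and "L \<in> linear_maps K P Q" "H \<in> linear_maps K (omega_module K A) Q"
    and "\<And>p as. (p, as) \<in> omega_gens K A \<Longrightarrow> L (f (p, as)) = H (omega_gen K A p as)"
    and "X \<in> carrier (omega_module K A)"
  shows "L (lift K P f X) = H X"
  by (rule lift_compare[OF assms(2,3) omega_rels_subset[OF assms(1)] _ assms(5)
        assms(6)[unfolded omega_module_def] _ assms(8)[unfolded omega_module_def]])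
    (use assms(4,7) in \<open>auto simp: omega_gen_def\<close>)

lemma lift_omega:
  assumes A: "module K A" and P: "module K P"
    and cl: "\<And>p as. (p, as) \<in> omega_gens K A \<Longrightarrow> f (p, as) \<in> carrier P"
    and zero: "(\<lambda>a. f ((a, \<zero>), [])) \<in> linear_maps K A P"
    and head: "\<And>as. \<lbrakk>as \<in> lists (carrier A); as \<noteq> []\<rbrakk>
      \<Longrightarrow> (\<lambda>p. f (p, as)) \<in> linear_maps K (unitization K A) P"
    and slot: "\<And>p xs ys. \<lbrakk>p \<in> carrier (unitization K A); xs \<in> lists (carrier A); ys \<in> lists (carrier A)\<rbrakk>
      \<Longrightarrow> (\<lambda>x. f (p, xs @ x # ys)) \<in> linear_maps K A P"
  shows lift_omega_linear: "lift K P f \<in> linear_maps K (omega_module K A) P"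
    and lift_omega_gen: "(p, as) \<in> omega_gens K A \<Longrightarrow> lift K P f (omega_gen K A p as) = f (p, as)"
proof -
  let ?S = "omega_gens K A"
  have cl': "f s \<in> carrier P" if "s \<in> ?S" for s using that cl by (cases s) auto
  then have fS: "f \<in> ?S \<rightarrow> carrier P" by auto
  have "kills P f (linear_rels K ?S A (\<lambda>a. ((a, \<zero>), [])))"
    by (rule kills_linear_rels[OF P A fS omega_gensI zero]) (auto simp: unitization_simps)
  moreover have "kills P f (linear_rels K ?S (unitization K A) (\<lambda>p. (p, as)))"
    if "as \<in> lists (carrier A) - {[]}" for as
    by (rule kills_linear_rels[OF P unitization_module[OF A] fS omega_gensI head]) (use that in auto)
  moreover have "kills P f (linear_rels K ?S A (\<lambda>x. (p, xs @ x # ys)))"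
    if "p \<in> carrier (unitization K A)" "xs \<in> lists (carrier A)" "ys \<in> lists (carrier A)" for p xs ys
    by (rule kills_linear_rels[OF P A fS omega_gensI slot]) (use that in auto)
  ultimately have "kills P f (omega_rels K A)"
    unfolding omega_rels_def kills_def by blast
  note u = lift_universal[OF P omega_rels_subset[OF A] cl' this]
  show "lift K P f \<in> linear_maps K (omega_module K A) P"
    unfolding omega_module_def by (rule u(1))
  show "lift K P f (omega_gen K A p as) = f (p, as)" if "(p, as) \<in> ?S"
    unfolding omega_gen_def by (rule u(2)[OF _ that])
qed

end


section \<open>The induced map\<close>

sublocale dg_entwining_over \<subseteq> scalars K by unfold_locales

lemma (in dg_entwining_over) rho_entwined: "\<rho> \<in> entwined_maps K A R C \<psi> \<Psi>"
  using rho_linear rho_psi by (simp add: entwined_maps_def)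

text \<open>The intertwining relation of \<open>\<rho>\<close> composed with that of \<open>D\<close>, which \<open>Psi_diff\<close> provides.\<close>

lemma (in dg_entwining_over) diff_rho_entwined: "(\<lambda>a. diff R (\<rho> a)) \<in> entwined_maps K A R C \<psi> \<Psi>"
proof -
  have A: "module K A" and C: "module K C" and R: "module K R" by unfold_locales
  have E: "nonunital_entwining K A C \<psi>" "nonunital_entwining K R C \<Psi>" by unfold_locales
  note psi = nonunital_entwining.psi_linear[OF E(1)] and Psi = nonunital_entwining.psi_linear[OF E(2)]
  have lin: "(\<lambda>a. diff R (\<rho> a)) \<in> linear_maps K A R" by (rule linear_comp[OF rho_linear diff_linear])
  have comp1: "tensor_map K R C (\<lambda>a. diff R (\<rho> a)) id X = tensor_map K R C (diff R) id (tensor_map K R C \<rho> id X)"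
    if "X \<in> carrier (tensor K A C)" for X
    by (rule tensor_ext[OF A C tensor_module[OF R C] tensor_map_linear[OF A C R C lin linear_id]
          linear_comp[OF tensor_map_linear[OF A C R C rho_linear linear_id]
            tensor_map_linear[OF R C R C diff_linear linear_id]] _ that])
      (simp add: tensor_map_tens[OF A C R C lin linear_id] tensor_map_tens[OF A C R C rho_linear linear_id]
        tensor_map_tens[OF R C R C diff_linear linear_id] linear_closed[OF rho_linear])
  have comp2: "tensor_map K C R id (\<lambda>a. diff R (\<rho> a)) X = tensor_map K C R id (diff R) (tensor_map K C R id \<rho> X)"
    if "X \<in> carrier (tensor K C A)" for X
    by (rule tensor_ext[OF C A tensor_module[OF C R] tensor_map_linear[OF C A C R linear_id lin]
          linear_comp[OF tensor_map_linear[OF C A C R linear_id rho_linear]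
            tensor_map_linear[OF C R C R linear_id diff_linear]] _ that])
      (simp add: tensor_map_tens[OF C A C R linear_id lin] tensor_map_tens[OF C A C R linear_id rho_linear]
        tensor_map_tens[OF C R C R linear_id diff_linear] linear_closed[OF rho_linear])
  have "tensor_map K R C (\<lambda>a. diff R (\<rho> a)) id (\<psi> X) = \<Psi> (tensor_map K C R id (\<lambda>a. diff R (\<rho> a)) X)"
    if X: "X \<in> carrier (tensor K C A)" for X
    unfolding comp1[OF linear_closed[OF psi X]] comp2[OF X] rho_psi[OF X]
    by (rule Psi_diff[OF linear_closed[OF tensor_map_linear[OF C A C R linear_id rho_linear] X]])
  then show ?thesis using lin by (simp add: entwined_maps_def)
qed

sublocale dg_entwining_over \<subseteq> word: entwined_word K A C \<psi> R \<Psi> "\<lambda>a. diff R (\<rho> a)"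
  by unfold_locales (rule diff_rho_entwined)

context dg_entwining_over
begin

abbreviation d\<rho> :: "'a \<Rightarrow> 'r" where "d\<rho> a \<equiv> diff R (\<rho> a)"

abbreviation dword :: "'a list \<Rightarrow> 'r" where "dword \<equiv> word.head_word d\<rho>"

text \<open>The image of \<open>(a + \<mu>) da\<^sub>1 \<dots> da\<^sub>n\<close>. The second summand is cut off in degree \<open>0\<close>, where \<open>dword []\<close>
  is an unspecified element.\<close>

fun hat_gen :: "('a \<times> 'k) \<times> 'a list \<Rightarrow> 'r" where
  "hat_gen ((a, \<mu>), as) =
    word.word_mult (\<rho> a) as \<oplus>\<^bsub>R\<^esub> (if as = [] then \<zero>\<^bsub>R\<^esub> else \<mu> \<odot>\<^bsub>R\<^esub> dword as)"

definition hat :: "(('a \<times> 'k) \<times> 'a list \<Rightarrow> 'k) set \<Rightarrow> 'r" where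
  "hat = lift K R hat_gen"

lemma modA: "module K A" and modC: "module K C" and modR: "module K R"
  by unfold_locales

lemma algA: "nonunital_algebra K A" and algR: "nonunital_algebra K R"
  by unfold_locales

lemma abgroupR: "abelian_group R"
  by unfold_locales

lemmas addR = abelian_group.axioms(1)[OF abgroupR]
  and addA = abelian_group.axioms(1)[OF module.axioms(2)[OF modA]]

lemmas R_smult_closed = module.smult_closed[OF modR]
  and R_smult_l_distr = module.smult_l_distr[OF modR]
  and R_smult_r_distr = module.smult_r_distr[OF modR]
  and R_smult_assoc1 = module.smult_assoc1[OF modR]
  and R_submoduleE = module.submoduleE[OF modR]
  and R_a_closed = abelian_monoid.a_closed[OF addR]
  and R_a_ac = abelian_monoid.a_ac[OF addR]
  and R_mult_bilinear = nonunital_algebra.mult_bilinear[OF algR]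
  and R_mult_closed = nonunital_algebra.mult_closed[OF algR]
  and R_mult_assoc = nonunital_algebra.mult_assoc[OF algR]
  and R_distr_l = nonunital_algebra.mult_distr_l[OF algR]
  and R_distr_r = nonunital_algebra.mult_distr_r[OF algR]
  and R_smult_mult_l = nonunital_algebra.smult_mult_l[OF algR]
  and R_smult_mult_r = nonunital_algebra.smult_mult_r[OF algR]
  and A_mult_closed = nonunital_algebra.mult_closed[OF algA]

lemma drho_closed: "a \<in> carrier A \<Longrightarrow> d\<rho> a \<in> carrier R"
  by (rule word.tau_closed)

lemma rho_closed: "a \<in> carrier A \<Longrightarrow> \<rho> a \<in> carrier R"
  by (rule linear_closed[OF rho_linear])

lemma diff_closed: "x \<in> carrier R \<Longrightarrow> diff R x \<in> carrier R"
  by (rule linear_closed[OF diff_linear])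

lemma hat_gen_closed:
  "\<lbrakk>p \<in> carrier (unitization K A); as \<in> lists (carrier A)\<rbrakk> \<Longrightarrow> hat_gen (p, as) \<in> carrier R"
proof -
  assume p: "p \<in> carrier (unitization K A)" and as: "as \<in> lists (carrier A)"
  obtain a \<mu> where "p = (a, \<mu>)" "a \<in> carrier A" "\<mu> \<in> carrier K"
    using p by (auto simp: unitization_simps)
  then show ?thesis
    using as by (auto intro!: R_a_closed word.word_mult_closed rho_closed R_smult_closed
        word.head_word_closed[OF word.tau_linear])
qed

lemma hat_gen_head_linear:
  assumes as: "as \<in> lists (carrier A)" "as \<noteq> []"
  shows "(\<lambda>p. hat_gen (p, as)) \<in> linear_maps K (unitization K A) R"
proof -
  note w = word.word_mult_slot_linear(1)[OF rho_linear as(1) as(1)]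
  have d: "dword as \<in> carrier R" by (rule word.head_word_closed[OF word.tau_linear as])
  show ?thesis
  proof (rule linear_mapsI)
    show "hat_gen (p, as) \<in> carrier R" if "p \<in> carrier (unitization K A)" for p
      by (rule hat_gen_closed[OF that as(1)])
  next
    fix p q assume "p \<in> carrier (unitization K A)" "q \<in> carrier (unitization K A)"
    then obtain a \<mu> b \<nu> where pq: "p = (a, \<mu>)" "q = (b, \<nu>)" and a: "a \<in> carrier A" "\<mu> \<in> carrier K"
      "b \<in> carrier A" "\<nu> \<in> carrier K" by (auto simp: unitization_simps)
    show "hat_gen (p \<oplus>\<^bsub>unitization K A\<^esub> q, as) = hat_gen (p, as) \<oplus>\<^bsub>R\<^esub> hat_gen (q, as)"
      using a as(2) d linear_closed[OF w]
      by (simp add: pq unitization_simps linear_add[OF w] R_smult_l_distr R_a_ac)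
  next
    fix k p assume k: "k \<in> carrier K" and "p \<in> carrier (unitization K A)"
    then obtain a \<mu> where p: "p = (a, \<mu>)" and a: "a \<in> carrier A" "\<mu> \<in> carrier K"
      by (auto simp: unitization_simps)
    show "hat_gen (k \<odot>\<^bsub>unitization K A\<^esub> p, as) = k \<odot>\<^bsub>R\<^esub> hat_gen (p, as)"
      using k a as(2) d linear_closed[OF w]
      by (simp add: p unitization_simps linear_smult[OF w] R_smult_r_distr R_smult_assoc1)
  qed
qed

lemma
  shows hat_linear: "hat \<in> linear_maps K (omega_module K A) R"
    and hat_omega_gen: "(p, as) \<in> omega_gens K A \<Longrightarrow> hat (omega_gen K A p as) = hat_gen (p, as)"
proof -
  have cl: "hat_gen (p, as) \<in> carrier R" if "(p, as) \<in> omega_gens K A" for p as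
    by (rule hat_gen_closed[OF omega_gensD(1,2)[OF that]])
  have zero: "(\<lambda>a. hat_gen ((a, \<zero>), [])) \<in> linear_maps K A R"
    using linear_sum[OF modR rho_linear linear_const_zero[OF modR]] by simp
  have slot: "(\<lambda>x. hat_gen (p, xs @ x # ys)) \<in> linear_maps K A R"
    if pU: "p \<in> carrier (unitization K A)" and xs: "xs \<in> lists (carrier A)" and ys: "ys \<in> lists (carrier A)"
    for p xs ys
  proof -
    obtain a \<mu> where p: "p = (a, \<mu>)" "a \<in> carrier A" "\<mu> \<in> carrier K"
      using pU by (auto simp: unitization_simps)
    show ?thesis
      using linear_sum[OF modR word.word_mult_slot_linear(2)[OF word.tau_linear xs ys rho_closed[OF p(2)]]
          linear_scale[OF modR word.head_word_slot_linear[OF word.tau_linear xs ys] p(3)]]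
      by (simp add: p(1))
  qed
  note u = lift_omega[OF modA modR cl zero hat_gen_head_linear slot, folded hat_def]
  show "hat \<in> linear_maps K (omega_module K A) R" by (rule u(1))
  show "(p, as) \<in> omega_gens K A \<Longrightarrow> hat (omega_gen K A p as) = hat_gen (p, as)" by (rule u(2))
qed

lemma hat_gen_append:
  assumes p: "p \<in> carrier (unitization K A)" and as: "as \<in> lists (carrier A)" "as \<noteq> []"
    and bs: "bs \<in> lists (carrier A)"
  shows "hat_gen (p, as @ bs) = word.word_mult (hat_gen (p, as)) bs"
proof -
  obtain a \<mu> where p: "p = (a, \<mu>)" "a \<in> carrier A" "\<mu> \<in> carrier K"
    using p by (auto simp: unitization_simps)
  note w = word.word_mult_linear[OF bs]
  have "dword (as @ bs) = word.word_mult (dword as) bs"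
    using as(2) by (simp add: word.head_word_def hd_append)
  then show ?thesis
    using p as word.word_mult_closed[OF rho_closed[OF p(2)] as(1)]
      word.head_word_closed[OF word.tau_linear as]
    by (simp add: linear_add[OF w] linear_smult[OF w])
qed

section \<open>Compatibility with the differential and the grading\<close>

lemma word_mult_grade:
  "\<lbrakk>r \<in> grade R n; as \<in> lists (carrier A)\<rbrakk> \<Longrightarrow> word.word_mult r as \<in> grade R (n + length as)"
proof (induct as arbitrary: r n)
  case (Cons a as)
  then have "d\<rho> a \<in> grade R 1" using diff_grade[OF rho_grade] by simp
  from grade_mult[OF Cons.prems(1) this]
  have "word.word_mult (r \<otimes>\<^bsub>R\<^esub> d\<rho> a) as \<in> grade R (n + 1 + length as)"
    using Cons by (intro Cons.hyps) auto
  then show ?case by simp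
qed simp

lemma grade_carrier: "x \<in> grade R n \<Longrightarrow> x \<in> carrier R"
proof -
  show "x \<in> grade R n \<Longrightarrow> x \<in> carrier R" using R_submoduleE(1)[OF grade_submodule] by blast
qed

text \<open>The factors \<open>D\<rho>(a)\<close> are killed by \<open>D\<close>, so only the first summand of the Leibniz rule survives, and
  with it no sign.\<close>

lemma diff_word_mult:
  "\<lbrakk>r \<in> grade R n; as \<in> lists (carrier A)\<rbrakk>
    \<Longrightarrow> diff R (word.word_mult r as) = word.word_mult (diff R r) as"
proof (induct as arbitrary: r n)
  case (Cons a as)
  from Cons.prems have a: "a \<in> carrier A" and as: "as \<in> lists (carrier A)" by auto
  have da: "d\<rho> a \<in> grade R 1" using a diff_grade[OF rho_grade] by simp
  note c = grade_carrier[OF Cons.prems(1)] grade_carrier[OF da]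
  have "diff R (word.word_mult (r \<otimes>\<^bsub>R\<^esub> d\<rho> a) as) = word.word_mult (diff R (r \<otimes>\<^bsub>R\<^esub> d\<rho> a)) as"
    by (rule Cons.hyps[OF grade_mult[OF Cons.prems(1) da] as])
  also have "diff R (r \<otimes>\<^bsub>R\<^esub> d\<rho> a) = diff R r \<otimes>\<^bsub>R\<^esub> d\<rho> a"
  proof -
    have "r \<otimes>\<^bsub>R\<^esub> \<zero>\<^bsub>R\<^esub> = \<zero>\<^bsub>R\<^esub>"
      by (rule linear_zero[OF modR modR bilinear_right[OF R_mult_bilinear c(1)]])
    then show ?thesis
      using c diff_closed
      by (simp add: diff_mult[OF Cons.prems(1)] diff_diff[OF rho_closed[OF a]] R_mult_closed)
  qed
  finally show ?case by simp
qed simp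

lemma hat_grade: "hat ` grade (Omega K A) n \<subseteq> grade R n"
proof -
  interpret W: module K "omega_module K A" by (rule omega_module_module[OF modA])
  let ?G = "{omega_gen K A p as | p as. (p, as) \<in> omega_gens K A \<and> length as = n}"
  note sub = submodule_vimage[OF W.module_axioms modR hat_linear grade_submodule[of n]]
  have "hat (omega_gen K A p as) \<in> grade R n" if g: "(p, as) \<in> omega_gens K A" and n: "length as = n" for p as
  proof -
    obtain a \<mu> where p: "p = (a, \<mu>)" "a \<in> carrier A" "\<mu> \<in> carrier K"
      using omega_gensD(1)[OF g] by (auto simp: unitization_simps)
    note as = omega_gensD(2)[OF g]
    note E = R_submoduleE[OF grade_submodule]
    have w: "word.word_mult (\<rho> a) as \<in> grade R n"
      using word_mult_grade[OF rho_grade[OF p(2)] as] n by simp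
    show ?thesis
    proof (cases as)
      case Nil
      then show ?thesis
        unfolding hat_omega_gen[OF g] using w grade_carrier[OF w] by (simp add: p(1))
    next
      case (Cons b bs)
      then have b: "b \<in> carrier A" and bs: "bs \<in> lists (carrier A)" using as by auto
      have "dword as \<in> grade R n"
        using word_mult_grade[OF diff_grade[OF rho_grade[OF b]] bs] n Cons
        by (simp add: word.head_word_def)
      then show ?thesis
        unfolding hat_omega_gen[OF g] using Cons w by (simp add: p(1) E(4)[OF p(3)] E(5))
    qed
  qed
  then have "?G \<subseteq> {x \<in> carrier (omega_module K A). hat x \<in> grade R n}"
    using omega_gen_closed[OF modA] by auto
  from mspan_least[OF sub this] show ?thesis by (auto simp: Omega_def Let_def)
qed

text \<open>On \<open>(a + \<mu>) da\<^sub>1 \<dots> da\<^sub>n\<close> both sides are \<open>D\<rho>(a) D\<rho>(a\<^sub>1) \<dots> D\<rho>(a\<^sub>n)\<close>. The summand with \<open>\<mu>\<close> is a product of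
  elements killed by \<open>D\<close>.\<close>

lemma hat_diff:
  assumes X: "X \<in> carrier (omega_module K A)"
  shows "hat (diff (Omega K A) X) = diff R (hat X)"
proof -
  note W = omega_module_module[OF modA]
  let ?f = "\<lambda>((a, \<mu>), as). omega_gen K A (\<zero>\<^bsub>A\<^esub>, \<one>) (a # as)"
  have gens: "((\<zero>\<^bsub>A\<^esub>, \<one>), a # as) \<in> omega_gens K A" if "((a, \<mu>), as) \<in> omega_gens K A" for a \<mu> as
    using omega_gensD[OF that] by (intro omega_gensI) (auto simp: unitization_simps)
  have "hat (lift K (omega_module K A) ?f X) = diff R (hat X)"
  proof (rule lift_omega_compare[OF modA W modR _ hat_linear linear_comp[OF hat_linear diff_linear] _ X])
    fix p as assume g: "(p, as) \<in> omega_gens K A"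
    obtain a \<mu> where p: "p = (a, \<mu>)" "a \<in> carrier A" "\<mu> \<in> carrier K"
      using omega_gensD(1)[OF g] by (auto simp: unitization_simps)
    note as = omega_gensD(2)[OF g]
    note g' = gens[OF g[unfolded p(1)]]
    show "?f (p, as) \<in> carrier (omega_module K A)"
      using omega_gen_closed[OF modA g'] by (simp add: p(1))
    have w: "word.word_mult (d\<rho> a) as \<in> carrier R"
      by (rule word.word_mult_closed[OF word.tau_closed[OF p(2)] as])
    have w0: "word.word_mult \<zero>\<^bsub>R\<^esub> bs = \<zero>\<^bsub>R\<^esub>" if "bs \<in> lists (carrier A)" for bs
      by (rule linear_zero[OF modR modR word.word_mult_linear[OF that]])
    have "\<rho> \<zero>\<^bsub>A\<^esub> = \<zero>\<^bsub>R\<^esub>" by (rule linear_zero[OF modA modR rho_linear])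
    then have "hat (?f (p, as)) = word.word_mult \<zero>\<^bsub>R\<^esub> (a # as) \<oplus>\<^bsub>R\<^esub> word.word_mult (d\<rho> a) as"
      using w by (simp add: p(1) hat_omega_gen[OF g'] word.head_word_def)
    also have "\<dots> = word.word_mult (d\<rho> a) as"
      using w w0[of "a # as"] p(2) as by simp
    also have "\<dots> = diff R (word.word_mult (\<rho> a) as)"
      by (rule diff_word_mult[OF rho_grade[OF p(2)] as, symmetric])
    also have "\<dots> = diff R (hat_gen (p, as))"
    proof (cases as)
      case Nil
      then show ?thesis using rho_closed[OF p(2)] by (simp add: p(1))
    next
      case (Cons b bs)
      then have b: "b \<in> carrier A" and bs: "bs \<in> lists (carrier A)" using as by auto
      have d: "dword as \<in> carrier R"
        by (rule word.head_word_closed[OF word.tau_linear as]) (simp add: Cons)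
      have "diff R (dword as) = word.word_mult (diff R (d\<rho> b)) bs"
        unfolding Cons word.head_word_def list.sel
        by (rule diff_word_mult[OF diff_grade[OF rho_grade[OF b]] bs])
      also have "\<dots> = \<zero>\<^bsub>R\<^esub>" by (simp add: diff_diff[OF rho_closed[OF b]] w0[OF bs])
      finally have dd: "diff R (dword as) = \<zero>\<^bsub>R\<^esub>" .
      have wc: "word.word_mult (\<rho> a) as \<in> carrier R" by (rule word.word_mult_closed[OF rho_closed[OF p(2)] as])
      have "diff R (hat_gen (p, as)) = diff R (word.word_mult (\<rho> a) as \<oplus>\<^bsub>R\<^esub> \<mu> \<odot>\<^bsub>R\<^esub> dword as)"
        using Cons by (simp add: p(1))
      also have "\<dots> = diff R (word.word_mult (\<rho> a) as) \<oplus>\<^bsub>R\<^esub> \<mu> \<odot>\<^bsub>R\<^esub> diff R (dword as)"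
        using wc d p(3) by (simp add: linear_add[OF diff_linear] linear_smult[OF diff_linear])
      also have "\<dots> = diff R (word.word_mult (\<rho> a) as)"
        using dd p(3) diff_closed[OF wc] by simp
      finally show ?thesis by simp
    qed
    finally show "hat (?f (p, as)) = diff R (hat (omega_gen K A p as))"
      by (simp add: hat_omega_gen[OF g])
  qed
  then show ?thesis by (simp add: Omega_def Let_def)
qed

section \<open>Multiplicativity\<close>

definition sign :: "nat \<Rightarrow> 'k" where "sign n = (\<ominus> \<one>) [^] n"

lemma sign_closed [simp]: "sign n \<in> carrier K" by (simp add: sign_def)

lemma sign_Suc: "sign (Suc n) = \<ominus> \<one> \<otimes> sign n" by (simp add: sign_def m_comm)

text \<open>The Leibniz rule for \<open>\<rho>(x) \<rho>(q)\<close>, a product of elements of degree \<open>0\<close>, solved for the term in which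
  \<open>\<rho>(q)\<close> stands on the right of a differential.\<close>

lemma drho_mult:
  assumes x: "x \<in> carrier A" and q: "q \<in> carrier A"
  shows "d\<rho> x \<otimes>\<^bsub>R\<^esub> \<rho> q = d\<rho> (x \<otimes>\<^bsub>A\<^esub> q) \<oplus>\<^bsub>R\<^esub> (\<ominus> \<one>) \<odot>\<^bsub>R\<^esub> (\<rho> x \<otimes>\<^bsub>R\<^esub> d\<rho> q)"
proof -
  let ?u = "d\<rho> x \<otimes>\<^bsub>R\<^esub> \<rho> q" and ?v = "\<rho> x \<otimes>\<^bsub>R\<^esub> d\<rho> q"
  have uv: "?u \<in> carrier R" "?v \<in> carrier R"
    using x q by (simp_all add: R_mult_closed rho_closed drho_closed)
  have "d\<rho> (x \<otimes>\<^bsub>A\<^esub> q) = ?u \<oplus>\<^bsub>R\<^esub> ?v"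
    using uv by (simp add: rho_mult[OF x q] diff_mult[OF rho_grade[OF x] rho_closed[OF q]])
  then have "d\<rho> (x \<otimes>\<^bsub>A\<^esub> q) \<oplus>\<^bsub>R\<^esub> (\<ominus> \<one>) \<odot>\<^bsub>R\<^esub> ?v = ?u \<oplus>\<^bsub>R\<^esub> (?v \<oplus>\<^bsub>R\<^esub> (\<ominus> \<one>) \<odot>\<^bsub>R\<^esub> ?v)"
    using uv by (simp add: R_a_ac R_smult_closed)
  also have "?v \<oplus>\<^bsub>R\<^esub> (\<ominus> \<one>) \<odot>\<^bsub>R\<^esub> ?v = \<zero>\<^bsub>R\<^esub>"
    using uv by (simp add: module.smult_l_minus[OF modR] abelian_group.r_neg[OF abgroupR])
  finally show ?thesis using uv by simp
qed

text \<open>With \<open>act z = \<rho>(a) z + \<mu> z\<close>, left multiplication by the coefficient \<open>a + \<mu>\<close>, this is \<open>drho_mult\<close>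
  multiplied by the coefficient: \<open>act\<close> commutes with right multiplication, and \<open>act(\<rho>(x))\<close> is the
  image of \<open>(a + \<mu>)x\<close>.\<close>

lemma hat_gen_mult_rho_singleton:
  assumes p: "p \<in> carrier (unitization K A)" and x: "x \<in> carrier A" and q: "q \<in> carrier A"
  shows "hat_gen (p, [x]) \<otimes>\<^bsub>R\<^esub> \<rho> q = hat_gen (p, [x \<otimes>\<^bsub>A\<^esub> q])
    \<oplus>\<^bsub>R\<^esub> (\<ominus> \<one>) \<odot>\<^bsub>R\<^esub> hat_gen (p \<otimes>\<^bsub>unitization K A\<^esub> (x, \<zero>), [q])"
proof -
  obtain a \<mu> where p: "p = (a, \<mu>)" and a: "a \<in> carrier A" and mu: "\<mu> \<in> carrier K"
    using p by (auto simp: unitization_simps)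
  let ?u = "d\<rho> (x \<otimes>\<^bsub>A\<^esub> q)" and ?v = "\<rho> x \<otimes>\<^bsub>R\<^esub> d\<rho> q"
  define act where "act z = \<rho> a \<otimes>\<^bsub>R\<^esub> z \<oplus>\<^bsub>R\<^esub> \<mu> \<odot>\<^bsub>R\<^esub> z" for z
  have act: "act \<in> linear_maps K R R"
    unfolding act_def
    by (rule linear_sum[OF modR bilinear_right[OF R_mult_bilinear rho_closed[OF a]]])
      (use linear_scale[OF modR linear_id mu] in simp)
  have act_mult: "act z \<otimes>\<^bsub>R\<^esub> w = act (z \<otimes>\<^bsub>R\<^esub> w)" if "z \<in> carrier R" "w \<in> carrier R" for z w
    using that mu rho_closed[OF a]
    by (simp add: act_def R_distr_l R_mult_closed R_smult_closed R_mult_assoc R_smult_mult_l)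
  have xq: "x \<otimes>\<^bsub>A\<^esub> q \<in> carrier A" by (rule A_mult_closed[OF x q])
  have c: "?u \<in> carrier R" "?v \<in> carrier R" "\<rho> x \<in> carrier R" "d\<rho> q \<in> carrier R" "d\<rho> x \<in> carrier R"
    "\<rho> q \<in> carrier R"
    using x q xq by (simp_all add: R_mult_closed rho_closed drho_closed)
  have "\<rho> (a \<otimes>\<^bsub>A\<^esub> x \<oplus>\<^bsub>A\<^esub> \<mu> \<odot>\<^bsub>A\<^esub> x \<oplus>\<^bsub>A\<^esub> \<zero> \<odot>\<^bsub>A\<^esub> a) = act (\<rho> x)"
    using a mu x A_mult_closed[OF a x] c
    by (simp add: act_def linear_add[OF rho_linear] linear_smult[OF rho_linear] rho_mult
        module.smult_l_null[OF modA] module.smult_closed[OF modA])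
  then have "hat_gen (p \<otimes>\<^bsub>unitization K A\<^esub> (x, \<zero>), [q]) = act (\<rho> x) \<otimes>\<^bsub>R\<^esub> d\<rho> q"
    using mu c linear_closed[OF act]
    by (simp add: p unitization_simps word.head_word_def R_mult_closed module.smult_l_null[OF modR])
  then have "hat_gen (p \<otimes>\<^bsub>unitization K A\<^esub> (x, \<zero>), [q]) = act ?v"
    using act_mult c by simp
  moreover have "hat_gen (p, [y]) = act (d\<rho> y)" for y
    by (simp add: p act_def word.head_word_def)
  moreover have "act (d\<rho> x) \<otimes>\<^bsub>R\<^esub> \<rho> q = act ?u \<oplus>\<^bsub>R\<^esub> (\<ominus> \<one>) \<odot>\<^bsub>R\<^esub> act ?v"
    using c by (simp add: act_mult drho_mult[OF x q] linear_add[OF act] linear_smult[OF act] R_smult_closed)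
  ultimately show ?thesis by simp
qed

lemma unitization_mult_closed:
  assumes "p \<in> carrier (unitization K A)" "x \<in> carrier A"
  shows "p \<otimes>\<^bsub>unitization K A\<^esub> (x, \<zero>) \<in> carrier (unitization K A)"
proof -
  obtain a \<mu> where "p = (a, \<mu>)" "a \<in> carrier A" "\<mu> \<in> carrier K"
    using assms(1) by (auto simp: unitization_simps)
  then show ?thesis using assms(2)
    by (simp add: unitization_simps A_mult_closed module.smult_closed[OF modA]
        abelian_monoid.a_closed[OF addA])
qed

text \<open>The element \<open>\<rho>(q)\<close> moves leftwards through the differentials. If the last one is \<open>dx\<close>, then
  \<open>drho_mult\<close> yields the term that ends in \<open>d(xq)\<close>, minus the product of \<open>dq\<close> with the same expression
  for the shorter word and \<open>x\<close> in place of \<open>q\<close>. That expression is known by induction, and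
  multiplication by \<open>-dq\<close> turns its terms into the remaining ones: its leading term becomes the summand
  of highest index, the others keep their index, and every sign changes.\<close>

lemma hat_gen_mult_rho:
  assumes p: "p \<in> carrier (unitization K A)"
  shows "\<lbrakk>ps \<noteq> []; ps \<in> lists (carrier A); q \<in> carrier A\<rbrakk> \<Longrightarrow>
    hat_gen (p, ps) \<otimes>\<^bsub>R\<^esub> \<rho> q = hat_gen (p, butlast ps @ [last ps \<otimes>\<^bsub>A\<^esub> q])
    \<oplus>\<^bsub>R\<^esub> (\<Oplus>\<^bsub>R\<^esub>l\<in>{1..<length ps}. sign (length ps - l) \<odot>\<^bsub>R\<^esub>
        hat_gen (p, take (l - 1) ps @ (ps ! (l - 1) \<otimes>\<^bsub>A\<^esub> ps ! l) # drop (l + 1) ps @ [q]))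
    \<oplus>\<^bsub>R\<^esub> sign (length ps) \<odot>\<^bsub>R\<^esub> hat_gen (p \<otimes>\<^bsub>unitization K A\<^esub> (hd ps, \<zero>), tl ps @ [q])"
proof (induct ps arbitrary: q rule: rev_nonempty_induct)
  case (single x)
  then have x: "x \<in> carrier A" and q: "q \<in> carrier A" by auto
  have "hat_gen (p, [x \<otimes>\<^bsub>A\<^esub> q]) \<in> carrier R"
    by (rule hat_gen_closed[OF p]) (use A_mult_closed[OF x q] in simp)
  then show ?case
    using hat_gen_mult_rho_singleton[OF p x q]
    by (simp add: sign_def abelian_monoid.finsum_empty[OF addR] abelian_monoid.r_zero[OF addR])
next
  case (snoc x ps)
  then have x: "x \<in> carrier A" and ps: "ps \<in> lists (carrier A)" and q: "q \<in> carrier A"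
    by auto
  have qs: "[q] \<in> lists (carrier A)" and xs: "[x] \<in> lists (carrier A)" using q x by auto
  let ?i = "length ps" and ?p' = "p \<otimes>\<^bsub>unitization K A\<^esub> (hd ps, \<zero>)"
  have i: "?i \<ge> 1" using snoc(1) by (cases ps) auto
  have hd: "hd ps \<in> carrier A" and last: "last ps \<in> carrier A"
    and tl: "tl ps \<in> lists (carrier A)" and butlast: "butlast ps \<in> lists (carrier A)"
    using snoc(1) ps by (auto simp: in_lists_conv_set dest: list.set_sel in_set_butlastD)
  have nth: "ps ! l \<in> carrier A" if "l < ?i" for l using ps that by (auto simp: in_lists_conv_set)
  have p': "?p' \<in> carrier (unitization K A)" by (rule unitization_mult_closed[OF p hd])
  \<comment> \<open>right multiplication by \<open>-D\<rho>(q)\<close>, which carries the formula for \<open>ps\<close> and \<open>x\<close> to that for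
    \<open>ps @ [x]\<close> and \<open>q\<close>\<close>
  define g where "g t = (\<ominus> \<one>) \<odot>\<^bsub>R\<^esub> (t \<otimes>\<^bsub>R\<^esub> d\<rho> q)" for t
  have g: "g \<in> linear_maps K R R"
    unfolding g_def
    by (rule linear_scale[OF modR bilinear_left[OF R_mult_bilinear drho_closed[OF q]]]) simp
  have g_hat: "g (hat_gen (p1, w)) = sign 1 \<odot>\<^bsub>R\<^esub> hat_gen (p1, w @ [q])"
    if "p1 \<in> carrier (unitization K A)" "w \<in> lists (carrier A)" "w \<noteq> []" for p1 w
    unfolding g_def hat_gen_append[OF that qs] by (simp add: sign_def)
  have g_sign: "g (sign k \<odot>\<^bsub>R\<^esub> hat_gen (p1, w)) = sign (Suc k) \<odot>\<^bsub>R\<^esub> hat_gen (p1, w @ [q])"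
    if p1: "p1 \<in> carrier (unitization K A)" and w: "w \<in> lists (carrier A)" "w \<noteq> []" for k p1 w
  proof -
    have "sign 1 = \<ominus> \<one>" by (simp add: sign_def)
    moreover have "hat_gen (p1, w @ [q]) \<in> carrier R" by (rule hat_gen_closed[OF p1]) (use w q in simp)
    ultimately show ?thesis
      using hat_gen_closed[OF p1 w(1)]
      by (simp add: linear_smult[OF g] g_hat[OF p1 w] sign_Suc m_comm R_smult_assoc1[symmetric])
  qed
  define V where "V = hat_gen (p, ps)"
  have V: "V \<in> carrier R" unfolding V_def by (rule hat_gen_closed[OF p ps])
  define Y where "Y = hat_gen (p, butlast ps @ [last ps \<otimes>\<^bsub>A\<^esub> x])"
  define w where "w l = take (l - 1) ps @ (ps ! (l - 1) \<otimes>\<^bsub>A\<^esub> ps ! l) # drop (l + 1) ps @ [x]" for l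
  define Z where "Z = hat_gen (?p', tl ps @ [x])"
  have w: "w l \<in> lists (carrier A)" "w l \<noteq> []" if "l \<in> {1..<?i}" for l
    using that ps x nth[of l] nth[of "l - 1"]
    by (auto simp: w_def A_mult_closed in_lists_conv_set dest: in_set_takeD in_set_dropD)
  have Yw: "butlast ps @ [last ps \<otimes>\<^bsub>A\<^esub> x] \<in> lists (carrier A)"
    using butlast A_mult_closed[OF last x] by simp
  have Zw: "tl ps @ [x] \<in> lists (carrier A)" using tl x by simp
  have Y: "Y \<in> carrier R" unfolding Y_def by (rule hat_gen_closed[OF p Yw])
  have Z: "Z \<in> carrier R" unfolding Z_def by (rule hat_gen_closed[OF p' Zw])
  have wc: "(\<lambda>l. sign (?i - l) \<odot>\<^bsub>R\<^esub> hat_gen (p, w l)) \<in> {1..<?i} \<rightarrow> carrier R"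
    using hat_gen_closed[OF p w(1)] by (simp add: R_smult_closed)
  let ?S = "\<Oplus>\<^bsub>R\<^esub>l\<in>{1..<?i}. sign (?i - l) \<odot>\<^bsub>R\<^esub> hat_gen (p, w l)"
  have S: "?S \<in> carrier R" by (rule abelian_monoid.finsum_closed[OF addR wc])
  have IH: "V \<otimes>\<^bsub>R\<^esub> \<rho> x = Y \<oplus>\<^bsub>R\<^esub> ?S \<oplus>\<^bsub>R\<^esub> sign ?i \<odot>\<^bsub>R\<^esub> Z"
    unfolding V_def Y_def Z_def w_def by (rule snoc(2)[OF ps x])
  let ?w' = "\<lambda>l. take (l - 1) (ps @ [x]) @ ((ps @ [x]) ! (l - 1) \<otimes>\<^bsub>A\<^esub> (ps @ [x]) ! l)
      # drop (l + 1) (ps @ [x]) @ [q]"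
  let ?F = "\<lambda>l. sign (Suc ?i - l) \<odot>\<^bsub>R\<^esub> hat_gen (p, ?w' l)"
  have w': "?w' l = w l @ [q]" if "l \<in> {1..<?i}" for l
    using that by (auto simp: w_def nth_append)
  have w'_last: "?w' ?i = butlast ps @ [last ps \<otimes>\<^bsub>A\<^esub> x] @ [q]"
    using snoc(1) by (simp add: nth_append last_conv_nth butlast_conv_take)
  have Fc: "?F \<in> {1..<?i} \<rightarrow> carrier R"
  proof
    fix l assume l: "l \<in> {1..<?i}"
    show "?F l \<in> carrier R"
      unfolding w'[OF l]
      by (rule R_smult_closed[OF sign_closed hat_gen_closed[OF p]]) (use w(1)[OF l] q in simp)
  qed
  have gS: "g ?S = (\<Oplus>\<^bsub>R\<^esub>l\<in>{1..<?i}. ?F l)"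
  proof -
    have "g ?S = (\<Oplus>\<^bsub>R\<^esub>l\<in>{1..<?i}. g (sign (?i - l) \<odot>\<^bsub>R\<^esub> hat_gen (p, w l)))"
      by (rule linear_finsum[OF modR modR g _ wc]) simp
    also have "\<dots> = (\<Oplus>\<^bsub>R\<^esub>l\<in>{1..<?i}. ?F l)"
    proof (rule abelian_monoid.finsum_cong'[OF addR refl])
      show "g (sign (?i - l) \<odot>\<^bsub>R\<^esub> hat_gen (p, w l)) = ?F l" if l: "l \<in> {1..<?i}" for l
        unfolding w'[OF l] g_sign[OF p w[OF l]] using l by (simp add: Suc_diff_le)
    qed (rule Fc)
    finally show ?thesis .
  qed
  \<comment> \<open>the leading term for \<open>ps\<close> becomes the summand of index \<open>length ps\<close> for \<open>ps @ [x]\<close>\<close>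
  have gY: "g Y = ?F ?i" unfolding Y_def w'_last using g_hat[OF p Yw] by simp
  have gZ: "g (sign ?i \<odot>\<^bsub>R\<^esub> Z) = sign (Suc ?i) \<odot>\<^bsub>R\<^esub> hat_gen (?p', tl ps @ [x] @ [q])"
    unfolding Z_def using g_sign[OF p' Zw] by simp
  have Fin: "(\<Oplus>\<^bsub>R\<^esub>l\<in>{1..<Suc ?i}. ?F l) = g Y \<oplus>\<^bsub>R\<^esub> g ?S"
  proof -
    have ins: "{1..<Suc ?i} = insert ?i {1..<?i}" using i by auto
    show ?thesis unfolding ins gS gY
      by (rule abelian_monoid.finsum_insert[OF addR _ _ Fc])
        (use gY linear_closed[OF g Y] in simp_all)
  qed
  have "hat_gen (p, ps @ [x]) \<otimes>\<^bsub>R\<^esub> \<rho> q = V \<otimes>\<^bsub>R\<^esub> (d\<rho> x \<otimes>\<^bsub>R\<^esub> \<rho> q)"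
    unfolding hat_gen_append[OF p ps snoc(1) xs]
    using V by (simp add: V_def R_mult_assoc drho_closed[OF x] rho_closed[OF q])
  also have "\<dots> = V \<otimes>\<^bsub>R\<^esub> d\<rho> (x \<otimes>\<^bsub>A\<^esub> q) \<oplus>\<^bsub>R\<^esub> g (V \<otimes>\<^bsub>R\<^esub> \<rho> x)"
    using V x q A_mult_closed[OF x q]
    by (simp add: drho_mult g_def R_distr_r R_smult_mult_r R_mult_assoc R_mult_closed R_smult_closed
        drho_closed rho_closed)
  also have "V \<otimes>\<^bsub>R\<^esub> d\<rho> (x \<otimes>\<^bsub>A\<^esub> q) = hat_gen (p, ps @ [x \<otimes>\<^bsub>A\<^esub> q])"
    using hat_gen_append[OF p ps snoc(1), of "[x \<otimes>\<^bsub>A\<^esub> q]"] A_mult_closed[OF x q]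
    by (simp add: V_def)
  also have "g (V \<otimes>\<^bsub>R\<^esub> \<rho> x) = g Y \<oplus>\<^bsub>R\<^esub> g ?S \<oplus>\<^bsub>R\<^esub> g (sign ?i \<odot>\<^bsub>R\<^esub> Z)"
    unfolding IH using Y S Z
    by (simp only: linear_add[OF g] R_a_closed R_smult_closed sign_closed)
  also have "\<dots> = (\<Oplus>\<^bsub>R\<^esub>l\<in>{1..<Suc ?i}. ?F l) \<oplus>\<^bsub>R\<^esub>
      sign (Suc ?i) \<odot>\<^bsub>R\<^esub> hat_gen (?p', tl ps @ [x] @ [q])"
    unfolding Fin gZ ..
  finally have eq: "hat_gen (p, ps @ [x]) \<otimes>\<^bsub>R\<^esub> \<rho> q = hat_gen (p, ps @ [x \<otimes>\<^bsub>A\<^esub> q]) \<oplus>\<^bsub>R\<^esub>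
      ((\<Oplus>\<^bsub>R\<^esub>l\<in>{1..<Suc ?i}. ?F l) \<oplus>\<^bsub>R\<^esub> sign (Suc ?i) \<odot>\<^bsub>R\<^esub> hat_gen (?p', tl ps @ [x] @ [q]))" .
  have X0: "hat_gen (p, ps @ [x \<otimes>\<^bsub>A\<^esub> q]) \<in> carrier R"
    by (rule hat_gen_closed[OF p]) (use ps A_mult_closed[OF x q] in simp)
  have Fc': "(\<Oplus>\<^bsub>R\<^esub>l\<in>{1..<Suc ?i}. ?F l) \<in> carrier R"
    unfolding Fin by (intro R_a_closed linear_closed[OF g] Y S)
  have Zc: "sign (Suc ?i) \<odot>\<^bsub>R\<^esub> hat_gen (?p', tl ps @ [x] @ [q]) \<in> carrier R"
    unfolding gZ[symmetric] by (intro linear_closed[OF g] R_smult_closed sign_closed Z)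
  show ?case
    using eq[unfolded abelian_monoid.a_assoc[OF addR X0 Fc' Zc, symmetric]] snoc(1)
    by (simp only: length_append_singleton hd_append2 tl_append2 butlast_snoc last_snoc append_assoc
        simp_thms)
qed

text \<open>A second factor \<open>(q\<^sub>0 + \<nu>) dq\<^sub>1 \<dots> dq\<^sub>j\<close> acts through \<open>q\<^sub>0\<close> and \<open>\<nu>\<close> first, after which its differentials
  are appended as a word.\<close>

lemma hat_gen_mult_word:
  assumes x: "x \<in> carrier R" and q0: "q0 \<in> carrier A" and nu: "\<nu> \<in> carrier K"
    and qs: "qs \<in> lists (carrier A)" and deg0: "qs = [] \<Longrightarrow> \<nu> = \<zero>"
  shows "x \<otimes>\<^bsub>R\<^esub> hat_gen ((q0, \<nu>), qs)
    = word.word_mult (x \<otimes>\<^bsub>R\<^esub> \<rho> q0) qs \<oplus>\<^bsub>R\<^esub> \<nu> \<odot>\<^bsub>R\<^esub> word.word_mult x qs"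
proof -
  have head: "word.word_mult (x \<otimes>\<^bsub>R\<^esub> \<rho> q0) qs = x \<otimes>\<^bsub>R\<^esub> word.word_mult (\<rho> q0) qs"
    by (rule word.mult_word_mult[OF x rho_closed[OF q0] qs])
  note c = word.word_mult_closed[OF rho_closed[OF q0] qs] R_mult_closed
  show ?thesis
  proof (cases qs)
    case Nil
    then show ?thesis using deg0 c x q0
      by (simp add: rho_closed module.smult_l_null[OF modR] abelian_monoid.r_zero[OF addR])
  next
    case (Cons b bs)
    then have b: "b \<in> carrier A" and bs: "bs \<in> lists (carrier A)" using qs by auto
    have "word.word_mult x qs = x \<otimes>\<^bsub>R\<^esub> dword qs"
      using word.mult_word_mult[OF x drho_closed[OF b] bs] by (simp add: Cons word.head_word_def)
    moreover have "dword qs \<in> carrier R"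
      by (rule word.head_word_closed[OF word.tau_linear qs]) (simp add: Cons)
    ultimately show ?thesis
      unfolding head using Cons x nu c
      by (simp only: hat_gen.simps list.distinct if_False R_distr_r R_smult_mult_r R_smult_closed)
  qed
qed

lemma omega_gen_mult_nonempty:
  assumes "ps \<noteq> []"
  shows "omega_gen_mult K A (p, ps) ((q0, \<nu>), qs) =
    omega_gen K A p (butlast ps @ (last ps \<otimes>\<^bsub>A\<^esub> q0) # qs)
    \<oplus>\<^bsub>omega_module K A\<^esub> (\<Oplus>\<^bsub>omega_module K A\<^esub>l\<in>{1..<length ps}. sign (length ps - l) \<odot>\<^bsub>omega_module K A\<^esub>
      omega_gen K A p (take (l - 1) ps @ (ps ! (l - 1) \<otimes>\<^bsub>A\<^esub> ps ! l) # drop (l + 1) ps @ q0 # qs))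
    \<oplus>\<^bsub>omega_module K A\<^esub> sign (length ps) \<odot>\<^bsub>omega_module K A\<^esub>
      omega_gen K A (p \<otimes>\<^bsub>unitization K A\<^esub> (hd ps, \<zero>)) (tl ps @ q0 # qs)
    \<oplus>\<^bsub>omega_module K A\<^esub> \<nu> \<odot>\<^bsub>omega_module K A\<^esub> omega_gen K A p (ps @ qs)"
  using assms by (simp add: Let_def sign_def)

text \<open>By \<open>hat_gen_append\<close>, appending \<open>dq\<^sub>1 \<dots> dq\<^sub>j\<close> to each term of \<open>hat_gen_mult_rho\<close> gives the images of
  all summands of the product formula except the last one, which is the contribution of \<open>\<nu>\<close>.\<close>

lemma hat_omega_gen_mult:
  assumes g: "(p, ps) \<in> omega_gens K A" and h: "(q, qs) \<in> omega_gens K A"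
  shows "omega_gen_mult K A (p, ps) (q, qs) \<in> carrier (omega_module K A)"
    and "hat (omega_gen_mult K A (p, ps) (q, qs)) = hat_gen (p, ps) \<otimes>\<^bsub>R\<^esub> hat_gen (q, qs)"
proof -
  let ?W = "omega_module K A" and ?U = "unitization K A"
  interpret W: module K ?W by (rule omega_module_module[OF modA])
  note pU = omega_gensD(1)[OF g] and ps = omega_gensD(2)[OF g] and p0 = omega_gensD(3)[OF g]
  note qs = omega_gensD(2)[OF h]
  obtain q0 \<nu> where q: "q = (q0, \<nu>)" and q0: "q0 \<in> carrier A" and nu: "\<nu> \<in> carrier K"
    using omega_gensD(1)[OF h] by (auto simp: unitization_simps)
  have deg0: "qs = [] \<Longrightarrow> \<nu> = \<zero>" using omega_gensD(3)[OF h] by (simp add: q)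
  note val = hat_gen_mult_word[OF hat_gen_closed[OF pU ps] q0 nu qs deg0]
  have "omega_gen_mult K A (p, ps) (q, qs) \<in> carrier ?W \<and>
    hat (omega_gen_mult K A (p, ps) (q, qs)) = hat_gen (p, ps) \<otimes>\<^bsub>R\<^esub> hat_gen (q, qs)"
  proof (cases "ps = []")
    case True
    obtain a where p: "p = (a, \<zero>)" and a: "a \<in> carrier A"
      using pU p0[OF True] by (cases p) (auto simp: unitization_simps)
    \<comment> \<open>a first factor \<open>a\<close> of degree \<open>0\<close> multiplies the coefficient \<open>q\<^sub>0 + \<nu>\<close> to \<open>aq\<^sub>0 + \<nu>a\<close>\<close>
    let ?b = "a \<otimes>\<^bsub>A\<^esub> q0 \<oplus>\<^bsub>A\<^esub> \<nu> \<odot>\<^bsub>A\<^esub> a"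
    note aq = A_mult_closed[OF a q0] and na = module.smult_closed[OF modA nu a]
    note bc = abelian_monoid.a_closed[OF addA aq na]
    have prod: "omega_gen_mult K A (p, ps) (q, qs) = omega_gen K A (?b, \<zero>) qs"
      using nu q0 aq module.smult_l_null[OF modA q0]
      by (simp add: True q p Let_def unitization_simps
          abelian_monoid.r_zero[OF addA])
    have bg: "((?b, \<zero>), qs) \<in> omega_gens K A"
      by (rule omega_gensI) (simp_all add: unitization_simps bc qs)
    note w = word.word_mult_slot_linear(1)[OF rho_linear qs qs]
    have d: "\<zero> \<odot>\<^bsub>R\<^esub> dword qs = \<zero>\<^bsub>R\<^esub>" if "qs \<noteq> []"
      by (rule module.smult_l_null[OF modR word.head_word_closed[OF word.tau_linear qs that]])
    have "hat_gen ((?b, \<zero>), qs) = word.word_mult (\<rho> ?b) qs"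
      using d linear_closed[OF w bc] by (simp add: abelian_monoid.r_zero[OF addR])
    also have "\<dots> = word.word_mult (\<rho> a \<otimes>\<^bsub>R\<^esub> \<rho> q0) qs \<oplus>\<^bsub>R\<^esub> \<nu> \<odot>\<^bsub>R\<^esub> word.word_mult (\<rho> a) qs"
      by (simp add: linear_add[OF w aq na] linear_smult[OF w nu a] rho_mult[OF a q0])
    also have "\<dots> = hat_gen (p, ps) \<otimes>\<^bsub>R\<^esub> hat_gen (q, qs)"
      using hat_gen_mult_word[OF rho_closed[OF a] q0 nu qs deg0] rho_closed[OF a]
      by (simp add: True p q abelian_monoid.r_zero[OF addR] del: hat_gen.simps(1))
        (simp add: abelian_monoid.r_zero[OF addR])
    finally show ?thesis unfolding prod using omega_gen_closed[OF modA bg] hat_omega_gen[OF bg] by simp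
  next
    case False
    let ?i = "length ps" and ?p' = "p \<otimes>\<^bsub>?U\<^esub> (hd ps, \<zero>)"
    have hd: "hd ps \<in> carrier A" and last: "last ps \<in> carrier A"
      and tl: "tl ps \<in> lists (carrier A)" and butlast: "butlast ps \<in> lists (carrier A)"
      using False ps by (auto simp: in_lists_conv_set dest: list.set_sel in_set_butlastD)
    have nth: "ps ! l \<in> carrier A" if "l < ?i" for l using ps that by (auto simp: in_lists_conv_set)
    have p': "?p' \<in> carrier ?U" by (rule unitization_mult_closed[OF pU hd])
    note lq = A_mult_closed[OF last q0]
    note lin = word.word_mult_linear[OF qs]
    have tm: "omega_gen K A p1 (w @ qs) \<in> carrier ?W"
      "hat (omega_gen K A p1 (w @ qs)) = word.word_mult (hat_gen (p1, w)) qs"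
      if "p1 \<in> carrier ?U" "w \<in> lists (carrier A)" "w \<noteq> []" for p1 w
    proof -
      have g1: "(p1, w @ qs) \<in> omega_gens K A" by (rule omega_gensI) (use that qs in simp_all)
      show "omega_gen K A p1 (w @ qs) \<in> carrier ?W" by (rule omega_gen_closed[OF modA g1])
      show "hat (omega_gen K A p1 (w @ qs)) = word.word_mult (hat_gen (p1, w)) qs"
        unfolding hat_omega_gen[OF g1] by (rule hat_gen_append[OF that qs])
    qed
    define w where "w l = take (l - 1) ps @ (ps ! (l - 1) \<otimes>\<^bsub>A\<^esub> ps ! l) # drop (l + 1) ps @ [q0]" for l
    have w: "w l \<in> lists (carrier A)" "w l \<noteq> []" if "l \<in> {1..<?i}" for l
      using that ps q0 nth[of l] nth[of "l - 1"]
      by (auto simp: w_def A_mult_closed in_lists_conv_set dest: in_set_takeD in_set_dropD)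
    have Y: "butlast ps @ [last ps \<otimes>\<^bsub>A\<^esub> q0] \<in> lists (carrier A)" using butlast lq by simp
    have Z: "tl ps @ [q0] \<in> lists (carrier A)" using tl q0 by simp
    define TY where "TY = omega_gen K A p ((butlast ps @ [last ps \<otimes>\<^bsub>A\<^esub> q0]) @ qs)"
    define TF where "TF l = sign (?i - l) \<odot>\<^bsub>?W\<^esub> omega_gen K A p (w l @ qs)" for l
    define TZ where "TZ = sign ?i \<odot>\<^bsub>?W\<^esub> omega_gen K A ?p' ((tl ps @ [q0]) @ qs)"
    define TN where "TN = \<nu> \<odot>\<^bsub>?W\<^esub> omega_gen K A p (ps @ qs)"
    let ?S = "\<Oplus>\<^bsub>?W\<^esub>l\<in>{1..<?i}. TF l"
    have prod: "omega_gen_mult K A (p, ps) (q, qs) = TY \<oplus>\<^bsub>?W\<^esub> ?S \<oplus>\<^bsub>?W\<^esub> TZ \<oplus>\<^bsub>?W\<^esub> TN"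
      unfolding q omega_gen_mult_nonempty[OF False] TY_def TF_def TZ_def TN_def w_def by simp
    have TYc: "TY \<in> carrier ?W" unfolding TY_def by (rule tm(1)[OF pU Y]) simp
    have TFc: "TF \<in> {1..<?i} \<rightarrow> carrier ?W"
      unfolding TF_def using tm(1)[OF pU w] by (simp add: W.smult_closed)
    have Sc: "?S \<in> carrier ?W" by (rule W.finsum_closed[OF TFc])
    have TZc: "TZ \<in> carrier ?W" unfolding TZ_def
      by (rule W.smult_closed[OF sign_closed tm(1)[OF p' Z]]) simp
    have TNc: "TN \<in> carrier ?W" unfolding TN_def
      by (rule W.smult_closed[OF nu tm(1)[OF pU ps False]])
    let ?m = "\<lambda>x. word.word_mult x qs"
    have hY: "hat TY = ?m (hat_gen (p, butlast ps @ [last ps \<otimes>\<^bsub>A\<^esub> q0]))"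
      unfolding TY_def by (rule tm(2)[OF pU Y]) simp
    have hF: "hat (TF l) = ?m (sign (?i - l) \<odot>\<^bsub>R\<^esub> hat_gen (p, w l))" if "l \<in> {1..<?i}" for l
      unfolding TF_def linear_smult[OF hat_linear sign_closed tm(1)[OF pU w[OF that]]]
        linear_smult[OF lin sign_closed hat_gen_closed[OF pU w(1)[OF that]]] tm(2)[OF pU w[OF that]] ..
    have Fc: "(\<lambda>l. sign (?i - l) \<odot>\<^bsub>R\<^esub> hat_gen (p, w l)) \<in> {1..<?i} \<rightarrow> carrier R"
      using hat_gen_closed[OF pU w(1)] by (simp add: R_smult_closed)
    have hS: "hat ?S = ?m (\<Oplus>\<^bsub>R\<^esub>l\<in>{1..<?i}. sign (?i - l) \<odot>\<^bsub>R\<^esub> hat_gen (p, w l))"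
      unfolding linear_finsum[OF W.module_axioms modR hat_linear finite_atLeastLessThan TFc]
        linear_finsum[OF modR modR lin finite_atLeastLessThan Fc]
      by (rule abelian_monoid.finsum_cong'[OF addR refl _ hF])
        (use linear_closed[OF lin] Fc in \<open>auto simp: Pi_iff\<close>)
    have hZ: "hat TZ = ?m (sign ?i \<odot>\<^bsub>R\<^esub> hat_gen (?p', tl ps @ [q0]))"
      unfolding TZ_def
      by (simp only: linear_smult[OF hat_linear sign_closed tm(1)[OF p' Z]] snoc_eq_iff_butlast
          linear_smult[OF lin sign_closed hat_gen_closed[OF p' Z]] tm(2)[OF p' Z] not_False_eq_True simp_thms
          append_is_Nil_conv list.distinct)
    have hN: "hat TN = \<nu> \<odot>\<^bsub>R\<^esub> ?m (hat_gen (p, ps))"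
      unfolding TN_def linear_smult[OF hat_linear nu tm(1)[OF pU ps False]] tm(2)[OF pU ps False] ..
    have Sr: "(\<Oplus>\<^bsub>R\<^esub>l\<in>{1..<?i}. sign (?i - l) \<odot>\<^bsub>R\<^esub> hat_gen (p, w l)) \<in> carrier R"
      by (rule abelian_monoid.finsum_closed[OF addR Fc])
    have Yr: "hat_gen (p, butlast ps @ [last ps \<otimes>\<^bsub>A\<^esub> q0]) \<in> carrier R" by (rule hat_gen_closed[OF pU Y])
    have Zr: "sign ?i \<odot>\<^bsub>R\<^esub> hat_gen (?p', tl ps @ [q0]) \<in> carrier R"
      by (rule R_smult_closed[OF sign_closed hat_gen_closed[OF p' Z]])
    have "hat (omega_gen_mult K A (p, ps) (q, qs)) = hat TY \<oplus>\<^bsub>R\<^esub> hat ?S \<oplus>\<^bsub>R\<^esub> hat TZ \<oplus>\<^bsub>R\<^esub> hat TN"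
      unfolding prod using TYc Sc TZc TNc
      by (simp only: linear_add[OF hat_linear] W.a_closed)
    also have "\<dots> = ?m (hat_gen (p, ps) \<otimes>\<^bsub>R\<^esub> \<rho> q0) \<oplus>\<^bsub>R\<^esub> \<nu> \<odot>\<^bsub>R\<^esub> ?m (hat_gen (p, ps))"
      unfolding hat_gen_mult_rho[OF pU False ps q0] w_def[symmetric] hY hS hZ hN
      using Yr Sr Zr by (simp only: linear_add[OF lin] R_a_closed)
    also have "\<dots> = hat_gen (p, ps) \<otimes>\<^bsub>R\<^esub> hat_gen (q, qs)"
      unfolding q by (rule val[symmetric])
    finally show ?thesis using TYc Sc TZc TNc by (simp add: prod W.a_closed)
  qed
  then show "omega_gen_mult K A (p, ps) (q, qs) \<in> carrier ?W"
    and "hat (omega_gen_mult K A (p, ps) (q, qs)) = hat_gen (p, ps) \<otimes>\<^bsub>R\<^esub> hat_gen (q, qs)"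
    by blast+
qed

lemma hat_mult:
  assumes X: "X \<in> carrier (omega_module K A)" and Y: "Y \<in> carrier (omega_module K A)"
  shows "hat (X \<otimes>\<^bsub>Omega K A\<^esub> Y) = hat X \<otimes>\<^bsub>R\<^esub> hat Y"
proof -
  let ?W = "omega_module K A"
  note W = omega_module_module[OF modA]
  have "hat (lift K ?W (\<lambda>p. lift K ?W (omega_gen_mult K A p) Y) X) = hat X \<otimes>\<^bsub>R\<^esub> hat Y"
  proof (rule lift_omega_compare[OF modA W modR _ hat_linear _ _ X])
    show "(\<lambda>X. hat X \<otimes>\<^bsub>R\<^esub> hat Y) \<in> linear_maps K ?W R"
      by (rule linear_comp[OF hat_linear bilinear_left[OF R_mult_bilinear linear_closed[OF hat_linear Y]]])
    fix p as assume g: "(p, as) \<in> omega_gens K A"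
    show "lift K ?W (omega_gen_mult K A (p, as)) Y \<in> carrier ?W"
      by (rule lift_omega_closed[OF modA W _ Y]) (rule hat_omega_gen_mult(1)[OF g])
    have c: "hat_gen (p, as) \<in> carrier R" by (rule hat_gen_closed[OF omega_gensD(1,2)[OF g]])
    show "hat (lift K ?W (omega_gen_mult K A (p, as)) Y) = hat (omega_gen K A p as) \<otimes>\<^bsub>R\<^esub> hat Y"
      unfolding hat_omega_gen[OF g]
    proof (rule lift_omega_compare[OF modA W modR _ hat_linear _ _ Y])
      show "(\<lambda>Y. hat_gen (p, as) \<otimes>\<^bsub>R\<^esub> hat Y) \<in> linear_maps K ?W R"
        by (rule linear_comp[OF hat_linear bilinear_right[OF R_mult_bilinear c]])
      fix q bs assume h: "(q, bs) \<in> omega_gens K A"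
      show "omega_gen_mult K A (p, as) (q, bs) \<in> carrier ?W" by (rule hat_omega_gen_mult(1)[OF g h])
      show "hat (omega_gen_mult K A (p, as) (q, bs)) = hat_gen (p, as) \<otimes>\<^bsub>R\<^esub> hat (omega_gen K A q bs)"
        unfolding hat_omega_gen[OF h] by (rule hat_omega_gen_mult(2)[OF g h])
    qed
  qed
  then show ?thesis by (simp add: Omega_def Let_def)
qed

section \<open>Compatibility with the entwining\<close>

lemma hat_words:
  shows "X \<in> carrier (tpow K A (Suc n)) \<Longrightarrow> omega_word K A X \<in> carrier (Omega K A)"
    and "X \<in> carrier (tpow K A (Suc n)) \<Longrightarrow> hat (omega_word K A X) = lift K R (word.head_word \<rho>) X"
    and "X \<in> carrier (tpow K A (Suc n)) \<Longrightarrow> omega_dword K A X \<in> carrier (Omega K A)"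
    and "X \<in> carrier (tpow K A (Suc n)) \<Longrightarrow> hat (omega_dword K A X) = lift K R dword X"
proof -
  note W = Omega_module[OF modA]
  have hatO: "hat \<in> linear_maps K (Omega K A) R" unfolding linear_maps_Omega by (rule hat_linear)
  have g1: "((hd as, \<zero>), tl as) \<in> omega_gens K A" if "as \<in> tpow_words A (Suc n)" for as
    by (rule omega_gensI) (use that in \<open>cases as; auto simp: tpow_words_def unitization_simps\<close>)+
  have g2: "((\<zero>\<^bsub>A\<^esub>, \<one>), as) \<in> omega_gens K A" if "as \<in> tpow_words A (Suc n)" for as
    by (rule omega_gensI) (use that in \<open>auto simp: tpow_words_def unitization_simps\<close>)
  have c1: "omega_gen K A (hd as, \<zero>) (tl as) \<in> carrier (Omega K A)" if "as \<in> tpow_words A (Suc n)" for as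
    unfolding Omega_simps by (rule omega_gen_closed[OF modA g1[OF that]])
  have c2: "omega_gen K A (\<zero>\<^bsub>A\<^esub>, \<one>) as \<in> carrier (Omega K A)" if "as \<in> tpow_words A (Suc n)" for as
    unfolding Omega_simps by (rule omega_gen_closed[OF modA g2[OF that]])
  assume X: "X \<in> carrier (tpow K A (Suc n))"
  show "omega_word K A X \<in> carrier (Omega K A)"
    unfolding omega_word_def by (rule lift_tpow_closed[OF modA W c1 X])
  show "omega_dword K A X \<in> carrier (Omega K A)"
    unfolding omega_dword_def by (rule lift_tpow_closed[OF modA W c2 X])
  show "hat (omega_word K A X) = lift K R (word.head_word \<rho>) X"
    unfolding omega_word_def
  proof (rule lift_tpow_compare[OF modA W modR c1 hatO word.lift_head_word(1)[OF rho_linear] _ X])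
    fix as assume as: "as \<in> tpow_words A (Suc n)"
    then have "hd as \<in> carrier A" "tl as \<in> lists (carrier A)" by (cases as; auto simp: tpow_words_def)+
    then have wc: "word.word_mult (\<rho> (hd as)) (tl as) \<in> carrier R"
      by (intro word.word_mult_closed rho_closed)
    have "\<zero> \<odot>\<^bsub>R\<^esub> dword (tl as) = \<zero>\<^bsub>R\<^esub>" if "tl as \<noteq> []"
      by (rule module.smult_l_null[OF modR word.head_word_closed[OF word.tau_linear \<open>tl as \<in> _\<close> that]])
    then have "hat_gen ((hd as, \<zero>), tl as) = word.head_word \<rho> as"
      using wc by (simp add: word.head_word_def abelian_monoid.r_zero[OF addR])
    then show "hat (omega_gen K A (hd as, \<zero>) (tl as)) = lift K R (word.head_word \<rho>) (tpow_tens K A as)"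
      unfolding hat_omega_gen[OF g1[OF as]] word.lift_head_word(2)[OF rho_linear as] .
  qed
  show "hat (omega_dword K A X) = lift K R dword X"
    unfolding omega_dword_def
  proof (rule lift_tpow_compare[OF modA W modR c2 hatO word.lift_head_word(1)[OF word.tau_linear] _ X])
    fix as assume as: "as \<in> tpow_words A (Suc n)"
    then have as': "as \<in> lists (carrier A)" "as \<noteq> []" by (auto simp: tpow_words_def)
    have "word.word_mult (\<rho> \<zero>\<^bsub>A\<^esub>) as = \<zero>\<^bsub>R\<^esub>"
      by (rule linear_zero[OF modA modR word.word_mult_slot_linear(1)[OF rho_linear as'(1) as'(1)]])
    then have "hat_gen ((\<zero>\<^bsub>A\<^esub>, \<one>), as) = dword as"
      using as' word.head_word_closed[OF word.tau_linear as']
      by (simp add: abelian_monoid.l_zero[OF addR] module.smult_one[OF modR])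
    then show "hat (omega_gen K A (\<zero>\<^bsub>A\<^esub>, \<one>) as) = lift K R dword (tpow_tens K A as)"
      unfolding hat_omega_gen[OF g2[OF as]] word.lift_head_word(2)[OF word.tau_linear as] .
  qed
qed

text \<open>For \<open>\<sigma> = \<rho>\<close> the map \<open>f\<close> is \<open>omega_word\<close>, and for \<open>\<sigma> = D \<circ> \<rho>\<close> it is \<open>omega_dword\<close>; these are the two
  summands of \<open>psi_hat\<close>.\<close>

lemma hat_psi_iter:
  assumes c: "c \<in> carrier C" and a: "a \<in> carrier A" and as: "as \<in> lists (carrier A)"
    and f: "\<And>X. X \<in> carrier (tpow K A (Suc (length as))) \<Longrightarrow> f X \<in> carrier (Omega K A)"
    and hf: "\<And>X. X \<in> carrier (tpow K A (Suc (length as))) \<Longrightarrow> hat (f X) = lift K R (word.head_word \<sigma>) X"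
    and s: "\<sigma> \<in> entwined_maps K A R C \<psi> \<Psi>"
  shows "tensor_map K (Omega K A) C f id (psi_iter K A C \<psi> c (a # as)) \<in> carrier (tensor K (Omega K A) C)"
    and "tensor_map K R C hat id (tensor_map K (Omega K A) C f id (psi_iter K A C \<psi> c (a # as)))
      = \<Psi> (tens K C R c (word.word_mult (\<sigma> a) as))"
proof -
  note W = Omega_module[OF modA] and T = tpow_module[OF modA, of "Suc (length as)"]
  have hatO: "hat \<in> linear_maps K (Omega K A) R" unfolding linear_maps_Omega by (rule hat_linear)
  have "a # as \<in> lists (carrier A)" using a as by simp
  note iter = word.psi_iter_closed[OF c this, unfolded list.size add_0_right add_Suc_right]
  show "tensor_map K (Omega K A) C f id (psi_iter K A C \<psi> c (a # as)) \<in> carrier (tensor K (Omega K A) C)"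
    by (rule tensor_map_closed[OF T modC W modC f _ iter]) simp_all
  note h = word.lift_head_word(1)[OF entwined_linear[OF s]]
  have "tensor_map K R C hat id (tensor_map K (Omega K A) C f id (psi_iter K A C \<psi> c (a # as)))
      = tensor_map K R C (lift K R (word.head_word \<sigma>)) id (psi_iter K A C \<psi> c (a # as))"
  proof (rule tensor_map_compare[OF T modC W modC tensor_module[OF modR modC] f _
        tensor_map_linear[OF W modC modR modC hatO linear_id]
        tensor_map_linear[OF T modC modR modC h linear_id] _ iter])
    fix X e assume X: "X \<in> carrier (tpow K A (Suc (length as)))" and e: "e \<in> carrier C"
    show "tensor_map K R C hat id (tens K (Omega K A) C (f X) (id e))
        = tensor_map K R C (lift K R (word.head_word \<sigma>)) id (tens K (tpow K A (Suc (length as))) C X e)"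
      using tensor_map_tens[OF W modC modR modC hatO linear_id f[OF X] e]
        tensor_map_tens[OF T modC modR modC h linear_id X e]
      by (simp add: hf[OF X])
  qed simp_all
  then show "tensor_map K R C hat id (tensor_map K (Omega K A) C f id (psi_iter K A C \<psi> c (a # as)))
      = \<Psi> (tens K C R c (word.word_mult (\<sigma> a) as))"
    unfolding word.psi_iter_head_word[OF c a as s] .
qed

text \<open>The two nested \<open>lift\<close>s in \<open>psi_hat\<close> are compared on generators one after the other. On
  \<open>c \<otimes> (a + \<mu>) da\<^sub>1 \<dots> da\<^sub>n\<close> the claim is \<open>psi_iter_head_word\<close>, for \<open>\<sigma> = \<rho>\<close> and the word \<open>a, a\<^sub>1, \<dots>, a\<^sub>n\<close>
  plus \<open>\<mu>\<close> times the same for \<open>\<sigma> = D \<circ> \<rho>\<close> and \<open>a\<^sub>1, \<dots>, a\<^sub>n\<close>.\<close>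

lemma hat_psi_hat:
  assumes X: "X \<in> carrier (tensor K C (Omega K A))"
  shows "tensor_map K R C hat id (psi_hat K A C \<psi> X) = \<Psi> (tensor_map K C R id hat X)"
proof -
  let ?W = "Omega K A"
  let ?WC = "tensor K ?W C"
  note W = Omega_module[OF modA]
  note WC = tensor_module[OF W modC] and RC = tensor_module[OF modR modC]
  have hatO: "hat \<in> linear_maps K ?W R" unfolding linear_maps_Omega by (rule hat_linear)
  define u where "u c as = tensor_map K ?W C (omega_word K A) id (psi_iter K A C \<psi> c as)" for c as
  define v where "v c as = tensor_map K ?W C (omega_dword K A) id (psi_iter K A C \<psi> c as)" for c as
  define h where "h c = (\<lambda>((a, \<mu>), as). u c (a # as) \<oplus>\<^bsub>?WC\<^esub>
    (if as = [] then \<zero>\<^bsub>?WC\<^esub> else \<mu> \<odot>\<^bsub>?WC\<^esub> v c as))" for c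
  have psi_hat: "psi_hat K A C \<psi> = lift K ?WC (\<lambda>(c, Y). lift K ?WC (h c) Y)"
    unfolding psi_hat_def Let_def h_def u_def v_def ..
  have Psi: "\<Psi> \<in> linear_maps K (tensor K C R) (tensor K R C)"
  proof -
    have "nonunital_entwining K R C \<Psi>" by unfold_locales
    then show ?thesis by (rule nonunital_entwining.psi_linear)
  qed
  let ?L = "tensor_map K R C hat id"
  note L = tensor_map_linear[OF W modC modR modC hatO linear_id]
  have u: "u c (a # as) \<in> carrier ?WC" "?L (u c (a # as)) = \<Psi> (tens K C R c (word.word_mult (\<rho> a) as))"
    if "c \<in> carrier C" "a \<in> carrier A" "as \<in> lists (carrier A)" for c a as
    unfolding u_def
    by (rule hat_psi_iter[OF that hat_words(1,2) rho_entwined]; assumption)+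
  have v: "v c (a # as) \<in> carrier ?WC" "?L (v c (a # as)) = \<Psi> (tens K C R c (dword (a # as)))"
    if "c \<in> carrier C" "a \<in> carrier A" "as \<in> lists (carrier A)" for c a as
    unfolding v_def word.head_word_def list.sel
    by (rule hat_psi_iter[OF that hat_words(3,4) diff_rho_entwined]; assumption)+
  have h: "h c (p, as) \<in> carrier ?WC \<and> ?L (h c (p, as)) = \<Psi> (tens K C R c (hat_gen (p, as)))"
    if c: "c \<in> carrier C" and g: "(p, as) \<in> omega_gens K A" for c p as
  proof -
    interpret WC: module K ?WC by (rule WC)
    obtain a \<mu> where p: "p = (a, \<mu>)" and a: "a \<in> carrier A" and mu: "\<mu> \<in> carrier K"
      using omega_gensD(1)[OF g] by (auto simp: unitization_simps)
    note as = omega_gensD(2)[OF g]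
    note uc = u[OF c a as]
    note wc = word.word_mult_closed[OF rho_closed[OF a] as]
    note P = linear_comp[OF bilinear_right[OF tens_bilinear[OF modC modR] c] Psi]
    show ?thesis
    proof (cases as)
      case Nil
      then show ?thesis using uc wc rho_closed[OF a]
        by (simp add: h_def p abelian_monoid.r_zero[OF addR])
    next
      case (Cons b bs)
      then have b: "b \<in> carrier A" and bs: "bs \<in> lists (carrier A)" using as by auto
      note vc = v[OF c b bs, folded Cons]
      have d: "dword as \<in> carrier R"
        by (rule word.head_word_closed[OF word.tau_linear as]) (simp add: Cons)
      have hc: "h c (p, as) = u c (a # as) \<oplus>\<^bsub>?WC\<^esub> \<mu> \<odot>\<^bsub>?WC\<^esub> v c as"
        using Cons by (simp add: h_def p)
      have gc: "hat_gen (p, as) = word.word_mult (\<rho> a) as \<oplus>\<^bsub>R\<^esub> \<mu> \<odot>\<^bsub>R\<^esub> dword as"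
        using Cons by (simp add: p)
      have "?L (h c (p, as)) = ?L (u c (a # as)) \<oplus>\<^bsub>tensor K R C\<^esub> \<mu> \<odot>\<^bsub>tensor K R C\<^esub> ?L (v c as)"
        unfolding hc using uc(1) vc(1) mu
        by (simp only: linear_add[OF L] linear_smult[OF L] WC.smult_closed)
      also have "\<dots> = \<Psi> (tens K C R c (hat_gen (p, as)))"
        unfolding gc uc(2) vc(2) using wc d mu
        by (simp only: linear_add[OF P] linear_smult[OF P] R_smult_closed)
      finally show ?thesis using uc(1) vc(1) mu by (simp add: hc WC.a_closed WC.smult_closed)
    qed
  qed
  have inner: "lift K ?WC (h c) Y \<in> carrier ?WC"
    "?L (lift K ?WC (h c) Y) = \<Psi> (tens K C R c (hat Y))"
    if c: "c \<in> carrier C" and Y: "Y \<in> carrier ?W" for c Y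
  proof -
    note Y' = Y[unfolded Omega_simps]
    show "lift K ?WC (h c) Y \<in> carrier ?WC"
      by (rule lift_omega_closed[OF modA WC _ Y']) (use h[OF c] in blast)
    note P = linear_comp[OF bilinear_right[OF tens_bilinear[OF modC modR] c] Psi]
    show "?L (lift K ?WC (h c) Y) = \<Psi> (tens K C R c (hat Y))"
    proof (rule lift_omega_compare[OF modA WC RC _ L linear_comp[OF hat_linear P] _ Y'])
      fix p as assume g: "(p, as) \<in> omega_gens K A"
      show "h c (p, as) \<in> carrier ?WC" using h[OF c g] by blast
      show "?L (h c (p, as)) = \<Psi> (tens K C R c (hat (omega_gen K A p as)))"
        unfolding hat_omega_gen[OF g] using h[OF c g] by blast
    qed
  qed
  have "?L (lift K ?WC (\<lambda>(c, Y). lift K ?WC (h c) Y) X) = \<Psi> (tensor_map K C R id hat X)"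
  proof (rule lift_tensor_compare[OF modC W WC RC inner(1) L _ _ X])
    show "(\<lambda>X. \<Psi> (tensor_map K C R id hat X)) \<in> linear_maps K (tensor K C ?W) (tensor K R C)"
      by (rule linear_comp[OF tensor_map_linear[OF modC W modC modR linear_id hatO] Psi])
    fix c Y assume c: "c \<in> carrier C" and Y: "Y \<in> carrier ?W"
    show "?L (lift K ?WC (h c) Y) = \<Psi> (tensor_map K C R id hat (tens K C ?W c Y))"
      unfolding tensor_map_tens[OF modC W modC modR linear_id hatO c Y] inner(2)[OF c Y] by simp
  qed
  then show ?thesis unfolding psi_hat .
qed

lemma hat_dg_hom: "hat \<in> dg_algebra_hom K (Omega K A) R"
  unfolding dg_algebra_hom_def
proof (intro CollectI conjI ballI allI)
  show "hat \<in> linear_maps K (Omega K A) R" unfolding linear_maps_Omega by (rule hat_linear)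
  show "hat ` grade (Omega K A) n \<subseteq> grade R n" for n by (rule hat_grade)
  show "hat (X \<otimes>\<^bsub>Omega K A\<^esub> Y) = hat X \<otimes>\<^bsub>R\<^esub> hat Y"
    if "X \<in> carrier (Omega K A)" "Y \<in> carrier (Omega K A)" for X Y
    by (rule hat_mult[OF that[unfolded Omega_simps]])
  show "hat (diff (Omega K A) X) = diff R (hat X)" if "X \<in> carrier (Omega K A)" for X
    by (rule hat_diff[OF that[unfolded Omega_simps]])
qed

lemma hat_Omega_incl:
  assumes a: "a \<in> carrier A"
  shows "hat (Omega_incl K A a) = \<rho> a"
proof -
  have "((a, \<zero>), []) \<in> omega_gens K A"
    by (rule omega_gensI) (use a in \<open>simp_all add: unitization_simps\<close>)
  then show ?thesis
    by (simp add: Omega_incl_def hat_omega_gen rho_closed[OF a] abelian_monoid.r_zero[OF addR])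
qed

end

theorem theorem3p4:
  fixes K :: "('k, 'm) ring_scheme"
    and A :: "('k, 'a, 'l) module_scheme"
    and C :: "('k, 'c, 'o) coalg_scheme"
    and \<psi> :: "('c \<times> 'a \<Rightarrow> 'k) set \<Rightarrow> ('a \<times> 'c \<Rightarrow> 'k) set"
    and R :: "('k, 'r, 'n) dg_alg_scheme"
    and \<Psi> :: "('c \<times> 'r \<Rightarrow> 'k) set \<Rightarrow> ('r \<times> 'c \<Rightarrow> 'k) set"
    and \<rho> :: "'a \<Rightarrow> 'r"
  assumes "field K"
    and "entwining K A C \<psi>"
    and "dg_entwining_over K A C \<psi> R \<Psi> \<rho>"
  shows "\<exists>\<rho>hat. \<rho>hat \<in> dg_algebra_hom K (Omega K A) R \<and>
           (\<forall>a\<in>carrier A. \<rho>hat (Omega_incl K A a) = \<rho> a) \<and>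
           (\<forall>X\<in>carrier (tensor K C (Omega K A)).
              tensor_map K R C \<rho>hat id (psi_hat K A C \<psi> X)
                = \<Psi> (tensor_map K C R id \<rho>hat X))"
proof -
  interpret dg_entwining_over K A C \<psi> R \<Psi> \<rho> by fact
  show ?thesis
    by (intro exI[of _ hat] conjI ballI hat_dg_hom hat_Omega_incl hat_psi_hat)
qed

end
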